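(* Let $n$ be a positive integer, $Y$ a Banach space, $i,k$ nonnegative integers, $0<\alpha\le1$, $1\le p<+\infty$, $T\in\mathscr D'(\mathbf R^n,Y)$, and let $A$ be the set of points $a\in\mathbf R^n$ such that $T$ is $\nu_{i,p}$ pointwise differentiable of order $(k,\alpha)$ at $a$. Then there exist a sequence of functions $f_1,f_2,\dots$ of class $(k,\alpha)$ mapping $\mathbf R^n$ into $Y'$ and compact sets $C_1,C_2,\dots$ such that $A=\bigcup_{j=1}^\infty C_j$ and $$\mathrm{pt}\,D^mT(a)=D^mf_j(a)\quad\text{for every positive integer }j,\ a\in C_j,\ m\in\{0,\dots,k\}.$$
   Context: All vector spaces are real. $Y'$ is the topological dual of $Y$. $\mathscr D(\mathbf R^n,Y)$ is the space of smooth compactly supported functions $\mathbf R^n\to Y$; $\mathscr D_K(\mathbf R^n,Y)$ the subspace of those with support in the compact set $K$, topologized by the seminorms $\sup_{x\in K}\|D^j\theta(x)\|$. $\mathscr D'(\mathbf R^n,Y)$ is the space of distributions: linear $T:\mathscr D(\mathbf R^n,Y)\to\mathbf R$ continuous on each $\mathscr D_K(\mathbf R^n,Y)$. $\mathbf B(a,r)$ is the closed ball, $\mathscr L^n$ Lebesgue measure. A polynomial function $P:\mathbf R^n\to Y'$ is a finite sum of maps $x\mapsto\psi_m(x,\dots,x)$ with $\psi_m$ symmetric $m$-linear with values in $Y'$; it is identified with the distribution $P(\theta)=\int\langle\theta(x),P(x)\rangle\,d\mathscr L^n_x$. For a distribution $T$, $a\in\mathbf R^n$, $0<r<\infty$: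 $T^{a,r}(\theta)=r^{-n}T_x(\theta(r^{-1}(x-a)))$. $\nu_{i,p}(\theta)=\left(\int\|D^i\theta\|^p\,d\mathscr L^n\right)^{1/p}$ for $\theta\in\mathscr D_{\mathbf B(0,1)}(\mathbf R^n,Y)$. $T$ is $\nu_{i,p}$ pointwise differentiable of order $(k,\alpha)$ at $a$ iff there is a polynomial function $P:\mathbf R^n\to Y'$ of degree at most $k$ with $$\limsup_{r\to0^+}\sup\{r^{-k-\alpha}(T-P)^{a,r}(\theta):\theta\in\mathscr D_{\mathbf B(0,1)}(\mathbf R^n,Y),\ \nu_{i,p}(\theta)\le1\}<\infty.$$ In this case $T$ is also pointwise differentiable of order $k$ at $a$, meaning that $\lim_{r\to0^+}r^{-k}(T-P)^{a,r}(\theta)=0$ for every $\theta\in\mathscr D_{\mathbf B(0,1)}(\mathbf R^n,Y)$; the polynomial function $P$ of degree at most $k$ with this property is unique, and $\mathrm{pt}\,D^mT(a)=D^mP(a)$ for $0\le m\le k$. A function $f:\mathbf R^n\to Y'$ is of class $(k,\alpha)$ if it is $k$ times continuously differentiable and $D^kf$ locally satisfies a Hölder condition with exponent $\alpha$. *)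

theory Defs
  imports "HOL-Analysis.Analysis" "HOL-Library.Multiset"
begin

text \<open>
  An \<open>m\<close>-linear map is encoded as a function on argument lists; only its values on lists
  of length \<open>m\<close> are meaningful.
\<close>

definition sym_multilinear ::
    "nat \<Rightarrow> ('a::real_vector list \<Rightarrow> 'c::real_vector) \<Rightarrow> bool" where
  "sym_multilinear m \<psi> \<longleftrightarrow>
     (\<forall>vs i. length vs = m \<and> i < m \<longrightarrow> linear (\<lambda>v. \<psi> (vs[i := v]))) \<and>
     (\<forall>vs ws. length vs = m \<and> mset vs = mset ws \<longrightarrow> \<psi> vs = \<psi> ws)"

definition mnorm ::
    "nat \<Rightarrow> ('a::real_normed_vector list \<Rightarrow> 'c::real_normed_vector) \<Rightarrow> real" where
  "mnorm m \<psi> = (SUP vs\<in>{vs. length vs = m \<and> (\<forall>v\<in>set vs. norm v \<le> 1)}. norm (\<psi> vs))"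

fun iter_deriv ::
    "('a::real_normed_vector \<Rightarrow> 'c::real_normed_vector) \<Rightarrow> 'a list \<Rightarrow> 'a \<Rightarrow> 'c" where
  "iter_deriv f [] = f"
| "iter_deriv f (v # vs) = iter_deriv (\<lambda>x. frechet_derivative f (at x) v) vs"

text \<open>
  \<open>higher_deriv m f x\<close> is the \<open>m\<close>-th derivative of \<open>f\<close> at \<open>x\<close> as an \<open>m\<close>-linear map.
  It is set to zero on lists of the wrong length so that two derivatives agree as
  multilinear maps iff they are equal as functions.
\<close>

definition higher_deriv ::
    "nat \<Rightarrow> ('a::real_normed_vector \<Rightarrow> 'c::real_normed_vector) \<Rightarrow> 'a \<Rightarrow> 'a list \<Rightarrow> 'c" where
  "higher_deriv m f x = (\<lambda>vs. if length vs = m then iter_deriv f vs x else 0)"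

text \<open>
  \<open>k\<close> times continuously differentiable. Continuity of the derivative is required for each
  direction separately; on a finite-dimensional domain this is continuity in operator norm.
\<close>

fun C_diff ::
    "nat \<Rightarrow> (real^'n \<Rightarrow> 'c::real_normed_vector) \<Rightarrow> bool" where
  "C_diff 0 f \<longleftrightarrow> continuous_on UNIV f"
| "C_diff (Suc k) f \<longleftrightarrow>
     (\<forall>x. f differentiable (at x)) \<and>
     (\<forall>v. C_diff k (\<lambda>x. frechet_derivative f (at x) v))"

definition of_class ::
    "nat \<Rightarrow> real \<Rightarrow> (real^'n \<Rightarrow> 'c::real_normed_vector) \<Rightarrow> bool" where
  "of_class k \<alpha> f \<longleftrightarrow>
     C_diff k f \<and>
     (\<forall>a. \<exists>U M. open U \<and> a \<in> U \<and>
        (\<forall>x\<in>U. \<forall>y\<in>U.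
           mnorm k (\<lambda>vs. higher_deriv k f x vs - higher_deriv k f y vs)
             \<le> M * dist x y powr \<alpha>))"

definition test_functions :: "(real^'n \<Rightarrow> 'b::real_normed_vector) set" where
  "test_functions = {\<theta>. (\<forall>k. C_diff k \<theta>) \<and> compact (closure {x. \<theta> x \<noteq> 0})}"

definition test_functions_on ::
    "(real^'n) set \<Rightarrow> (real^'n \<Rightarrow> 'b::real_normed_vector) set" where
  "test_functions_on K = {\<theta> \<in> test_functions. closure {x. \<theta> x \<noteq> 0} \<subseteq> K}"

definition test_seminorm ::
    "(real^'n) set \<Rightarrow> nat \<Rightarrow> (real^'n \<Rightarrow> 'b::real_normed_vector) \<Rightarrow> real" where
  "test_seminorm K j \<theta> = (SUP x\<in>K. mnorm j (higher_deriv j \<theta> x))"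

definition test_topology ::
    "(real^'n) set \<Rightarrow> (real^'n \<Rightarrow> 'b::real_normed_vector) topology" where
  "test_topology K = topology_generated_by
     {{\<eta> \<in> test_functions_on K. test_seminorm K j (\<lambda>x. \<eta> x - \<theta> x) < e} | j \<theta> e.
        \<theta> \<in> test_functions_on K \<and> e > 0}"

text \<open>
  Distributions are total functions of which only the values on test functions matter.
\<close>

definition distribution :: "((real^'n \<Rightarrow> 'b::real_normed_vector) \<Rightarrow> real) \<Rightarrow> bool" where
  "distribution T \<longleftrightarrow>
     (\<forall>\<theta>\<in>test_functions. \<forall>\<eta>\<in>test_functions. T (\<lambda>x. \<theta> x + \<eta> x) = T \<theta> + T \<eta>) \<and>
     (\<forall>c. \<forall>\<theta>\<in>test_functions. T (\<lambda>x. c *\<^sub>R \<theta> x) = c * T \<theta>) \<and>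
     (\<forall>K. compact K \<longrightarrow> continuous_map (test_topology K) euclideanreal T)"

definition poly_fun ::
    "nat \<Rightarrow> (real^'n \<Rightarrow> 'c::real_vector) \<Rightarrow> bool" where
  "poly_fun k P \<longleftrightarrow>
     (\<exists>\<psi>. (\<forall>m\<le>k. sym_multilinear m (\<psi> m)) \<and>
          P = (\<lambda>x. \<Sum>m\<le>k. \<psi> m (replicate m x)))"

definition fun_distr ::
    "(real^'n \<Rightarrow> ('b::real_normed_vector \<Rightarrow>\<^sub>L real)) \<Rightarrow> (real^'n \<Rightarrow> 'b) \<Rightarrow> real" where
  "fun_distr P \<theta> = (LINT x|lborel. blinfun_apply (P x) (\<theta> x))"

definition rescale ::
    "((real^'n \<Rightarrow> 'b::real_normed_vector) \<Rightarrow> real) \<Rightarrow> real^'n \<Rightarrow> real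
      \<Rightarrow> (real^'n \<Rightarrow> 'b) \<Rightarrow> real" where
  "rescale T a r \<theta> = inverse r ^ CARD('n) * T (\<lambda>x. \<theta> (inverse r *\<^sub>R (x - a)))"

definition \<nu> ::
    "nat \<Rightarrow> real \<Rightarrow> (real^'n \<Rightarrow> 'b::real_normed_vector) \<Rightarrow> real" where
  "\<nu> i p \<theta> = (LINT x|lborel. mnorm i (higher_deriv i \<theta> x) powr p) powr (1 / p)"

definition nu_pt_differentiable ::
    "nat \<Rightarrow> real \<Rightarrow> nat \<Rightarrow> real \<Rightarrow> ((real^'n \<Rightarrow> 'b::real_normed_vector) \<Rightarrow> real)
      \<Rightarrow> real^'n \<Rightarrow> bool" where
  "nu_pt_differentiable i p k \<alpha> T a \<longleftrightarrow>
     (\<exists>P :: real^'n \<Rightarrow> ('b \<Rightarrow>\<^sub>L real). poly_fun k P \<and>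
        Limsup (at_right 0)
          (\<lambda>r. SUP \<theta>\<in>{\<theta> \<in> test_functions_on (cball 0 1). \<nu> i p \<theta> \<le> 1}.
             ereal (r powr (- real k - \<alpha>) * rescale (\<lambda>\<eta>. T \<eta> - fun_distr P \<eta>) a r \<theta>)) < \<infinity>)"

definition pt_approx ::
    "nat \<Rightarrow> ((real^'n \<Rightarrow> 'b::real_normed_vector) \<Rightarrow> real) \<Rightarrow> real^'n
      \<Rightarrow> (real^'n \<Rightarrow> ('b \<Rightarrow>\<^sub>L real)) \<Rightarrow> bool" where
  "pt_approx k T a P \<longleftrightarrow> poly_fun k P \<and>
     (\<forall>\<theta>\<in>test_functions_on (cball 0 1).
        ((\<lambda>r. r powr (- real k) * rescale (\<lambda>\<eta>. T \<eta> - fun_distr P \<eta>) a r \<theta>) \<longlongrightarrow> 0)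
          (at_right 0))"

text \<open>
  \<open>pt_deriv k T m a\<close> is the \<open>m\<close>-th pointwise derivative of \<open>T\<close> at \<open>a\<close> read off from the
  unique approximating polynomial of degree at most \<open>k\<close>; it is meaningful only if \<open>T\<close> is
  pointwise differentiable of order \<open>k\<close> at \<open>a\<close> and \<open>m \<le> k\<close>.
\<close>

definition pt_deriv ::
    "nat \<Rightarrow> ((real^'n \<Rightarrow> 'b::real_normed_vector) \<Rightarrow> real) \<Rightarrow> nat \<Rightarrow> real^'n
      \<Rightarrow> (real^'n) list \<Rightarrow> ('b \<Rightarrow>\<^sub>L real)" where
  "pt_deriv k T m a = higher_deriv m (THE P. pt_approx k T a P) a"

end

theory Submission
  imports Defs
begin

text \<open>
  Let \<open>P\<^sub>a\<close> be the polynomial attached to a point \<open>a\<close> of \<open>A\<close>. The set \<open>A\<close> is the union of the sets \<open>C j\<close> of those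
  \<open>a\<close> with \<open>norm a \<le> j\<close> at which \<open>(T - P\<^sub>a)^{a,r} \<le> j r^(k+\<alpha>)\<close> holds on admissible tests for all
  \<open>r < 1 / (j + 1)\<close>. It has to be shown that each \<open>C j\<close> is compact and that some function of class \<open>(k, \<alpha>)\<close>
  has the Taylor polynomial \<open>P\<^sub>a\<close> at every \<open>a\<close> in \<open>C j\<close>. Whitney's extension theorem would give the function, but
  the distribution \<open>T\<close> itself provides a more direct construction.

  Let \<open>\<phi>\<close> be a smooth kernel of mass 1 supported in the unit ball whose moments of degrees 1 to \<open>k\<close> vanish, and
  let \<open>g q = T * \<phi>\<^sub>\<rho>\<close> with \<open>\<rho> = \<rho> q\<close> decreasing geometrically. Convolution with \<open>\<phi>\<^sub>\<rho>\<close> reproduces \<open>P\<^sub>a\<close>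
  (\<open>conv_polynomial\<close>), and the value of \<open>(T - P\<^sub>a) * \<phi>\<^sub>\<rho>\<close> at a point within a few \<open>\<rho>\<close> of \<open>a\<close> is the value of
  \<open>T - P\<^sub>a\<close> on a test function of the kind controlled by the hypothesis (\<open>zoomed_kernel_estimate\<close>).
  Therefore the derivatives of order \<open>m\<close> of \<open>g q - P\<^sub>a\<close> are \<open>O(\<rho>^(k+\<alpha>-m))\<close> near \<open>a\<close>, uniformly in \<open>a\<close> (\<open>approx\<close>).
  This holds for every \<open>m\<close>, because a derivative of \<open>\<phi>\<close> is again a kernel.

  Away from the set the \<open>g q\<close> need not converge, so the extension is
  \<open>g 0 + (\<Sum>q. cut (q+1) * (g (q+1) - g q))\<close>, where \<open>cut q\<close> is a smooth cutoff to a neighbourhood of width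
  comparable with \<open>\<rho> q\<close>. On the support of a term, both \<open>g (q+1)\<close> and \<open>g q\<close> are close to one \<open>P\<^sub>a\<close>, so the
  \<open>m\<close>-th derivatives of the terms are \<open>O(\<rho>^(k+\<alpha>-m))\<close> everywhere (\<open>h_bound\<close>). The series may thus be
  differentiated \<open>k\<close> times. Near the set the partial sums \<open>F Q\<close> equal \<open>g Q\<close>, which yields the
  derivatives of \<open>P\<^sub>a\<close> at \<open>a\<close> in the limit (\<open>extension_agrees\<close>). For the Hoelder condition, the
  derivatives of order \<open>k + 1\<close> of \<open>F Q\<close> are \<open>O(\<rho>^(\<alpha>-1))\<close> (\<open>top_derivative_bound\<close>), and one compares
  points at distance about \<open>\<rho> Q\<close> through \<open>F Q\<close> (\<open>extension_holder\<close>).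

  Compactness follows afterwards: on \<open>C j\<close> the \<open>P\<^sub>a\<close> are the Taylor polynomials of a single function of
  class \<open>k\<close>, so they depend continuously on \<open>a\<close>, and the estimate passes to limits of points
  (\<open>uniform_approximation_set\<close>). Finally, \<open>P\<^sub>a\<close> is the only polynomial approximating \<open>T\<close> at \<open>a\<close>
  (\<open>pt_approx_unique\<close>), so its derivatives at \<open>a\<close> are the pointwise derivatives of \<open>T\<close>.
\<close>

section \<open>Calculus of iterated directional derivatives\<close>

text \<open>
  Everything below is phrased through the derivatives of \<open>f\<close> along a fixed list of directions.
  Since the domain is finite dimensional, lists of basis vectors suffice in the end, so all
  constants may depend on the list.
\<close>

abbreviation ddir :: "'a::real_normed_vector \<Rightarrow> ('a \<Rightarrow> 'c::real_normed_vector) \<Rightarrow> 'a \<Rightarrow> 'c" where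
  "ddir v f \<equiv> (\<lambda>x. frechet_derivative f (at x) v)"

definition smooth :: "(real^'n \<Rightarrow> 'c::real_normed_vector) \<Rightarrow> bool" where
  "smooth f \<longleftrightarrow> (\<forall>k. C_diff k f)"

lemma C_diff_SucI:
  assumes "\<And>x. (f has_derivative F x) (at x)" and "\<And>v. C_diff k (\<lambda>x. F x v)"
  shows "C_diff (Suc k) f"
proof -
  have "frechet_derivative f (at x) = F x" for x
    using frechet_derivative_at[OF assms(1)] by simp
  then show ?thesis using assms by (auto simp: differentiable_def)
qed

lemma C_diff_has_derivative:
  "C_diff (Suc k) f \<Longrightarrow> (f has_derivative frechet_derivative f (at x)) (at x)"
  by (simp add: frechet_derivative_works)

lemma C_diff_Suc_D: "C_diff (Suc k) f \<Longrightarrow> C_diff k f"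
proof (induction k arbitrary: f)
  case 0
  then show ?case
    by (auto intro!: continuous_at_imp_continuous_on differentiable_imp_continuous_within)
next
  case (Suc k)
  then show ?case by (metis C_diff.simps(2))
qed

lemma C_diff_mono: "C_diff k f \<Longrightarrow> m \<le> k \<Longrightarrow> C_diff m f"
  by (induction k) (auto simp del: C_diff.simps simp: le_Suc_eq dest: C_diff_Suc_D)

lemma C_diff_imp_continuous: "C_diff k f \<Longrightarrow> continuous_on S f"
  using C_diff_mono[of k f 0] by (auto intro: continuous_on_subset)

lemma smooth_C_diff: "smooth f \<Longrightarrow> C_diff k f"
  by (simp add: smooth_def)

lemma smooth_continuous: "smooth f \<Longrightarrow> continuous_on S f"
  using C_diff_imp_continuous smooth_C_diff by blast

lemma smooth_has_derivative: "smooth f \<Longrightarrow> (f has_derivative frechet_derivative f (at x)) (at x)"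
  using C_diff_has_derivative smooth_C_diff by blast

lemma smooth_ddir: "smooth f \<Longrightarrow> smooth (ddir v f)"
  unfolding smooth_def by (metis C_diff.simps(2))

lemma C_diff_const: "C_diff k (\<lambda>x. c)"
proof (induction k arbitrary: c)
  case (Suc k)
  then show ?case by (intro C_diff_SucI[where F="\<lambda>x v. 0"]) auto
qed simp

lemma C_diff_add: "C_diff k f \<Longrightarrow> C_diff k g \<Longrightarrow> C_diff k (\<lambda>x. f x + g x)"
proof (induction k arbitrary: f g)
  case 0
  then show ?case by (auto intro: continuous_intros)
next
  case (Suc k)
  show ?case
    by (rule C_diff_SucI[where F="\<lambda>x v. frechet_derivative f (at x) v + frechet_derivative g (at x) v"])
      (use Suc in \<open>auto intro!: has_derivative_add C_diff_has_derivative Suc.IH simp: frechet_derivative_works\<close>)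
qed

lemma C_diff_bounded_linear:
  assumes L: "bounded_linear L"
  shows "C_diff k f \<Longrightarrow> C_diff k (\<lambda>x. L (f x))"
proof (induction k arbitrary: f)
  case 0
  then show ?case using bounded_linear.continuous_on[OF L] by auto
next
  case (Suc k)
  show ?case
    by (rule C_diff_SucI[where F="\<lambda>x v. L (frechet_derivative f (at x) v)"])
      (use Suc in \<open>auto intro!: bounded_linear.has_derivative[OF L] simp: frechet_derivative_works\<close>)
qed

lemma C_diff_scaleR:
  fixes f :: "real^'n \<Rightarrow> real"
  shows "C_diff k f \<Longrightarrow> C_diff k g \<Longrightarrow> C_diff k (\<lambda>x. f x *\<^sub>R g x)"
proof (induction k arbitrary: f g)
  case 0
  then show ?case by (auto intro: continuous_intros)
next
  case (Suc k)
  show ?case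
  proof (rule C_diff_SucI[where F="\<lambda>x v. f x *\<^sub>R ddir v g x + ddir v f x *\<^sub>R g x"])
    show "((\<lambda>x. f x *\<^sub>R g x) has_derivative
          (\<lambda>v. f x *\<^sub>R ddir v g x + ddir v f x *\<^sub>R g x)) (at x)" for x
      using Suc.prems by (intro has_derivative_scaleR C_diff_has_derivative)
    show "C_diff k (\<lambda>x. f x *\<^sub>R ddir v g x + ddir v f x *\<^sub>R g x)" for v
      using Suc.prems C_diff_Suc_D[of k f] C_diff_Suc_D[of k g]
      by (intro C_diff_add Suc.IH) auto
  qed
qed

lemma C_diff_affine: "C_diff k f \<Longrightarrow> C_diff k (\<lambda>x. f (c *\<^sub>R x + b))"
proof (induction k arbitrary: f)
  case 0
  then show ?case by (auto intro!: continuous_on_compose2[of UNIV f] continuous_intros)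
next
  case (Suc k)
  show ?case
  proof (rule C_diff_SucI[where F="\<lambda>x v. c *\<^sub>R ddir v f (c *\<^sub>R x + b)"])
    show "((\<lambda>x. f (c *\<^sub>R x + b)) has_derivative (\<lambda>v. c *\<^sub>R ddir v f (c *\<^sub>R x + b))) (at x)" for x
    proof -
      have d: "(f has_derivative frechet_derivative f (at (c *\<^sub>R x + b))) (at (c *\<^sub>R x + b))"
        using Suc.prems C_diff_has_derivative by blast
      have "((\<lambda>x. c *\<^sub>R x + b) has_derivative (\<lambda>v. c *\<^sub>R v)) (at x)"
        by (auto intro!: derivative_eq_intros)
      from has_derivative_compose[OF this d] show ?thesis
        using linear_cmul[OF has_derivative_linear[OF d]] by simp
    qed
    show "C_diff k (\<lambda>x. c *\<^sub>R ddir v f (c *\<^sub>R x + b))" for v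
      using Suc by (intro C_diff_bounded_linear[OF bounded_linear_scaleR_right] Suc.IH) auto
  qed
qed

lemma C_diff_sum: "(\<And>i. i \<in> I \<Longrightarrow> C_diff k (f i)) \<Longrightarrow> C_diff k (\<lambda>x. \<Sum>i\<in>I. f i x)"
proof (induction I rule: infinite_finite_induct)
  case (insert i I)
  then show ?case by (simp add: C_diff_add)
qed (simp_all add: C_diff_const)

lemma C_diff_linear:
  assumes L: "bounded_linear L" shows "C_diff k L"
proof (cases k)
  case 0
  then show ?thesis using linear_continuous_on[OF L] by simp
next
  case (Suc m)
  then show ?thesis
    by (simp only:, intro C_diff_SucI[where F="\<lambda>x v. L v"] C_diff_const)
      (rule bounded_linear_imp_has_derivative[OF L])
qed

lemma smooth_const: "smooth (\<lambda>x. a)"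
  and smooth_add: "smooth f \<Longrightarrow> smooth g \<Longrightarrow> smooth (\<lambda>x. f x + g x)"
  and smooth_bounded_linear: "bounded_linear L \<Longrightarrow> smooth f \<Longrightarrow> smooth (\<lambda>x. L (f x))"
  and smooth_scaleR: "smooth h \<Longrightarrow> smooth f \<Longrightarrow> smooth (\<lambda>x. h x *\<^sub>R f x)"
  and smooth_affine: "smooth f \<Longrightarrow> smooth (\<lambda>x. f (c *\<^sub>R x + b))"
  and smooth_sum: "(\<And>i. i \<in> I \<Longrightarrow> smooth (F i)) \<Longrightarrow> smooth (\<lambda>x. \<Sum>i\<in>I. F i x)"
  and smooth_linear: "bounded_linear f \<Longrightarrow> smooth f"
  by (simp_all add: smooth_def C_diff_const C_diff_add C_diff_bounded_linear C_diff_scaleR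
      C_diff_affine C_diff_sum C_diff_linear)

lemma smooth_cmul: "smooth f \<Longrightarrow> smooth (\<lambda>x. c *\<^sub>R f x)"
  by (rule smooth_bounded_linear[OF bounded_linear_scaleR_right])

lemma smooth_diff: "smooth f \<Longrightarrow> smooth g \<Longrightarrow> smooth (\<lambda>x. f x - g x)"
  using smooth_add[of f "\<lambda>x. - 1 *\<^sub>R g x"] smooth_cmul[of g "- 1"] by simp

lemma ddir_eqI: "(f has_derivative F) (at x) \<Longrightarrow> ddir v f x = F v"
  by (metis frechet_derivative_at)

lemma iter_deriv_add:
  "C_diff m f \<Longrightarrow> C_diff m g \<Longrightarrow> length vs \<le> m \<Longrightarrow>
    iter_deriv (\<lambda>x. f x + g x) vs = (\<lambda>x. iter_deriv f vs x + iter_deriv g vs x)"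
proof (induction vs arbitrary: f g m)
  case (Cons v vs)
  then obtain m' where m: "m = Suc m'" by (cases m) auto
  have "ddir v (\<lambda>x. f x + g x) = (\<lambda>x. ddir v f x + ddir v g x)"
    using Cons.prems m by (intro ext ddir_eqI has_derivative_add C_diff_has_derivative) auto
  then show ?case using Cons.IH[where f="ddir v f" and g="ddir v g" and m=m'] Cons.prems m by simp
qed simp

lemma iter_deriv_bounded_linear:
  assumes L: "bounded_linear L"
  shows "C_diff m f \<Longrightarrow> length vs \<le> m \<Longrightarrow>
    iter_deriv (\<lambda>x. L (f x)) vs = (\<lambda>x. L (iter_deriv f vs x))"
proof (induction vs arbitrary: f m)
  case (Cons v vs)
  then obtain m' where m: "m = Suc m'" by (cases m) auto
  have "ddir v (\<lambda>x. L (f x)) = (\<lambda>x. L (ddir v f x))"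
    using Cons.prems m
    by (intro ext ddir_eqI bounded_linear.has_derivative[OF L] C_diff_has_derivative) auto
  then show ?case using Cons.IH[where f="ddir v f" and m=m'] Cons.prems m by simp
qed simp

lemma iter_deriv_zero: "iter_deriv (\<lambda>x. 0) vs = (\<lambda>x. 0)"
  by (induction vs) auto

lemma iter_deriv_affine:
  "smooth f \<Longrightarrow>
    iter_deriv (\<lambda>x. f (c *\<^sub>R x + b)) vs = (\<lambda>x. c ^ length vs *\<^sub>R iter_deriv f vs (c *\<^sub>R x + b))"
proof (induction vs arbitrary: f)
  case (Cons v vs)
  have dd: "ddir v (\<lambda>x. f (c *\<^sub>R x + b)) = (\<lambda>x. c *\<^sub>R ddir v f (c *\<^sub>R x + b))"
  proof
    fix x
    have d: "(f has_derivative frechet_derivative f (at (c *\<^sub>R x + b))) (at (c *\<^sub>R x + b))"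
      using Cons.prems smooth_has_derivative by blast
    have "((\<lambda>x. c *\<^sub>R x + b) has_derivative (\<lambda>v. c *\<^sub>R v)) (at x)"
      by (auto intro!: derivative_eq_intros)
    from has_derivative_compose[OF this d]
    show "ddir v (\<lambda>x. f (c *\<^sub>R x + b)) x = c *\<^sub>R ddir v f (c *\<^sub>R x + b)"
      using linear_cmul[OF has_derivative_linear[OF d]] by (simp add: ddir_eqI)
  qed
  have s: "smooth (ddir v f)" using Cons.prems by (rule smooth_ddir)
  have "iter_deriv (\<lambda>x. c *\<^sub>R ddir v f (c *\<^sub>R x + b)) vs =
      (\<lambda>x. c *\<^sub>R iter_deriv (\<lambda>x. ddir v f (c *\<^sub>R x + b)) vs x)"
    by (rule iter_deriv_bounded_linear[OF bounded_linear_scaleR_right smooth_C_diff])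
      (use smooth_affine[OF s] in auto)
  then show ?case by (simp add: dd Cons.IH[OF s] mult.commute)
qed simp

lemma C_diff_iter_deriv: "C_diff (m + length vs) f \<Longrightarrow> C_diff m (iter_deriv f vs)"
  by (induction vs arbitrary: f) auto

lemma smooth_iter_deriv: "smooth f \<Longrightarrow> smooth (iter_deriv f vs)"
  unfolding smooth_def using C_diff_iter_deriv by blast

lemma iter_deriv_append: "iter_deriv f (us @ vs) = iter_deriv (iter_deriv f us) vs"
  by (induction us arbitrary: f) auto

lemma iter_deriv_snoc: "iter_deriv f (vs @ [v]) = ddir v (iter_deriv f vs)"
  by (simp add: iter_deriv_append)

lemma iter_deriv_cmul:
  "C_diff m f \<Longrightarrow> length vs \<le> m \<Longrightarrow> iter_deriv (\<lambda>x. c *\<^sub>R f x) vs = (\<lambda>x. c *\<^sub>R iter_deriv f vs x)"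
  by (rule iter_deriv_bounded_linear[OF bounded_linear_scaleR_right])

lemma iter_deriv_diff:
  assumes "C_diff m f" "C_diff m g" "length vs \<le> m"
  shows "iter_deriv (\<lambda>x. f x - g x) vs = (\<lambda>x. iter_deriv f vs x - iter_deriv g vs x)"
proof -
  have "iter_deriv (\<lambda>x. f x + - 1 *\<^sub>R g x) vs =
      (\<lambda>x. iter_deriv f vs x + iter_deriv (\<lambda>x. - 1 *\<^sub>R g x) vs x)"
    using assms by (intro iter_deriv_add[where m=m] C_diff_bounded_linear[OF bounded_linear_scaleR_right])
  then show ?thesis using iter_deriv_cmul[OF assms(2,3), of "- 1"] by simp
qed

lemma iter_deriv_sum:
  "(\<And>i. i \<in> I \<Longrightarrow> C_diff m (f i)) \<Longrightarrow> length vs \<le> m \<Longrightarrow>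
    iter_deriv (\<lambda>x. \<Sum>i\<in>I. f i x) vs = (\<lambda>x. \<Sum>i\<in>I. iter_deriv (f i) vs x)"
proof (induction I rule: infinite_finite_induct)
  case (insert i I)
  then show ?case by (simp add: iter_deriv_add[where m=m] C_diff_sum)
qed (simp_all add: iter_deriv_zero)

lemma smooth_iter_deriv_add: "smooth f \<Longrightarrow> smooth g \<Longrightarrow>
    iter_deriv (\<lambda>x. f x + g x) vs = (\<lambda>x. iter_deriv f vs x + iter_deriv g vs x)"
  and smooth_iter_deriv_diff: "smooth f \<Longrightarrow> smooth g \<Longrightarrow>
    iter_deriv (\<lambda>x. f x - g x) vs = (\<lambda>x. iter_deriv f vs x - iter_deriv g vs x)"
  and smooth_iter_deriv_cmul: "smooth f \<Longrightarrow>
    iter_deriv (\<lambda>x. c *\<^sub>R f x) vs = (\<lambda>x. c *\<^sub>R iter_deriv f vs x)"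
  and smooth_iter_deriv_bounded_linear: "bounded_linear L \<Longrightarrow> smooth f \<Longrightarrow>
    iter_deriv (\<lambda>x. L (f x)) vs = (\<lambda>x. L (iter_deriv f vs x))"
  and smooth_iter_deriv_sum: "(\<And>i. i \<in> I \<Longrightarrow> smooth (F i)) \<Longrightarrow>
    iter_deriv (\<lambda>x. \<Sum>i\<in>I. F i x) vs = (\<lambda>x. \<Sum>i\<in>I. iter_deriv (F i) vs x)"
  by (simp_all add: smooth_C_diff iter_deriv_add[OF _ _ order_refl] iter_deriv_diff[OF _ _ order_refl]
      iter_deriv_cmul[OF _ order_refl] iter_deriv_bounded_linear[OF _ _ order_refl]
      iter_deriv_sum[OF _ order_refl])

text \<open>
  The smoothness hypotheses matter because \<open>frechet_derivative\<close> is an arbitrary choice at points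
  where no derivative exists.
\<close>

lemma iter_deriv_local:
  assumes "open U" and "smooth f" and "smooth g" and "\<And>x. x \<in> U \<Longrightarrow> f x = g x"
  shows "x \<in> U \<Longrightarrow> iter_deriv f vs x = iter_deriv g vs x"
  using assms(2-)
proof (induction vs arbitrary: f g x)
  case (Cons v vs)
  have "ddir v f y = ddir v g y" if "y \<in> U" for y
  proof -
    have "(g has_derivative frechet_derivative f (at y)) (at y)"
      using has_derivative_transform_within_open[OF smooth_has_derivative[OF Cons.prems(2)] \<open>open U\<close> that]
        Cons.prems(4) by blast
    then show ?thesis by (simp add: ddir_eqI)
  qed
  then show ?case
    using Cons.IH[of x "ddir v f" "ddir v g"] Cons.prems smooth_ddir by auto
qed simp

lemma iter_deriv_multilinear:
  assumes "C_diff m f" "length vs \<le> m" "i < length vs"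
  shows "linear (\<lambda>v. iter_deriv f (vs[i := v]) x)"
  using assms
proof (induction vs arbitrary: f i m)
  case (Cons w vs)
  then obtain m' where m: "m = Suc m'" by (cases m) auto
  show ?case
  proof (cases i)
    case 0
    have lin: "linear (frechet_derivative f (at y))" for y
      using Cons.prems m C_diff_has_derivative has_derivative_linear by blast
    have C: "C_diff m' (ddir v f)" for v using Cons.prems m by simp
    show ?thesis
    proof (rule linearI)
      fix u v and c :: real
      show "iter_deriv f ((w # vs)[i := u + v]) x
          = iter_deriv f ((w # vs)[i := u]) x + iter_deriv f ((w # vs)[i := v]) x"
        using Cons.prems m iter_deriv_add[OF C C, of vs u v] by (simp add: 0 linear_add[OF lin])
      show "iter_deriv f ((w # vs)[i := c *\<^sub>R u]) x = c *\<^sub>R iter_deriv f ((w # vs)[i := u]) x"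
        using Cons.prems m iter_deriv_cmul[OF C, of vs c u] by (simp add: 0 linear_cmul[OF lin])
    qed
  next
    case (Suc j)
    then show ?thesis using Cons.IH[of m' "ddir w f" j] Cons.prems m by simp
  qed
qed simp

lemma smooth_line_derivative:
  assumes "smooth g"
  shows "((\<lambda>t. g (b + t *\<^sub>R w)) has_vector_derivative ddir w g (b + t *\<^sub>R w)) (at t)"
proof -
  have "((\<lambda>t. b + t *\<^sub>R w) has_derivative (\<lambda>h. h *\<^sub>R w)) (at t)"
    by (auto intro!: derivative_eq_intros)
  from has_derivative_compose[OF this smooth_has_derivative[OF assms, of "b + t *\<^sub>R w"]]
  show ?thesis
    using linear_cmul[OF has_derivative_linear[OF smooth_has_derivative[OF assms]]]
    by (simp add: has_vector_derivative_def)
qed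

text \<open>
  Schwarz's theorem. Convolution differentiates the kernel first in the direction \<open>u\<close>, whereas the
  seminorms differentiate the result in directions \<open>bs\<close>; comparing the two requires the order to be
  immaterial. The symmetry of the Taylor coefficients of a polynomial comes from here as well.
\<close>

lemma ddir_commute:
  fixes f :: "real^'n \<Rightarrow> real"
  assumes f: "smooth f"
  shows "ddir u (ddir v f) x = ddir v (ddir u f) x"
proof -
  \<comment> \<open>Applying the mean value theorem in direction \<open>u\<close> and then in direction \<open>v\<close> makes the second
    difference \<open>s\<^sup>2\<close> times a value of the mixed derivative near \<open>x\<close>; the second difference itself is
    symmetric in \<open>u\<close> and \<open>v\<close>.\<close>
  have key: "\<exists>\<xi> \<eta>. 0 < \<xi> \<and> \<xi> < s \<and> 0 < \<eta> \<and> \<eta> < s \<and>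
      f (x + s *\<^sub>R u + s *\<^sub>R v) - f (x + s *\<^sub>R u) - f (x + s *\<^sub>R v) + f x
        = s * (s * ddir v (ddir u f) (x + \<xi> *\<^sub>R u + \<eta> *\<^sub>R v))" if s: "s > 0" for s :: real and u v
  proof -
    have line: "((\<lambda>t. g (b + t *\<^sub>R w)) has_real_derivative ddir w g (b + t *\<^sub>R w)) (at t)"
      if "smooth g" for g :: "real^'n \<Rightarrow> real" and b w t
      using smooth_line_derivative[OF that] by (simp add: has_real_derivative_iff_has_vector_derivative)
    have "\<exists>\<xi>>0. \<xi> < s \<and> (f (x + s *\<^sub>R v + s *\<^sub>R u) - f (x + s *\<^sub>R u)) -
        (f (x + s *\<^sub>R v + 0 *\<^sub>R u) - f (x + 0 *\<^sub>R u))
        = (s - 0) * (ddir u f (x + s *\<^sub>R v + \<xi> *\<^sub>R u) - ddir u f (x + \<xi> *\<^sub>R u))"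
      by (rule MVT2[OF s]) (intro DERIV_diff line[OF f])
    then obtain \<xi> where xi: "0 < \<xi>" "\<xi> < s" "(f (x + s *\<^sub>R v + s *\<^sub>R u) - f (x + s *\<^sub>R u)) -
        (f (x + s *\<^sub>R v + 0 *\<^sub>R u) - f (x + 0 *\<^sub>R u))
        = s * (ddir u f (x + s *\<^sub>R v + \<xi> *\<^sub>R u) - ddir u f (x + \<xi> *\<^sub>R u))" by auto
    have "\<exists>\<eta>>0. \<eta> < s \<and> ddir u f ((x + \<xi> *\<^sub>R u) + s *\<^sub>R v) - ddir u f ((x + \<xi> *\<^sub>R u) + 0 *\<^sub>R v)
        = (s - 0) * ddir v (ddir u f) ((x + \<xi> *\<^sub>R u) + \<eta> *\<^sub>R v)"
      by (rule MVT2[OF s]) (rule line[OF smooth_ddir[OF f]])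
    then obtain \<eta> where "0 < \<eta>" "\<eta> < s" "ddir u f ((x + \<xi> *\<^sub>R u) + s *\<^sub>R v) - ddir u f (x + \<xi> *\<^sub>R u)
        = s * ddir v (ddir u f) ((x + \<xi> *\<^sub>R u) + \<eta> *\<^sub>R v)" by auto
    with xi show ?thesis
      by (intro exI[of _ \<xi>] exI[of _ \<eta>]) (simp add: algebra_simps)
  qed
  have near: "\<exists>\<delta>>0. \<forall>s \<xi> \<eta>. 0 < s \<and> s < \<delta> \<and> 0 < \<xi> \<and> \<xi> < s \<and> 0 < \<eta> \<and> \<eta> < s \<longrightarrow>
      \<bar>g (x + \<xi> *\<^sub>R u + \<eta> *\<^sub>R v) - g x\<bar> < e" if g: "smooth g" and "e > 0"
    for g :: "real^'n \<Rightarrow> real" and e u v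
  proof -
    have "isCont g x" using smooth_continuous[OF g, of UNIV] by (simp add: continuous_on_eq_continuous_at)
    then obtain d where d: "d > 0" "\<And>y. dist y x < d \<Longrightarrow> dist (g y) (g x) < e"
      using \<open>e > 0\<close> unfolding continuous_at_eps_delta by blast
    let ?M = "norm u + norm v + 1"
    have M: "?M > 0" by (smt (verit) norm_ge_zero)
    show ?thesis
    proof (intro exI[of _ "d / ?M"] conjI allI impI)
      show "d / ?M > 0" using d M by simp
      fix s \<xi> \<eta> :: real assume h: "0 < s \<and> s < d / ?M \<and> 0 < \<xi> \<and> \<xi> < s \<and> 0 < \<eta> \<and> \<eta> < s"
      have "dist (x + \<xi> *\<^sub>R u + \<eta> *\<^sub>R v) x = norm (\<xi> *\<^sub>R u + \<eta> *\<^sub>R v)" by (simp add: dist_norm add.assoc)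
      also have "\<dots> \<le> \<xi> * norm u + \<eta> * norm v" using norm_triangle_ineq[of "\<xi> *\<^sub>R u" "\<eta> *\<^sub>R v"] h by simp
      also have "\<dots> \<le> s * norm u + s * norm v" using h by (intro add_mono mult_right_mono) auto
      also have "\<dots> \<le> s * ?M" using h by (simp add: algebra_simps)
      also have "\<dots> < d" using h M by (simp add: pos_less_divide_eq)
      finally show "\<bar>g (x + \<xi> *\<^sub>R u + \<eta> *\<^sub>R v) - g x\<bar> < e" using d(2) by (simp add: dist_real_def)
    qed
  qed
  have "\<bar>ddir u (ddir v f) x - ddir v (ddir u f) x\<bar> \<le> e" if e: "e > 0" for e
  proof -
    obtain d1 where d1: "d1 > 0" "\<And>s \<xi> \<eta>. 0 < s \<Longrightarrow> s < d1 \<Longrightarrow> 0 < \<xi> \<Longrightarrow> \<xi> < s \<Longrightarrow> 0 < \<eta> \<Longrightarrow> \<eta> < s \<Longrightarrow>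
      \<bar>ddir v (ddir u f) (x + \<xi> *\<^sub>R u + \<eta> *\<^sub>R v) - ddir v (ddir u f) x\<bar> < e / 2"
      using near[where g="ddir v (ddir u f)" and e="e/2" and u=u and v=v] smooth_ddir f e
      by (metis half_gt_zero)
    obtain d2 where d2: "d2 > 0" "\<And>s \<xi> \<eta>. 0 < s \<Longrightarrow> s < d2 \<Longrightarrow> 0 < \<xi> \<Longrightarrow> \<xi> < s \<Longrightarrow> 0 < \<eta> \<Longrightarrow> \<eta> < s \<Longrightarrow>
      \<bar>ddir u (ddir v f) (x + \<xi> *\<^sub>R v + \<eta> *\<^sub>R u) - ddir u (ddir v f) x\<bar> < e / 2"
      using near[where g="ddir u (ddir v f)" and e="e/2" and u=v and v=u] smooth_ddir f e
      by (metis half_gt_zero)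
    define s where "s = min d1 d2 / 2"
    have s: "s > 0" "s < d1" "s < d2" using d1(1) d2(1) by (auto simp: s_def)
    obtain \<xi> \<eta> where a: "0 < \<xi>" "\<xi> < s" "0 < \<eta>" "\<eta> < s"
      "f (x + s *\<^sub>R u + s *\<^sub>R v) - f (x + s *\<^sub>R u) - f (x + s *\<^sub>R v) + f x
        = s * (s * ddir v (ddir u f) (x + \<xi> *\<^sub>R u + \<eta> *\<^sub>R v))" using key[OF s(1)] by blast
    obtain \<xi>' \<eta>' where b: "0 < \<xi>'" "\<xi>' < s" "0 < \<eta>'" "\<eta>' < s"
      "f (x + s *\<^sub>R v + s *\<^sub>R u) - f (x + s *\<^sub>R v) - f (x + s *\<^sub>R u) + f x
        = s * (s * ddir u (ddir v f) (x + \<xi>' *\<^sub>R v + \<eta>' *\<^sub>R u))" using key[OF s(1)] by blast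
    have "s * (s * ddir v (ddir u f) (x + \<xi> *\<^sub>R u + \<eta> *\<^sub>R v))
        = s * (s * ddir u (ddir v f) (x + \<xi>' *\<^sub>R v + \<eta>' *\<^sub>R u))"
      using a(5) b(5) by (simp add: algebra_simps)
    then have "ddir v (ddir u f) (x + \<xi> *\<^sub>R u + \<eta> *\<^sub>R v) = ddir u (ddir v f) (x + \<xi>' *\<^sub>R v + \<eta>' *\<^sub>R u)"
      using s by simp
    then show ?thesis using d1(2)[OF s(1,2) a(1-4)] d2(2)[OF s(1,3) b(1-4)] by linarith
  qed
  then have "\<bar>ddir u (ddir v f) x - ddir v (ddir u f) x\<bar> \<le> 0" by (rule field_le_epsilon[of _ 0, simplified])
  then show ?thesis by simp
qed

lemma iter_deriv_mset_eq:
  fixes f :: "real^'n \<Rightarrow> real"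
  assumes "smooth f" and "mset vs = mset ws"
  shows "iter_deriv f vs = iter_deriv f ws"
proof -
  have front: "iter_deriv f (as @ v # bs) = iter_deriv f (v # as @ bs)" if "smooth f"
    for f :: "real^'n \<Rightarrow> real" and as bs v
    using that
  proof (induction as arbitrary: f)
    case (Cons a as)
    then show ?case
      using Cons.IH[OF smooth_ddir[OF Cons.prems]] ddir_commute[OF Cons.prems]
      by simp
  qed simp
  show ?thesis using assms
  proof (induction vs arbitrary: f ws)
    case (Cons v vs)
    then have "v \<in> set ws" by (metis list.set_intros(1) set_mset_mset)
    then obtain as bs where ws: "ws = as @ v # bs" by (meson split_list)
    have "mset vs = mset (as @ bs)" using Cons.prems(2) ws by simp
    then show ?case
      using Cons.IH[OF smooth_ddir[OF Cons.prems(1)]] front[OF Cons.prems(1)] ws by simp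
  qed simp
qed

section \<open>Multilinear maps on basis vectors\<close>

definition basis_lists :: "nat \<Rightarrow> (real^'n) list set" where
  "basis_lists m = {bs. set bs \<subseteq> Basis \<and> length bs = m}"

lemma finite_basis_lists: "finite (basis_lists m)"
  unfolding basis_lists_def by (rule finite_lists_length_eq) simp

lemma basis_lists_Suc: "basis_lists (Suc m) = (\<lambda>(b, bs). b # bs) ` (Basis \<times> basis_lists m)"
  unfolding basis_lists_def by (auto simp: length_Suc_conv image_iff)

text \<open>
  The tool that replaces operator norms by finitely many scalar data: a multilinear map on
  \<open>real^'n\<close> is an explicit polynomial in the coordinates with its values on basis vectors as coefficients.
\<close>

lemma multilinear_expansion:
  fixes \<psi> :: "(real^'n) list \<Rightarrow> 'c::real_vector"
  assumes "\<And>vs i. length vs = m \<Longrightarrow> i < m \<Longrightarrow> linear (\<lambda>v. \<psi> (vs[i := v]))" and "length vs = m"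
  shows "\<psi> vs = (\<Sum>bs\<in>basis_lists m. (\<Prod>i<m. vs ! i \<bullet> bs ! i) *\<^sub>R \<psi> bs)"
  using assms
proof (induction m arbitrary: \<psi> vs)
  case 0
  have "basis_lists 0 = {[] :: (real^'n) list}" by (auto simp: basis_lists_def)
  then show ?case using 0 by simp
next
  case (Suc m)
  then obtain v ws where vs: "vs = v # ws" "length ws = m" by (auto simp: length_Suc_conv)
  have tail: "linear (\<lambda>w. \<psi> (b # (us[i := w])))" if "length us = m" "i < m" for us i b
    using Suc.prems(1)[of "b # us" "Suc i"] that by simp
  have head: "linear (\<lambda>w. \<psi> (w # ws))" using Suc.prems(1)[of vs 0] vs by simp
  have "\<psi> vs = \<psi> ((\<Sum>b\<in>Basis. (v \<bullet> b) *\<^sub>R b) # ws)" by (simp add: euclidean_representation vs)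
  also have "\<dots> = (\<Sum>b\<in>Basis. (v \<bullet> b) *\<^sub>R \<psi> (b # ws))"
    by (simp add: linear_sum[OF head] linear_cmul[OF head])
  also have "\<dots> = (\<Sum>b\<in>Basis. (v \<bullet> b) *\<^sub>R
      (\<Sum>bs\<in>basis_lists m. (\<Prod>i<m. ws ! i \<bullet> bs ! i) *\<^sub>R \<psi> (b # bs)))"
    using Suc.IH[of "\<lambda>us. \<psi> (b # us)" ws for b] tail vs by simp
  also have "\<dots> = (\<Sum>(b, bs)\<in>Basis \<times> basis_lists m.
      (\<Prod>i<Suc m. vs ! i \<bullet> (b # bs) ! i) *\<^sub>R \<psi> (b # bs))"
    by (simp add: sum.cartesian_product[symmetric] scaleR_sum_right vs prod.lessThan_Suc_shift
        del: prod.lessThan_Suc)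
  also have "\<dots> = (\<Sum>bs\<in>basis_lists (Suc m). (\<Prod>i<Suc m. vs ! i \<bullet> bs ! i) *\<^sub>R \<psi> bs)"
    unfolding basis_lists_Suc
    by (subst sum.reindex) (auto simp: inj_on_def case_prod_unfold intro!: sum.cong)
  finally show ?case .
qed

lemma multilinear_norm_le:
  fixes \<psi> :: "(real^'n) list \<Rightarrow> 'c::real_normed_vector"
  assumes "\<And>vs i. length vs = m \<Longrightarrow> i < m \<Longrightarrow> linear (\<lambda>v. \<psi> (vs[i := v]))"
    and "length vs = m" and "\<forall>v\<in>set vs. norm v \<le> 1"
  shows "norm (\<psi> vs) \<le> (\<Sum>bs\<in>basis_lists m. norm (\<psi> bs))"
proof -
  have "norm (\<psi> vs) = norm (\<Sum>bs\<in>basis_lists m. (\<Prod>i<m. vs ! i \<bullet> bs ! i) *\<^sub>R \<psi> bs)"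
    using multilinear_expansion[OF assms(1,2)] by simp
  also have "\<dots> \<le> (\<Sum>bs\<in>basis_lists m. norm (\<psi> bs))"
  proof (rule sum_norm_le)
    fix bs :: "(real^'n) list" assume bs: "bs \<in> basis_lists m"
    have "\<bar>\<Prod>i<m. vs ! i \<bullet> bs ! i\<bar> \<le> (\<Prod>i<m. 1)"
      unfolding abs_prod
    proof (rule prod_mono, safe)
      fix i assume i: "i < m"
      have "\<bar>vs ! i \<bullet> bs ! i\<bar> \<le> norm (vs ! i) * norm (bs ! i)" by (rule Cauchy_Schwarz_ineq2)
      also have "\<dots> \<le> 1 * 1"
        using bs i assms(2,3) by (intro mult_mono) (auto simp: basis_lists_def nth_mem subset_iff)
      finally show "\<bar>vs ! i \<bullet> bs ! i\<bar> \<le> 1" by simp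
    qed simp
    then show "norm ((\<Prod>i<m. vs ! i \<bullet> bs ! i) *\<^sub>R \<psi> bs) \<le> norm (\<psi> bs)"
      by (simp add: mult_left_le_one_le)
  qed
  finally show ?thesis .
qed

lemma mnorm_le_sum:
  fixes \<psi> :: "(real^'n) list \<Rightarrow> 'c::real_normed_vector"
  assumes "\<And>vs i. length vs = m \<Longrightarrow> i < m \<Longrightarrow> linear (\<lambda>v. \<psi> (vs[i := v]))"
  shows "mnorm m \<psi> \<le> (\<Sum>bs\<in>basis_lists m. norm (\<psi> bs))"
  unfolding mnorm_def
proof (rule cSUP_least)
  have "replicate m 0 \<in> {vs :: (real^'n) list. length vs = m \<and> (\<forall>v\<in>set vs. norm v \<le> 1)}" by auto
  then show "{vs :: (real^'n) list. length vs = m \<and> (\<forall>v\<in>set vs. norm v \<le> 1)} \<noteq> {}" by blast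
qed (use multilinear_norm_le[OF assms] in auto)

lemma norm_le_mnorm:
  fixes \<psi> :: "(real^'n) list \<Rightarrow> 'c::real_normed_vector"
  assumes "\<And>vs i. length vs = m \<Longrightarrow> i < m \<Longrightarrow> linear (\<lambda>v. \<psi> (vs[i := v]))"
    and "length vs = m" and "\<forall>v\<in>set vs. norm v \<le> 1"
  shows "norm (\<psi> vs) \<le> mnorm m \<psi>"
  unfolding mnorm_def
proof (rule cSUP_upper)
  show "bdd_above ((\<lambda>vs. norm (\<psi> vs)) ` {vs. length vs = m \<and> (\<forall>v\<in>set vs. norm v \<le> 1)})"
    using multilinear_norm_le[of m \<psi>] assms(1)
    by (intro bdd_aboveI2[where M="\<Sum>bs\<in>basis_lists m. norm (\<psi> bs)"]) auto
qed (use assms in auto)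

lemma mnorm_nonneg:
  fixes \<psi> :: "(real^'n) list \<Rightarrow> 'c::real_normed_vector"
  assumes "\<And>vs i. length vs = m \<Longrightarrow> i < m \<Longrightarrow> linear (\<lambda>v. \<psi> (vs[i := v]))"
  shows "0 \<le> mnorm m \<psi>"
proof -
  have "norm (\<psi> (replicate m 0)) \<le> mnorm m \<psi>"
    by (rule norm_le_mnorm) (auto intro: assms)
  then show ?thesis using norm_ge_zero order_trans by blast
qed

lemma higher_deriv_multilinear:
  assumes "C_diff m f" and "length vs = m" and "i < m"
  shows "linear (\<lambda>v. higher_deriv m f x (vs[i := v]))"
  using iter_deriv_multilinear[of m f vs i x] assms by (simp add: higher_deriv_def)

section \<open>Functionals of locally finite order\<close>

lemma test_functions_on_iff:
  assumes "compact K"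
  shows "\<theta> \<in> test_functions_on K \<longleftrightarrow> smooth \<theta> \<and> (\<forall>x. x \<notin> K \<longrightarrow> \<theta> x = 0)"
proof -
  have "closure {x. \<theta> x \<noteq> 0} \<subseteq> K \<longleftrightarrow> (\<forall>x. x \<notin> K \<longrightarrow> \<theta> x = 0)"
    using closure_minimal[of "{x. \<theta> x \<noteq> 0}" K] closure_subset[of "{x. \<theta> x \<noteq> 0}"]
      compact_imp_closed[OF assms] by auto
  moreover have "compact (closure {x. \<theta> x \<noteq> 0})" if "closure {x. \<theta> x \<noteq> 0} \<subseteq> K"
    using that assms by (meson bounded_subset closed_closure compact_eq_bounded_closed)
  ultimately show ?thesis by (auto simp: test_functions_on_def test_functions_def smooth_def)
qed

abbreviation unit_tests :: "(real^'n \<Rightarrow> 'b::real_normed_vector) set" where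
  "unit_tests \<equiv> test_functions_on (cball 0 1)"

lemma test_functions_on_subset: "test_functions_on K \<subseteq> test_functions"
  by (auto simp: test_functions_on_def)

lemma iter_deriv_outside:
  assumes "closed K" and "smooth f" and "\<And>x. x \<notin> K \<Longrightarrow> f x = 0" and "x \<notin> K"
  shows "iter_deriv f vs x = 0"
  using iter_deriv_local[of "- K" f "\<lambda>x. 0" x vs] assms by (simp add: iter_deriv_zero smooth_const open_Compl)

lemma zero_test_function: "compact K \<Longrightarrow> (\<lambda>x. 0) \<in> test_functions_on K"
  by (simp add: test_functions_on_iff smooth_const)

lemma cmul_test_function:
  "compact K \<Longrightarrow> \<theta> \<in> test_functions_on K \<Longrightarrow> (\<lambda>x. c *\<^sub>R \<theta> x) \<in> test_functions_on K"
  by (simp add: test_functions_on_iff smooth_cmul)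

definition linear_on_tests :: "((real^'n \<Rightarrow> 'b::real_normed_vector) \<Rightarrow> real) \<Rightarrow> bool" where
  "linear_on_tests T \<longleftrightarrow>
     (\<forall>\<theta>\<in>test_functions. \<forall>\<eta>\<in>test_functions. T (\<lambda>x. \<theta> x + \<eta> x) = T \<theta> + T \<eta>) \<and>
     (\<forall>c. \<forall>\<theta>\<in>test_functions. T (\<lambda>x. c *\<^sub>R \<theta> x) = c * T \<theta>)"

definition derivs_bounded :: "nat \<Rightarrow> real \<Rightarrow> (real^'n \<Rightarrow> 'c::real_normed_vector) \<Rightarrow> bool" where
  "derivs_bounded N M \<theta> \<longleftrightarrow>
    (\<forall>bs x. set bs \<subseteq> Basis \<longrightarrow> length bs \<le> N \<longrightarrow> norm (iter_deriv \<theta> bs x) \<le> M)"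

lemma derivs_boundedD:
  "derivs_bounded N M \<theta> \<Longrightarrow> set bs \<subseteq> Basis \<Longrightarrow> length bs \<le> N \<Longrightarrow> norm (iter_deriv \<theta> bs x) \<le> M"
  by (simp add: derivs_bounded_def)

lemma derivs_bounded_norm: "derivs_bounded N M \<theta> \<Longrightarrow> norm (\<theta> x) \<le> M"
  using derivs_boundedD[of N M \<theta> "[]" x] by simp

lemma derivs_bounded_nonneg: "derivs_bounded N M \<theta> \<Longrightarrow> 0 \<le> M"
  using derivs_bounded_norm[of N M \<theta> 0] norm_ge_zero order_trans by blast

text \<open>
  The quantitative form of continuity on each \<open>test_functions_on K\<close>. It is stable under the
  operations needed here and holds for distributions and for locally bounded densities alike, so
  one calculus of convolutions serves for \<open>T\<close>, for polynomials and for the cutoff functions.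
\<close>

definition locally_finite_order :: "((real^'n \<Rightarrow> 'b::real_normed_vector) \<Rightarrow> real) \<Rightarrow> bool" where
  "locally_finite_order T \<longleftrightarrow> linear_on_tests T \<and>
     (\<forall>K. compact K \<longrightarrow> (\<exists>N C. \<forall>\<theta>\<in>test_functions_on K. \<forall>M.
        derivs_bounded N M \<theta> \<longrightarrow> \<bar>T \<theta>\<bar> \<le> C * M))"

lemma iter_deriv_bounded_on_compact:
  fixes \<theta> :: "real^'n \<Rightarrow> 'b::real_normed_vector"
  assumes "compact K" and "smooth \<theta>"
  shows "\<exists>B\<ge>0. \<forall>x\<in>K. norm (iter_deriv \<theta> vs x) \<le> B"
proof -
  have "compact (iter_deriv \<theta> vs ` K)"
    by (rule compact_continuous_image[OF smooth_continuous[OF smooth_iter_deriv[OF assms(2)]] assms(1)])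
  then obtain B where "B > 0" "\<forall>y\<in>iter_deriv \<theta> vs ` K. norm y \<le> B"
    using compact_imp_bounded bounded_pos by metis
  then show ?thesis by (intro exI[of _ B]) auto
qed

lemma mnorm_higher_deriv_bounded:
  fixes \<theta> :: "real^'n \<Rightarrow> 'b::real_normed_vector"
  assumes "compact K" and "smooth \<theta>"
  shows "bdd_above ((\<lambda>x. mnorm j (higher_deriv j \<theta> x)) ` K)"
proof -
  obtain B where B: "\<And>vs x. x \<in> K \<Longrightarrow> norm (iter_deriv \<theta> vs x) \<le> B vs"
    using iter_deriv_bounded_on_compact[OF assms] by metis
  have "mnorm j (higher_deriv j \<theta> x) \<le> (\<Sum>bs\<in>basis_lists j. B bs)" if "x \<in> K" for x
  proof -
    have "mnorm j (higher_deriv j \<theta> x) \<le> (\<Sum>bs\<in>basis_lists j. norm (higher_deriv j \<theta> x bs))"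
      by (intro mnorm_le_sum higher_deriv_multilinear smooth_C_diff assms(2))
    also have "\<dots> \<le> (\<Sum>bs\<in>basis_lists j. B bs)"
      using B that by (intro sum_mono) (simp add: higher_deriv_def basis_lists_def)
    finally show ?thesis .
  qed
  then show ?thesis by (rule bdd_aboveI2)
qed

lemma test_seminorm_triangle:
  fixes \<theta> \<eta> :: "real^'n \<Rightarrow> 'b::real_normed_vector"
  assumes "compact K" "K \<noteq> {}" "smooth \<theta>" "smooth \<eta>"
  shows "test_seminorm K j (\<lambda>x. \<theta> x + \<eta> x) \<le> test_seminorm K j \<theta> + test_seminorm K j \<eta>"
  unfolding test_seminorm_def
proof (rule cSUP_least[OF assms(2)])
  fix x assume x: "x \<in> K"
  have "mnorm j (higher_deriv j (\<lambda>x. \<theta> x + \<eta> x) x)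
      \<le> mnorm j (higher_deriv j \<theta> x) + mnorm j (higher_deriv j \<eta> x)"
    unfolding mnorm_def[of j "higher_deriv j (\<lambda>x. \<theta> x + \<eta> x) x"]
  proof (rule cSUP_least)
    have "replicate j 0 \<in> {vs :: (real^'n) list. length vs = j \<and> (\<forall>v\<in>set vs. norm v \<le> 1)}" by auto
    then show "{vs :: (real^'n) list. length vs = j \<and> (\<forall>v\<in>set vs. norm v \<le> 1)} \<noteq> {}" by blast
  next
    fix vs assume vs: "vs \<in> {vs :: (real^'n) list. length vs = j \<and> (\<forall>v\<in>set vs. norm v \<le> 1)}"
    have "higher_deriv j (\<lambda>x. \<theta> x + \<eta> x) x vs = higher_deriv j \<theta> x vs + higher_deriv j \<eta> x vs"
      using vs iter_deriv_add[OF smooth_C_diff[OF assms(3)] smooth_C_diff[OF assms(4)], of vs "length vs"]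
      by (simp add: higher_deriv_def)
    then have "norm (higher_deriv j (\<lambda>x. \<theta> x + \<eta> x) x vs)
        \<le> norm (higher_deriv j \<theta> x vs) + norm (higher_deriv j \<eta> x vs)" by (simp add: norm_triangle_ineq)
    also have "\<dots> \<le> mnorm j (higher_deriv j \<theta> x) + mnorm j (higher_deriv j \<eta> x)"
      using vs assms(3,4)
      by (intro add_mono norm_le_mnorm higher_deriv_multilinear smooth_C_diff) auto
    finally show "norm (higher_deriv j (\<lambda>x. \<theta> x + \<eta> x) x vs)
        \<le> mnorm j (higher_deriv j \<theta> x) + mnorm j (higher_deriv j \<eta> x)" .
  qed
  also have "\<dots> \<le> (SUP x\<in>K. mnorm j (higher_deriv j \<theta> x)) + (SUP x\<in>K. mnorm j (higher_deriv j \<eta> x))"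
    by (intro add_mono cSUP_upper x mnorm_higher_deriv_bounded assms)
  finally show "mnorm j (higher_deriv j (\<lambda>x. \<theta> x + \<eta> x) x)
      \<le> (SUP x\<in>K. mnorm j (higher_deriv j \<theta> x)) + (SUP x\<in>K. mnorm j (higher_deriv j \<eta> x))" .
qed

text \<open>
  The sets generating the topology are seminorm balls with arbitrary centres. A ball that contains 0
  contains a smaller one centred at 0, and finite intersections and unions preserve
  the property.
\<close>

lemma test_topology_neighbourhood_zero:
  fixes V :: "(real^'n \<Rightarrow> 'b::real_normed_vector) set"
  assumes K: "compact K" "K \<noteq> {}"
    and V: "generate_topology_on {{\<eta> \<in> test_functions_on K. test_seminorm K j (\<lambda>x. \<eta> x - \<theta> x) < e} | j \<theta> e.
        (\<theta> :: real^'n \<Rightarrow> 'b) \<in> test_functions_on K \<and> e > 0} V"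
    and "(\<lambda>x. 0) \<in> V"
  shows "\<exists>N. \<exists>e>0. \<forall>\<eta>\<in>test_functions_on K. (\<forall>j\<le>N. test_seminorm K j \<eta> < e) \<longrightarrow> \<eta> \<in> V"
  using V assms(4)
proof induction
  case (Int V W)
  then obtain N e N' e' where "e > 0" "e' > 0"
    and *: "\<And>\<eta>. \<eta> \<in> test_functions_on K \<Longrightarrow> (\<forall>j\<le>N. test_seminorm K j \<eta> < e) \<Longrightarrow> \<eta> \<in> V"
      "\<And>\<eta>. \<eta> \<in> test_functions_on K \<Longrightarrow> (\<forall>j\<le>N'. test_seminorm K j \<eta> < e') \<Longrightarrow> \<eta> \<in> W"
    using Int.IH Int.prems by (metis (no_types, lifting) IntD1 IntD2)
  then show ?case
    by (intro exI[of _ "max N N'"] exI[of _ "min e e'"]) auto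
next
  case (UN F)
  then obtain W where W: "W \<in> F" "(\<lambda>x. 0) \<in> W" by blast
  obtain N e where "e > 0" "\<And>\<eta>. \<eta> \<in> test_functions_on K \<Longrightarrow> (\<forall>j\<le>N. test_seminorm K j \<eta> < e) \<Longrightarrow> \<eta> \<in> W"
    using UN.IH[OF W] by blast
  then show ?case using W(1) by (intro exI[of _ N] exI[of _ e]) blast
next
  case (Basis W)
  then obtain j \<theta> e where W: "W = {\<eta> \<in> test_functions_on K. test_seminorm K j (\<lambda>x. \<eta> x - \<theta> x) < e}"
    and th: "\<theta> \<in> test_functions_on K" "e > 0" by blast
  have z: "test_seminorm K j (\<lambda>x. - \<theta> x) < e" using Basis.prems W by simp
  have sm: "smooth \<theta>" using th(1) K(1) by (simp add: test_functions_on_iff)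
  then have sm': "smooth (\<lambda>x. - \<theta> x)" using smooth_cmul[of \<theta> "- 1"] by simp
  show ?case
  proof (intro exI[of _ j] exI[of _ "e - test_seminorm K j (\<lambda>x. - \<theta> x)"] conjI ballI impI)
    fix \<eta> :: "real^'n \<Rightarrow> 'b" assume eta: "\<eta> \<in> test_functions_on K"
      "\<forall>ja\<le>j. test_seminorm K ja \<eta> < e - test_seminorm K j (\<lambda>x. - \<theta> x)"
    have "smooth \<eta>" using eta(1) K(1) by (simp add: test_functions_on_iff)
    then have "test_seminorm K j (\<lambda>x. \<eta> x - \<theta> x) \<le> test_seminorm K j \<eta> + test_seminorm K j (\<lambda>x. - \<theta> x)"
      using test_seminorm_triangle[OF K _ sm', of \<eta> j] by simp
    also have "\<dots> < e" using eta(2) by (simp add: less_diff_eq)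
    finally show "\<eta> \<in> W" using eta(1) W by simp
  qed (use z in simp)
qed simp

text \<open>
  Continuity at 0 bounds \<open>T\<close> by 1 on a seminorm ball; homogeneity turns this into a linear bound.
\<close>

lemma distribution_locally_finite_order:
  fixes T :: "(real^'n \<Rightarrow> 'b::real_normed_vector) \<Rightarrow> real"
  assumes T: "distribution T"
  shows "locally_finite_order T"
  unfolding locally_finite_order_def
proof (intro conjI allI impI)
  show lin: "linear_on_tests T" using T by (simp add: distribution_def linear_on_tests_def)
  have cm: "T (\<lambda>x. c *\<^sub>R \<theta> x) = c * T \<theta>" if "\<theta> \<in> test_functions_on K" for c \<theta> K
    using lin subsetD[OF test_functions_on_subset that] by (simp add: linear_on_tests_def)
  fix K :: "(real^'n) set" assume K: "compact K"
  have T0: "T (\<lambda>x. 0) = 0" using cm[OF zero_test_function[OF K], of 0] by simp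
  show "\<exists>N C. \<forall>\<theta>\<in>test_functions_on K. \<forall>M.
        derivs_bounded N M \<theta> \<longrightarrow> \<bar>T \<theta>\<bar> \<le> C * M"
  proof (cases "K = {}")
    case True
    then have "T \<theta> = 0" if "\<theta> \<in> test_functions_on K" for \<theta>
    proof -
      have "\<theta> = (\<lambda>x. 0)" using that True K by (auto simp: test_functions_on_iff)
      then show ?thesis using T0 by simp
    qed
    then show ?thesis by (intro exI[of _ 0]) simp
  next
    case False
    define S where "S = {{\<eta> \<in> test_functions_on K. test_seminorm K j (\<lambda>x. \<eta> x - \<theta> x) < e} | j \<theta> e.
        (\<theta> :: real^'n \<Rightarrow> 'b) \<in> test_functions_on K \<and> e > 0}"
    have top: "test_topology K = topology_generated_by S" by (simp add: test_topology_def S_def)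
    define V where "V = {\<theta> \<in> topspace (test_topology K). T \<theta> \<in> {-1<..<1}}"
    have "openin (test_topology K) V"
      unfolding V_def using T K
      by (intro openin_continuous_map_preimage[where Y=euclideanreal]) (auto simp: distribution_def)
    then have V: "generate_topology_on S V" by (simp add: top openin_topology_generated_by_iff)
    define e0 where "e0 = \<bar>test_seminorm K 0 (\<lambda>x. 0 - 0 :: 'b)\<bar> + 1"
    have "{\<eta> \<in> test_functions_on K. test_seminorm K 0 (\<lambda>x. \<eta> x - (\<lambda>x. 0 :: 'b) x) < e0} \<in> S"
      unfolding S_def mem_Collect_eq using zero_test_function[OF K]
      by (intro exI[of _ 0] exI[of _ "\<lambda>x. 0 :: 'b"] exI[of _ e0]) (auto simp: e0_def)
    moreover have "(\<lambda>x. 0) \<in> {\<eta> \<in> test_functions_on K. test_seminorm K 0 (\<lambda>x. \<eta> x - (\<lambda>x. 0 :: 'b) x) < e0}"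
      using zero_test_function[OF K] by (auto simp: e0_def)
    ultimately have "(\<lambda>x. 0 :: 'b) \<in> topspace (test_topology K)"
      unfolding top topology_generated_by_topspace by (rule UnionI)
    then have "(\<lambda>x. 0 :: 'b) \<in> V" using T0 by (simp add: V_def)
    then obtain N e where e: "e > 0"
      and N: "\<And>\<eta>. \<eta> \<in> test_functions_on K \<Longrightarrow> (\<forall>j\<le>N. test_seminorm K j \<eta> < e) \<Longrightarrow> \<eta> \<in> V"
      using test_topology_neighbourhood_zero[OF K False V[unfolded S_def]] by blast
    define D where "D = (\<Sum>j\<le>N. real (card (basis_lists j :: (real^'n) list set))) + 1"
    have D: "D > 0" "\<And>j. j \<le> N \<Longrightarrow> real (card (basis_lists j :: (real^'n) list set)) < D"
    proof -
      show "D > 0" unfolding D_def by (smt (verit) of_nat_0_le_iff sum_nonneg)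
      fix j assume "j \<le> N"
      then have "real (card (basis_lists j :: (real^'n) list set)) \<le> (\<Sum>j\<le>N. real (card (basis_lists j :: (real^'n) list set)))"
        by (intro member_le_sum) auto
      then show "real (card (basis_lists j :: (real^'n) list set)) < D" by (simp add: D_def)
    qed
    show ?thesis
    proof (intro exI ballI allI impI)
      fix \<theta> :: "real^'n \<Rightarrow> 'b" and M assume th: "\<theta> \<in> test_functions_on K"
        and M: "derivs_bounded N M \<theta>"
      have sm: "smooth \<theta>" using th K by (simp add: test_functions_on_iff)
      note M0 = derivs_bounded_norm[OF M]
      show "\<bar>T \<theta>\<bar> \<le> D / e * M"
      proof (cases "M \<le> 0")
        case True
        then have "norm (\<theta> x) \<le> 0" for x using M0[of x] by linarith
        then have "\<theta> = (\<lambda>x. 0)" by auto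
        moreover have "M = 0" using M0[of 0] True norm_ge_zero[of "\<theta> 0"] by linarith
        ultimately show ?thesis using T0 by simp
      next
        case False
        \<comment> \<open>With this factor the scaled function has all seminorms up to order \<open>N\<close> below \<open>e\<close>.\<close>
        define c where "c = e / (D * M)"
        have c: "c > 0" using e D False by (simp add: c_def)
        have "test_seminorm K j (\<lambda>x. c *\<^sub>R \<theta> x) < e" if j: "j \<le> N" for j
        proof -
          have "test_seminorm K j (\<lambda>x. c *\<^sub>R \<theta> x)
              \<le> real (card (basis_lists j :: (real^'n) list set)) * (c * M)"
            unfolding test_seminorm_def
          proof (rule cSUP_least[OF \<open>K \<noteq> {}\<close>])
            fix x assume "x \<in> K"
            have "mnorm j (higher_deriv j (\<lambda>x. c *\<^sub>R \<theta> x) x)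
                \<le> (\<Sum>bs\<in>basis_lists j. norm (higher_deriv j (\<lambda>x. c *\<^sub>R \<theta> x) x bs))"
              using smooth_cmul[OF sm]
              by (intro mnorm_le_sum higher_deriv_multilinear smooth_C_diff) auto
            also have "\<dots> \<le> real (card (basis_lists j :: (real^'n) list set)) * (c * M)"
            proof (rule sum_bounded_above)
              fix bs :: "(real^'n) list" assume "bs \<in> basis_lists j"
              then have "set bs \<subseteq> Basis" "length bs = j" by (auto simp: basis_lists_def)
              then show "norm (higher_deriv j (\<lambda>x. c *\<^sub>R \<theta> x) x bs) \<le> c * M"
                using derivs_boundedD[OF M, of bs x] j c iter_deriv_cmul[OF smooth_C_diff[OF sm], of bs "length bs" c]
                by (simp add: higher_deriv_def)
            qed
            finally show "mnorm j (higher_deriv j (\<lambda>x. c *\<^sub>R \<theta> x) x)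
              \<le> real (card (basis_lists j :: (real^'n) list set)) * (c * M)" .
          qed
          also have "\<dots> < D * (c * M)"
            using D(2)[OF j] c False by (intro mult_strict_right_mono) auto
          also have "\<dots> = e" using D False by (simp add: c_def)
          finally show ?thesis .
        qed
        then have "(\<lambda>x. c *\<^sub>R \<theta> x) \<in> V" using N[OF cmul_test_function[OF K th]] by blast
        then have "\<bar>c * T \<theta>\<bar> < 1" using cm[OF th] by (auto simp: V_def)
        then have "\<bar>T \<theta>\<bar> < 1 / c" using c by (simp add: abs_mult pos_less_divide_eq mult.commute)
        also have "1 / c = D / e * M" using e D False by (simp add: c_def field_simps)
        finally show ?thesis by simp
      qed
    qed
  qed
qed

section \<open>Convolution with smooth kernels\<close>

definition kernel :: "real \<Rightarrow> (real^'n \<Rightarrow> real) \<Rightarrow> bool" where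
  "kernel R \<phi> \<longleftrightarrow> smooth \<phi> \<and> (\<forall>z. R < norm z \<longrightarrow> \<phi> z = 0)"

text \<open>
  The regularization of \<open>T\<close> by \<open>\<phi>\<close>, a function with values in the dual space of \<open>'b\<close>.
\<close>

definition conv :: "((real^'n \<Rightarrow> 'b::real_normed_vector) \<Rightarrow> real) \<Rightarrow> (real^'n \<Rightarrow> real)
    \<Rightarrow> real^'n \<Rightarrow> ('b \<Rightarrow>\<^sub>L real)" where
  "conv T \<phi> x = Blinfun (\<lambda>v. T (\<lambda>y. \<phi> (x - y) *\<^sub>R v))"

lemma linear_on_tests_add:
  "linear_on_tests T \<Longrightarrow> \<theta> \<in> test_functions \<Longrightarrow> \<eta> \<in> test_functions \<Longrightarrow>
    T (\<lambda>x. \<theta> x + \<eta> x) = T \<theta> + T \<eta>"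
  and linear_on_tests_cmul:
  "linear_on_tests T \<Longrightarrow> \<theta> \<in> test_functions \<Longrightarrow> T (\<lambda>x. c *\<^sub>R \<theta> x) = c * T \<theta>"
  by (simp_all add: linear_on_tests_def)

lemma locally_finite_order_linear: "locally_finite_order T \<Longrightarrow> linear_on_tests T"
  by (simp add: locally_finite_order_def)

lemma kernel_smooth: "kernel R \<phi> \<Longrightarrow> smooth \<phi>"
  by (simp add: kernel_def)

lemma kernel_mono: "kernel R \<phi> \<Longrightarrow> R \<le> R' \<Longrightarrow> kernel R' \<phi>"
  by (simp add: kernel_def)

lemma kernel_iter_deriv: "kernel R \<phi> \<Longrightarrow> kernel R (iter_deriv \<phi> vs)"
  using iter_deriv_outside[of "cball 0 R" \<phi>]
  by (auto simp: kernel_def smooth_iter_deriv not_le)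

lemma kernel_ddir: "kernel R \<phi> \<Longrightarrow> kernel R (ddir v \<phi>)"
  using kernel_iter_deriv[of R \<phi> "[v]"] by simp

lemma kernel_add: "kernel R \<phi> \<Longrightarrow> kernel R \<psi> \<Longrightarrow> kernel R (\<lambda>z. \<phi> z + \<psi> z)"
  by (simp add: kernel_def smooth_add)

lemma kernel_diff: "kernel R \<phi> \<Longrightarrow> kernel R \<psi> \<Longrightarrow> kernel R (\<lambda>z. \<phi> z - \<psi> z)"
  by (simp add: kernel_def smooth_diff)

lemma kernel_cmul: "kernel R \<phi> \<Longrightarrow> kernel R (\<lambda>z. c * \<phi> z)"
  using smooth_cmul[of \<phi> c] by (simp add: kernel_def)

lemma kernel_translate:
  fixes \<phi> :: "real^'n \<Rightarrow> real"
  assumes "kernel R \<phi>" shows "kernel (R + norm u) (\<lambda>z. \<phi> (z + u))"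
  unfolding kernel_def
proof (intro conjI allI impI)
  show "smooth (\<lambda>z. \<phi> (z + u))" using smooth_affine[OF kernel_smooth[OF assms], of 1 u] by simp
  fix z :: "real^'n" assume "R + norm u < norm z"
  then have "R < norm (z + u)" using norm_diff_ineq[of z u] by linarith
  then show "\<phi> (z + u) = 0" using assms by (simp add: kernel_def)
qed

lemma kernel_bounded:
  fixes \<phi> :: "real^'n \<Rightarrow> real"
  assumes \<phi>: "kernel R \<phi>"
  shows "\<exists>M. derivs_bounded N M \<phi>"
proof -
  obtain B where B0: "\<And>vs. B vs \<ge> 0" and B: "\<And>vs x. x \<in> cball 0 R \<Longrightarrow> norm (iter_deriv \<phi> vs x) \<le> B vs"
    using iter_deriv_bounded_on_compact[OF compact_cball kernel_smooth[OF \<phi>], of 0 R] by metis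
  have B': "\<bar>iter_deriv \<phi> vs x\<bar> \<le> B vs" for vs x
    using B[of x vs] B0[of vs] kernel_iter_deriv[OF \<phi>, of vs] by (cases "x \<in> cball 0 R") (auto simp: kernel_def)
  let ?L = "\<Union>m\<le>N. basis_lists m :: (real^'n) list set"
  have "finite ?L" using finite_basis_lists by blast
  then have "B bs \<le> sum B ?L" if "set bs \<subseteq> Basis" "length bs \<le> N" for bs
    using that B0 by (intro member_le_sum) (auto simp: basis_lists_def)
  then have "derivs_bounded N (sum B ?L) \<phi>"
    unfolding derivs_bounded_def real_norm_def using B' order_trans by blast
  then show ?thesis ..
qed

lemma conv_integrand_test:
  fixes v :: "'b::real_normed_vector" and \<phi> :: "real^'n \<Rightarrow> real"
  assumes \<phi>: "kernel R \<phi>" and x: "norm x \<le> X"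
  shows "(\<lambda>y. \<phi> (x - y) *\<^sub>R v) \<in> test_functions_on (cball 0 (X + R))"
  unfolding test_functions_on_iff[OF compact_cball]
proof (intro conjI allI impI)
  have "smooth (\<lambda>y. \<phi> (x - y))"
    using smooth_affine[OF kernel_smooth[OF \<phi>], of "- 1" x] by simp
  then show "smooth (\<lambda>y. \<phi> (x - y) *\<^sub>R v)"
    by (rule smooth_bounded_linear[OF bounded_linear_scaleR_left])
  fix y :: "real^'n" assume "y \<notin> cball 0 (X + R)"
  then have "R < norm (x - y)" using x norm_triangle_ineq2[of y x] by (simp add: norm_minus_commute)
  then show "\<phi> (x - y) *\<^sub>R v = 0" using \<phi> by (simp add: kernel_def)
qed

lemma conv_integrand_in_test_functions:
  assumes "kernel R \<phi>"
  shows "(\<lambda>y. \<phi> (x - y) *\<^sub>R v) \<in> test_functions"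
  using conv_integrand_test[OF assms order_refl] test_functions_on_subset by blast

lemma iter_deriv_conv_integrand:
  assumes "smooth \<phi>"
  shows "iter_deriv (\<lambda>y. \<phi> (x - y) *\<^sub>R v) bs = (\<lambda>y. ((- 1) ^ length bs * iter_deriv \<phi> bs (x - y)) *\<^sub>R v)"
proof -
  have "smooth (\<lambda>y. \<phi> (x - y))"
    using smooth_affine[OF assms, of "- 1" x] by simp
  from smooth_iter_deriv_bounded_linear[OF bounded_linear_scaleR_left this, of v bs]
  show ?thesis using iter_deriv_affine[OF assms, of "- 1" x bs] by simp
qed

text \<open>
  Uniformity in the vector \<open>v\<close> and locally in \<open>x\<close> makes the regularization a bounded functional
  that is differentiable in norm.
\<close>

lemma conv_integrand_bound:
  fixes T :: "(real^'n \<Rightarrow> 'b::real_normed_vector) \<Rightarrow> real"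
  assumes T: "locally_finite_order T"
  obtains N C where "C \<ge> 0" and
    "\<And>\<phi> x M v. kernel R \<phi> \<Longrightarrow> norm x \<le> X \<Longrightarrow>
      derivs_bounded N M \<phi> \<Longrightarrow>
      \<bar>T (\<lambda>y. \<phi> (x - y) *\<^sub>R v)\<bar> \<le> C * M * norm v"
proof -
  have "compact (cball 0 (X + R) :: (real^'n) set)" by (rule compact_cball)
  with T obtain N C where NC: "\<And>\<theta> M. \<theta> \<in> test_functions_on (cball 0 (X + R)) \<Longrightarrow>
      derivs_bounded N M \<theta> \<Longrightarrow> \<bar>T \<theta>\<bar> \<le> C * M"
    unfolding locally_finite_order_def by metis
  show thesis
  proof (rule that[of "\<bar>C\<bar>" N])
    fix \<phi> :: "real^'n \<Rightarrow> real" and x :: "real^'n" and M and v :: 'b assume \<phi>: "kernel R \<phi>" and x: "norm x \<le> X"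
      and M: "derivs_bounded N M \<phi>"
    have M0: "M \<ge> 0" by (rule derivs_bounded_nonneg[OF M])
    have "\<bar>T (\<lambda>y. \<phi> (x - y) *\<^sub>R v)\<bar> \<le> C * (M * norm v)"
    proof (rule NC[OF conv_integrand_test[OF \<phi> x]], unfold derivs_bounded_def, intro allI impI)
      fix bs :: "(real^'n) list" and y assume "set bs \<subseteq> Basis" "length bs \<le> N"
      then show "norm (iter_deriv (\<lambda>y. \<phi> (x - y) *\<^sub>R v) bs y) \<le> M * norm v"
        using derivs_boundedD[OF M] by (simp add: iter_deriv_conv_integrand[OF kernel_smooth[OF \<phi>]] abs_mult mult_right_mono)
    qed
    also have "\<dots> \<le> \<bar>C\<bar> * (M * norm v)" using M0 by (intro mult_right_mono) auto
    finally show "\<bar>T (\<lambda>y. \<phi> (x - y) *\<^sub>R v)\<bar> \<le> \<bar>C\<bar> * M * norm v" by (simp add: mult.assoc)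
  qed simp
qed

lemma conv_apply:
  fixes T :: "(real^'n \<Rightarrow> 'b::real_normed_vector) \<Rightarrow> real"
  assumes T: "locally_finite_order T" and \<phi>: "kernel R \<phi>"
  shows "conv T \<phi> x v = T (\<lambda>y. \<phi> (x - y) *\<^sub>R v)"
proof -
  have lin: "linear_on_tests T" using T by (simp add: locally_finite_order_def)
  note tf = conv_integrand_in_test_functions[OF \<phi>]
  obtain N C where NC: "C \<ge> 0" "\<And>\<phi> y M v. kernel R \<phi> \<Longrightarrow> norm y \<le> norm x \<Longrightarrow>
      derivs_bounded N M \<phi> \<Longrightarrow>
      \<bar>T (\<lambda>z. \<phi> (y - z) *\<^sub>R v)\<bar> \<le> C * M * norm v"
    using conv_integrand_bound[OF T] by metis
  obtain M where M: "derivs_bounded N M \<phi>"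
    using kernel_bounded[OF \<phi>] by metis
  have "bounded_linear (\<lambda>v. T (\<lambda>y. \<phi> (x - y) *\<^sub>R v))"
  proof (rule bounded_linear_intro)
    fix u v :: 'b and r :: real
    show "T (\<lambda>y. \<phi> (x - y) *\<^sub>R (u + v)) = T (\<lambda>y. \<phi> (x - y) *\<^sub>R u) + T (\<lambda>y. \<phi> (x - y) *\<^sub>R v)"
      using linear_on_tests_add[OF lin tf[of x u] tf[of x v]] by (simp add: scaleR_add_right)
    show "T (\<lambda>y. \<phi> (x - y) *\<^sub>R (r *\<^sub>R v)) = r *\<^sub>R T (\<lambda>y. \<phi> (x - y) *\<^sub>R v)"
      using linear_on_tests_cmul[OF lin tf[of x v], of r] by (simp add: mult.commute)
    show "norm (T (\<lambda>y. \<phi> (x - y) *\<^sub>R v)) \<le> norm v * (C * M)"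
      using NC(2)[OF \<phi> order_refl M] by (simp add: mult.commute mult.left_commute)
  qed
  then show ?thesis by (simp add: conv_def bounded_linear_Blinfun_apply)
qed

lemma conv_add:
  assumes T: "locally_finite_order T" and \<phi>: "kernel R \<phi>" and \<psi>: "kernel R \<psi>"
  shows "conv T (\<lambda>z. \<phi> z + \<psi> z) x = conv T \<phi> x + conv T \<psi> x"
proof (rule blinfun_eqI)
  fix v
  have "T (\<lambda>y. \<phi> (x - y) *\<^sub>R v + \<psi> (x - y) *\<^sub>R v) = T (\<lambda>y. \<phi> (x - y) *\<^sub>R v) + T (\<lambda>y. \<psi> (x - y) *\<^sub>R v)"
    by (intro linear_on_tests_add locally_finite_order_linear[OF T]
        conv_integrand_in_test_functions[OF \<phi>] conv_integrand_in_test_functions[OF \<psi>])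
  then show "conv T (\<lambda>z. \<phi> z + \<psi> z) x v = (conv T \<phi> x + conv T \<psi> x) v"
    using conv_apply[OF T] kernel_add[OF \<phi> \<psi>] \<phi> \<psi>
    by (simp add: plus_blinfun.rep_eq scaleR_add_left)
qed

lemma conv_cmul:
  assumes T: "locally_finite_order T" and \<phi>: "kernel R \<phi>"
  shows "conv T (\<lambda>z. c * \<phi> z) x = c *\<^sub>R conv T \<phi> x"
proof (rule blinfun_eqI)
  fix v
  have "T (\<lambda>y. c *\<^sub>R \<phi> (x - y) *\<^sub>R v) = c * T (\<lambda>y. \<phi> (x - y) *\<^sub>R v)"
    by (intro linear_on_tests_cmul locally_finite_order_linear[OF T]
        conv_integrand_in_test_functions[OF \<phi>])
  then show "conv T (\<lambda>z. c * \<phi> z) x v = (c *\<^sub>R conv T \<phi> x) v"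
    by (simp add: conv_apply[OF T kernel_cmul[OF \<phi>]] conv_apply[OF T \<phi>] scaleR_blinfun.rep_eq)
qed

lemma conv_diff:
  assumes T: "locally_finite_order T" and \<phi>: "kernel R \<phi>" and \<psi>: "kernel R \<psi>"
  shows "conv T (\<lambda>z. \<phi> z - \<psi> z) x = conv T \<phi> x - conv T \<psi> x"
  using conv_add[OF T \<phi> kernel_cmul[OF \<psi>, of "- 1"]] conv_cmul[OF T \<psi>, of "- 1"] by simp

lemma conv_norm_bound:
  fixes T :: "(real^'n \<Rightarrow> 'b::real_normed_vector) \<Rightarrow> real"
  assumes T: "locally_finite_order T"
  obtains N C where "C \<ge> 0" and
    "\<And>\<phi> x M. kernel R \<phi> \<Longrightarrow> norm x \<le> X \<Longrightarrow>
      derivs_bounded N M \<phi> \<Longrightarrow>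
      norm (conv T \<phi> x) \<le> C * M"
proof -
  obtain N C where C: "C \<ge> 0" and
    NC: "\<And>\<phi> x M v. kernel R \<phi> \<Longrightarrow> norm x \<le> X \<Longrightarrow>
      derivs_bounded N M \<phi> \<Longrightarrow>
      \<bar>T (\<lambda>y. \<phi> (x - y) *\<^sub>R v)\<bar> \<le> C * M * norm v"
    using conv_integrand_bound[OF T] by metis
  show thesis
  proof (rule that[OF C])
    fix \<phi> :: "real^'n \<Rightarrow> real" and x :: "real^'n" and M assume \<phi>: "kernel R \<phi>" and x: "norm x \<le> X"
      and M: "derivs_bounded N M \<phi>"
    have M0: "M \<ge> 0" by (rule derivs_bounded_nonneg[OF M])
    show "norm (conv T \<phi> x) \<le> C * M"
      using NC[OF \<phi> x M] C M0 by (intro norm_blinfun_bound) (auto simp: conv_apply[OF T \<phi>])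
  qed
qed

lemma taylor_remainder_bound:
  fixes \<psi> :: "real^'n \<Rightarrow> real"
  assumes \<psi>: "smooth \<psi>" and "\<And>b c z. b \<in> Basis \<Longrightarrow> c \<in> Basis \<Longrightarrow> \<bar>iter_deriv \<psi> [b, c] z\<bar> \<le> M"
  shows "\<bar>\<psi> (z + u) - \<psi> z - ddir u \<psi> z\<bar> \<le> real (card (basis_lists 2 :: (real^'n) list set)) * M * (norm u)\<^sup>2"
proof -
  have line: "((\<lambda>t. g (z + t *\<^sub>R u)) has_real_derivative ddir u g (z + t *\<^sub>R u)) (at t)"
    if "smooth g" for g :: "real^'n \<Rightarrow> real" and t
    using smooth_line_derivative[OF that] by (simp add: has_real_derivative_iff_has_vector_derivative)
  obtain \<xi> where xi: "0 < \<xi>" "\<xi> < 1" "\<psi> (z + 1 *\<^sub>R u) - \<psi> (z + 0 *\<^sub>R u) = (1 - 0) * ddir u \<psi> (z + \<xi> *\<^sub>R u)"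
    using MVT2[OF zero_less_one, of "\<lambda>t. \<psi> (z + t *\<^sub>R u)" "\<lambda>t. ddir u \<psi> (z + t *\<^sub>R u)"] line[OF \<psi>] by blast
  obtain \<eta> where eta: "0 < \<eta>" "\<eta> < \<xi>"
    "ddir u \<psi> (z + \<xi> *\<^sub>R u) - ddir u \<psi> (z + 0 *\<^sub>R u) = (\<xi> - 0) * ddir u (ddir u \<psi>) (z + \<eta> *\<^sub>R u)"
    using MVT2[OF xi(1), of "\<lambda>t. ddir u \<psi> (z + t *\<^sub>R u)" "\<lambda>t. ddir u (ddir u \<psi>) (z + t *\<^sub>R u)"]
      line[OF smooth_ddir[OF \<psi>]] by blast
  have "iter_deriv \<psi> [u, u] w = (\<Sum>bs\<in>basis_lists 2. (\<Prod>i<2. [u, u] ! i \<bullet> bs ! i) *\<^sub>R iter_deriv \<psi> bs w)" for w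
    using iter_deriv_multilinear[OF smooth_C_diff[OF \<psi>] order_refl]
    by (intro multilinear_expansion) auto
  moreover have "norm (\<Sum>bs\<in>basis_lists 2. (\<Prod>i<2. [u, u] ! i \<bullet> bs ! i) *\<^sub>R iter_deriv \<psi> bs w)
      \<le> real (card (basis_lists 2 :: (real^'n) list set)) * (M * (norm u)\<^sup>2)" for w
  proof (rule order_trans[OF norm_sum sum_bounded_above])
    fix bs :: "(real^'n) list" assume "bs \<in> basis_lists 2"
    then obtain b c where bs: "bs = [b, c]" "b \<in> Basis" "c \<in> Basis"
      by (auto simp: basis_lists_def length_Suc_conv numeral_2_eq_2)
    have "\<bar>u \<bullet> b\<bar> * \<bar>u \<bullet> c\<bar> \<le> norm u * norm u"
      using bs by (intro mult_mono Basis_le_norm abs_ge_zero norm_ge_zero)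
    then have "(\<bar>u \<bullet> b\<bar> * \<bar>u \<bullet> c\<bar>) * \<bar>iter_deriv \<psi> bs w\<bar> \<le> (norm u * norm u) * M"
      using assms(2)[OF bs(2,3)] bs(1) by (rule_tac mult_mono) (auto)
    then show "norm ((\<Prod>i<2. [u, u] ! i \<bullet> bs ! i) *\<^sub>R iter_deriv \<psi> bs w) \<le> M * (norm u)\<^sup>2"
      by (simp add: bs(1) numeral_2_eq_2 abs_mult power2_eq_square mult.commute)
  qed
  ultimately have b: "\<bar>ddir u (ddir u \<psi>) w\<bar> \<le> real (card (basis_lists 2 :: (real^'n) list set)) * M * (norm u)\<^sup>2" for w
    by (simp add: mult.assoc)
  have "\<bar>\<psi> (z + u) - \<psi> z - ddir u \<psi> z\<bar> = \<xi> * \<bar>ddir u (ddir u \<psi>) (z + \<eta> *\<^sub>R u)\<bar>"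
    using xi eta by (simp add: abs_mult)
  also have "\<dots> \<le> \<bar>ddir u (ddir u \<psi>) (z + \<eta> *\<^sub>R u)\<bar>" using xi by (simp add: mult_left_le_one_le)
  finally show ?thesis using b order_trans by blast
qed

text \<open>
  The error of the difference quotient is the convolution with the kernel
  \<open>\<phi>(z + u) - \<phi>(z) - D\<phi>(z) u\<close>. By Taylor's formula for each derivative of \<open>\<phi>\<close> it is
  of size \<open>norm u ^ 2\<close> in every \<open>C^N\<close> seminorm, hence so is its convolution with \<open>T\<close>.
\<close>

lemma conv_has_derivative:
  fixes T :: "(real^'n \<Rightarrow> 'b::real_normed_vector) \<Rightarrow> real"
  assumes T: "locally_finite_order T" and \<phi>: "kernel R \<phi>"
  shows "(conv T \<phi> has_derivative (\<lambda>u. conv T (ddir u \<phi>) x)) (at x)"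
proof -
  have sm: "smooth \<phi>" by (rule kernel_smooth[OF \<phi>])
  obtain N C where C: "C \<ge> 0" and NC: "\<And>\<phi> y M. kernel (R + 1) \<phi> \<Longrightarrow> norm y \<le> norm x \<Longrightarrow>
      derivs_bounded N M \<phi> \<Longrightarrow>
      norm (conv T \<phi> y) \<le> C * M"
    using conv_norm_bound[OF T] by metis
  obtain M where M: "derivs_bounded (N + 2) M \<phi>"
    using kernel_bounded[OF \<phi>] by metis
  define D where "D = real (card (basis_lists 2 :: (real^'n) list set)) * M"
  have lin: "linear (\<lambda>u. conv T (ddir u \<phi>) x)"
  proof (rule linearI)
    have l: "linear (frechet_derivative \<phi> (at z))" for z
      by (rule has_derivative_linear[OF smooth_has_derivative[OF sm]])
    show "conv T (ddir (u + v) \<phi>) x = conv T (ddir u \<phi>) x + conv T (ddir v \<phi>) x" for u v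
      by (simp add: linear_add[OF l] conv_add[OF T kernel_ddir[OF \<phi>] kernel_ddir[OF \<phi>]])
    show "conv T (ddir (r *\<^sub>R v) \<phi>) x = r *\<^sub>R conv T (ddir v \<phi>) x" for r v
      by (simp add: linear_cmul[OF l] conv_cmul[OF T kernel_ddir[OF \<phi>]])
  qed
  show ?thesis
  proof (rule has_derivativeI_sandwich[of 1])
    show "bounded_linear (\<lambda>u. conv T (ddir u \<phi>) x)" using lin by (simp add: linear_conv_bounded_linear)
    show "((\<lambda>y. C * D * norm (y - x)) \<longlongrightarrow> 0) (at x)"
      by (auto intro!: tendsto_eq_intros)
    fix y assume "y \<noteq> x" and d: "dist y x < 1"
    define u where "u = y - x"
    have y: "y = x + u" by (simp add: u_def)
    have nu: "norm u \<le> 1" "norm u > 0" using d \<open>y \<noteq> x\<close> by (auto simp: u_def dist_norm)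
    let ?\<zeta> = "\<lambda>z. \<phi> (z + u) - \<phi> z - ddir u \<phi> z"
    have k1: "kernel (R + 1) (\<lambda>z. \<phi> (z + u))"
      using kernel_mono[OF kernel_translate[OF \<phi>]] nu by simp
    have k2: "kernel (R + 1) \<phi>" "kernel (R + 1) (ddir u \<phi>)"
      using kernel_mono[OF \<phi>] kernel_mono[OF kernel_ddir[OF \<phi>]] by auto
    have k3: "kernel (R + 1) (\<lambda>z. \<phi> (z + u) - \<phi> z)" by (rule kernel_diff[OF k1 k2(1)])
    have "conv T \<phi> y = conv T (\<lambda>z. \<phi> (z + u)) x"
      unfolding conv_def by (simp add: y algebra_simps)
    then have "conv T \<phi> y - conv T \<phi> x - conv T (ddir u \<phi>) x = conv T ?\<zeta> x"
      by (simp add: conv_diff[OF T k3 k2(2)] conv_diff[OF T k1 k2(1)])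
    moreover have "norm (conv T ?\<zeta> x) \<le> C * (D * (norm u)\<^sup>2)"
    proof (rule NC[OF kernel_diff[OF k3 k2(2)] order_refl], unfold derivs_bounded_def, intro allI impI)
      fix bs z assume bs: "set bs \<subseteq> (Basis :: (real^'n) set)" "length bs \<le> N"
      let ?\<psi> = "iter_deriv \<phi> bs"
      have c1: "iter_deriv (\<lambda>z. \<phi> (z + u)) bs = (\<lambda>z. ?\<psi> (z + u))"
        using iter_deriv_affine[OF sm, of 1 u bs] by simp
      have c2: "iter_deriv (ddir u \<phi>) bs = ddir u ?\<psi>"
        using iter_deriv_mset_eq[OF sm, of "u # bs" "bs @ [u]"] by (simp add: iter_deriv_append)
      have "iter_deriv ?\<zeta> bs z = ?\<psi> (z + u) - ?\<psi> z - ddir u ?\<psi> z"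
        using smooth_iter_deriv_diff[OF kernel_smooth[OF k3] kernel_smooth[OF k2(2)], of bs]
          smooth_iter_deriv_diff[OF kernel_smooth[OF k1] sm, of bs]
        by (simp add: c1 c2)
      moreover have "\<bar>?\<psi> (z + u) - ?\<psi> z - ddir u ?\<psi> z\<bar> \<le> D * (norm u)\<^sup>2"
        unfolding D_def
      proof (rule taylor_remainder_bound[OF smooth_iter_deriv[OF sm]])
        fix b c :: "real^'n" and w assume "b \<in> Basis" "c \<in> Basis"
        then show "\<bar>iter_deriv ?\<psi> [b, c] w\<bar> \<le> M"
          using derivs_boundedD[OF M, of "bs @ [b, c]" w] bs by (simp add: iter_deriv_append)
      qed
      ultimately show "norm (iter_deriv ?\<zeta> bs z) \<le> D * (norm u)\<^sup>2" by simp
    qed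
    ultimately have "norm (conv T \<phi> y - conv T \<phi> x - conv T (ddir u \<phi>) x) \<le> C * D * norm u * norm u"
      by (simp add: power2_eq_square mult.assoc)
    then show "norm (conv T \<phi> y - conv T \<phi> x - conv T (ddir (y - x) \<phi>) x) / norm (y - x) \<le> C * D * norm (y - x)"
      using nu by (simp add: pos_divide_le_eq flip: u_def)
  qed simp
qed

lemma smooth_conv:
  assumes T: "locally_finite_order T" and \<phi>: "kernel R \<phi>"
  shows "smooth (conv T \<phi>)"
proof -
  have "C_diff k (conv T \<phi>)" for k
    using \<phi>
  proof (induction k arbitrary: \<phi>)
    case 0
    then show ?case
      using has_derivative_continuous[OF conv_has_derivative[OF T 0]]
      by (simp add: continuous_at_imp_continuous_on)
  next
    case (Suc k)
    show ?case
      by (rule C_diff_SucI[OF conv_has_derivative[OF T Suc.prems]])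
        (use Suc.IH[OF kernel_ddir[OF Suc.prems]] in simp)
  qed
  then show ?thesis by (simp add: smooth_def)
qed

lemma iter_deriv_conv:
  assumes T: "locally_finite_order T"
  shows "kernel R \<phi> \<Longrightarrow> iter_deriv (conv T \<phi>) vs = conv T (iter_deriv \<phi> vs)"
proof (induction vs arbitrary: \<phi>)
  case (Cons v vs)
  have "ddir v (conv T \<phi>) = conv T (ddir v \<phi>)"
    by (intro ext ddir_eqI conv_has_derivative[OF T Cons.prems])
  then show ?case using Cons.IH[OF kernel_ddir[OF Cons.prems]] by simp
qed simp

section \<open>Distributions given by functions\<close>

lemma integrable_compact_support:
  fixes f :: "real^'n \<Rightarrow> real"
  assumes f: "f \<in> borel_measurable borel" and K: "compact K"
    and B: "\<And>x. x \<in> K \<Longrightarrow> \<bar>f x\<bar> \<le> B" and out: "\<And>x. x \<notin> K \<Longrightarrow> f x = 0"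
  shows "integrable lborel f" and "\<bar>LINT x|lborel. f x\<bar> \<le> B * measure lborel K"
proof -
  have fin: "emeasure lborel K < \<infinity>" "K \<in> sets lborel"
    using emeasure_bounded_finite[OF compact_imp_bounded[OF K]] K by (auto simp: borel_compact)
  have ind: "integrable lborel (\<lambda>x. B * indicator K x)"
    using fin by (intro integrable_mult_right integrable_real_indicator)
  have le: "\<bar>f x\<bar> \<le> B * indicator K x" for x using B out by (auto simp: indicator_def)
  have le': "norm (f x) \<le> norm (B * indicator K x)" for x using le[of x] by simp
  show int: "integrable lborel f"
    by (rule Bochner_Integration.integrable_bound[OF ind]) (use f le' in auto)
  have "\<bar>LINT x|lborel. f x\<bar> \<le> (LINT x|lborel. \<bar>f x\<bar>)" by (rule integral_abs_bound)
  also have "\<dots> \<le> (LINT x|lborel. B * indicator K x)"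
    using int ind le by (intro integral_mono) auto
  finally show "\<bar>LINT x|lborel. f x\<bar> \<le> B * measure lborel K" by simp
qed

lemma locally_finite_order_fun_distr:
  fixes P :: "real^'n \<Rightarrow> ('b::real_normed_vector \<Rightarrow>\<^sub>L real)"
  assumes meas: "\<And>\<theta>. \<theta> \<in> test_functions \<Longrightarrow> (\<lambda>x. P x (\<theta> x)) \<in> borel_measurable borel"
    and bdd: "\<And>K. compact K \<Longrightarrow> \<exists>B. \<forall>x\<in>K. norm (P x) \<le> B"
  shows "locally_finite_order (fun_distr P)"
proof -
  have key: "integrable lborel (\<lambda>x. P x (\<theta> x)) \<and> \<bar>fun_distr P \<theta>\<bar> \<le> (B * M) * measure lborel K"
    if K: "compact K" and th: "\<theta> \<in> test_functions_on K" and B: "\<forall>x\<in>K. norm (P x) \<le> B"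
      and M: "\<And>x. norm (\<theta> x) \<le> M" for K \<theta> B M
  proof -
    have out: "P x (\<theta> x) = 0" if "x \<notin> K" for x
      using th that K by (simp add: test_functions_on_iff)
    have bd: "\<bar>P x (\<theta> x)\<bar> \<le> B * M" if "x \<in> K" for x
    proof -
      have "norm (P x (\<theta> x)) \<le> norm (P x) * norm (\<theta> x)" by (rule norm_blinfun)
      also have "\<dots> \<le> B * M"
        using B M that by (intro mult_mono) (auto intro: order_trans[OF norm_ge_zero])
      finally show ?thesis by simp
    qed
    have "\<theta> \<in> test_functions" using th test_functions_on_subset by blast
    then show ?thesis
      using integrable_compact_support[OF meas K bd out] by (simp add: fun_distr_def)
  qed
  have int: "integrable lborel (\<lambda>x. P x (\<theta> x))" if th: "\<theta> \<in> test_functions" for \<theta>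
  proof -
    let ?K = "closure {x. \<theta> x \<noteq> 0}"
    have K: "compact ?K" and sm: "smooth \<theta>" using th by (auto simp: test_functions_def smooth_def)
    have "\<theta> \<in> test_functions_on ?K" using th by (simp add: test_functions_on_def)
    moreover obtain B where "\<forall>x\<in>?K. norm (P x) \<le> B" using bdd[OF K] by blast
    moreover obtain M where M: "M \<ge> 0" "\<forall>x\<in>?K. norm (iter_deriv \<theta> [] x) \<le> M"
      using iter_deriv_bounded_on_compact[OF K sm] by blast
    have "norm (\<theta> x) \<le> M" for x
      using M closure_subset[of "{x. \<theta> x \<noteq> 0}"] by (cases "\<theta> x = 0") auto
    ultimately show ?thesis using key[OF K] by blast
  qed
  show ?thesis
    unfolding locally_finite_order_def
  proof (intro conjI allI impI)
    show "linear_on_tests (fun_distr P)"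
      unfolding linear_on_tests_def fun_distr_def
      by (auto simp: blinfun.add_right blinfun.scaleR_right Bochner_Integration.integral_add int)
    fix K :: "(real^'n) set" assume K: "compact K"
    obtain B where B: "\<forall>x\<in>K. norm (P x) \<le> B" using bdd[OF K] by blast
    show "\<exists>N C. \<forall>\<theta>\<in>test_functions_on K. \<forall>M.
        derivs_bounded N M \<theta> \<longrightarrow> \<bar>fun_distr P \<theta>\<bar> \<le> C * M"
    proof (intro exI[of _ "0 :: nat"] exI[of _ "B * measure lborel K"] ballI allI impI)
      fix \<theta> :: "real^'n \<Rightarrow> 'b" and M
      assume th: "\<theta> \<in> test_functions_on K"
        and M: "derivs_bounded 0 M \<theta>"
      show "\<bar>fun_distr P \<theta>\<bar> \<le> B * measure lborel K * M"
        using key[OF K th B derivs_bounded_norm[OF M]] by (simp add: mult_ac)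
    qed
  qed
qed

lemma locally_finite_order_continuous:
  fixes P :: "real^'n \<Rightarrow> ('b::real_normed_vector \<Rightarrow>\<^sub>L real)"
  assumes P: "continuous_on UNIV P"
  shows "locally_finite_order (fun_distr P)"
proof (rule locally_finite_order_fun_distr)
  fix \<theta> :: "real^'n \<Rightarrow> 'b" assume "\<theta> \<in> test_functions"
  then have "continuous_on UNIV \<theta>"
    by (auto simp: test_functions_def intro: C_diff_imp_continuous)
  then show "(\<lambda>x. P x (\<theta> x)) \<in> borel_measurable borel"
    using bounded_bilinear.continuous_on[OF bounded_bilinear_blinfun_apply P]
    by (intro borel_measurable_continuous_onI)
next
  fix K :: "(real^'n) set" assume "compact K"
  then have "compact (P ` K)" using P by (metis compact_continuous_image continuous_on_subset subset_UNIV)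
  then show "\<exists>B. \<forall>x\<in>K. norm (P x) \<le> B"
    using compact_imp_bounded bounded_iff by (metis imageI)
qed

text \<open>
  The characteristic function of \<open>E\<close> as a distribution on real valued tests. Its regularizations are
  the smooth cutoff functions, whose derivatives are then given by the rules for \<open>conv\<close>.
\<close>

definition set_distr :: "(real^'n) set \<Rightarrow> (real^'n \<Rightarrow> real) \<Rightarrow> real" where
  "set_distr E = fun_distr (\<lambda>x. indicator E x *\<^sub>R (id_blinfun :: real \<Rightarrow>\<^sub>L real))"

lemma locally_finite_order_set_distr:
  fixes E :: "(real^'n) set"
  assumes E: "E \<in> sets borel"
  shows "locally_finite_order (set_distr E)"
  unfolding set_distr_def
proof (rule locally_finite_order_fun_distr)
  fix \<theta> :: "real^'n \<Rightarrow> real" assume "\<theta> \<in> test_functions"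
  then have "continuous_on UNIV \<theta>"
    by (auto simp: test_functions_def intro: C_diff_imp_continuous)
  then have [measurable]: "\<theta> \<in> borel_measurable borel" by (rule borel_measurable_continuous_onI)
  show "(\<lambda>x. (indicator E x *\<^sub>R (id_blinfun :: real \<Rightarrow>\<^sub>L real)) (\<theta> x)) \<in> borel_measurable borel"
    using E by (simp add: scaleR_blinfun.rep_eq)
next
  fix K :: "(real^'n) set"
  show "\<exists>B. \<forall>x\<in>K. norm (indicator E x *\<^sub>R (id_blinfun :: real \<Rightarrow>\<^sub>L real)) \<le> B"
    by (intro exI[of _ 1]) (auto simp: indicator_def)
qed

lemma linear_on_tests_diff: "linear_on_tests T \<Longrightarrow> linear_on_tests S \<Longrightarrow> linear_on_tests (\<lambda>\<eta>. T \<eta> - S \<eta>)"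
  by (simp add: linear_on_tests_def algebra_simps)

lemma lborel_integral_affine:
  fixes f :: "real^'n \<Rightarrow> real"
  assumes f: "f \<in> borel_measurable borel" and c: "c \<noteq> 0"
  shows "(LINT x|lborel. f x) = \<bar>c\<bar> ^ CARD('n) * (LINT x|lborel. f (t + c *\<^sub>R x))"
proof -
  have "(LINT x|lborel. f x) = (LINT x|density (distr lborel borel (\<lambda>x. t + c *\<^sub>R x)) (\<lambda>_. \<bar>c\<bar> ^ DIM(real^'n)). f x)"
    using lborel_affine[OF c, of t] by simp
  also have "\<dots> = (LINT x|distr lborel borel (\<lambda>x. t + c *\<^sub>R x). \<bar>c\<bar> ^ DIM(real^'n) *\<^sub>R f x)"
    using f by (subst integral_density) auto
  also have "\<dots> = (LINT x|lborel. \<bar>c\<bar> ^ DIM(real^'n) *\<^sub>R f (t + c *\<^sub>R x))"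
    using f by (subst integral_distr) auto
  finally show ?thesis by simp
qed

section \<open>Smoothing kernels with vanishing moments\<close>

text \<open>
  The functions \<open>exp(-1/t) / t^m\<close>, continued by 0. The whole family is needed because it
  is closed under differentiation up to linear combinations, whereas \<open>exp(-1/t)\<close> alone is not.
\<close>

definition flat :: "nat \<Rightarrow> real \<Rightarrow> real" where
  "flat m t = (if t > 0 then (1 / t) ^ m * exp (- 1 / t) else 0)"

lemma flat_tendsto_0: "(flat m \<longlongrightarrow> 0) (at 0)"
proof (rule filterlim_split_at)
  have "((\<lambda>t. (inverse t) ^ m / exp (inverse t)) \<longlongrightarrow> 0) (at_right (0::real))"
    by (rule filterlim_compose[OF tendsto_power_div_exp_0 filterlim_inverse_at_top_right])
  then show "(flat m \<longlongrightarrow> 0) (at_right 0)"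
    by (rule Lim_transform_eventually)
      (auto simp: flat_def eventually_at_filter exp_minus field_simps)
  show "(flat m \<longlongrightarrow> 0) (at_left 0)"
    by (rule Lim_transform_eventually[OF tendsto_const])
      (auto simp: flat_def eventually_at_filter)
qed

lemma flat_has_derivative:
  "(flat m has_real_derivative (- real m * flat (Suc m) t + flat (m + 2) t)) (at t)"
proof (cases t "0 :: real" rule: linorder_cases)
  case less
  have "((\<lambda>t. 0) has_real_derivative 0) (at t)" by simp
  then have "(flat m has_real_derivative 0) (at t)"
    by (rule has_field_derivative_transform_within_open[where S="{..<0}"]) (use less in \<open>auto simp: flat_def\<close>)
  then show ?thesis using less by (simp add: flat_def)
next
  case greater
  have "((\<lambda>t. (1 / t) ^ m * exp (- 1 / t)) has_real_derivative
      (- real m * flat (Suc m) t + flat (m + 2) t)) (at t)"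
    using greater
    by (auto intro!: derivative_eq_intros simp: flat_def field_simps power2_eq_square)
      (cases m; simp add: field_simps)
  then show ?thesis
    by (rule has_field_derivative_transform_within_open[where S="{0<..}"]) (use greater in \<open>auto simp: flat_def\<close>)
next
  case equal
  have "((\<lambda>h. (flat m (0 + h) - flat m 0) / h) \<longlongrightarrow> 0) (at 0)"
    by (rule Lim_transform_eventually[OF flat_tendsto_0[of "Suc m"]])
      (auto simp: flat_def eventually_at_filter field_simps)
  then show ?thesis using equal by (simp add: has_field_derivative_iff flat_def)
qed

lemma smooth_flat_ball: "smooth (\<lambda>x :: real^'n. flat m (1 - x \<bullet> x))"
proof -
  have "C_diff k (\<lambda>x :: real^'n. flat m (1 - x \<bullet> x))" for k
  proof (induction k arbitrary: m)
    case 0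
    have "continuous_on UNIV (flat m)"
      using DERIV_isCont[OF flat_has_derivative] by (simp add: continuous_at_imp_continuous_on)
    then show ?case by (auto intro!: continuous_on_compose2[of UNIV "flat m"] continuous_intros)
  next
    case (Suc k)
    let ?F = "\<lambda>x v :: real^'n. (- real m * flat (Suc m) (1 - x \<bullet> x) + flat (m + 2) (1 - x \<bullet> x)) * (- 2 * (x \<bullet> v))"
    show ?case
    proof (rule C_diff_SucI[where F="?F"])
      fix x :: "real^'n"
      have "((\<lambda>x. 1 - x \<bullet> x) has_derivative (\<lambda>v. - 2 * (x \<bullet> v))) (at x)"
        by (auto intro!: derivative_eq_intros simp: inner_commute)
      from has_derivative_compose[OF this flat_has_derivative[unfolded has_field_derivative_def]]
      show "((\<lambda>x. flat m (1 - x \<bullet> x)) has_derivative ?F x) (at x)" by simp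
    next
      fix v :: "real^'n"
      have lin: "C_diff k (\<lambda>x. - 2 * (x \<bullet> v))"
        by (intro C_diff_linear bounded_linear_const_mult bounded_linear_inner_left)
      have "C_diff k (\<lambda>x :: real^'n. (- real m) *\<^sub>R flat (Suc m) (1 - x \<bullet> x) + flat (m + 2) (1 - x \<bullet> x))"
        by (intro C_diff_add C_diff_bounded_linear[OF bounded_linear_scaleR_right] Suc.IH)
      from C_diff_scaleR[OF this lin] show "C_diff k (\<lambda>x. ?F x v)" by simp
    qed
  qed
  then show ?thesis by (simp add: smooth_def)
qed

lemma kernel_integrable:
  assumes \<phi>: "kernel R \<phi>" and Q: "continuous_on UNIV Q"
  shows "integrable lborel (\<lambda>z. Q z * \<phi> z)"
proof -
  have c: "continuous_on UNIV (\<lambda>z. Q z * \<phi> z)"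
    using Q smooth_continuous[OF kernel_smooth[OF \<phi>]] by (intro continuous_on_mult)
  have "bounded ((\<lambda>z. Q z * \<phi> z) ` cball 0 R)"
    by (intro compact_imp_bounded compact_continuous_image continuous_on_subset[OF c]) auto
  then obtain B where "\<forall>z\<in>cball 0 R. \<bar>Q z * \<phi> z\<bar> \<le> B" by (auto simp: bounded_iff)
  moreover have "Q z * \<phi> z = 0" if "z \<notin> cball 0 R" for z using \<phi> that by (simp add: kernel_def)
  ultimately show ?thesis
    using borel_measurable_continuous_onI[OF c]
    by (intro integrable_compact_support(1)[where K="cball 0 R" and B=B]) auto
qed

lemma exists_normalized_kernel:
  "\<exists>\<phi> :: real^'n \<Rightarrow> real. kernel 1 \<phi> \<and> (LINT z|lborel. \<phi> z) = 1"
proof -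
  define \<eta> where "\<eta> = (\<lambda>x :: real^'n. flat 0 (1 - x \<bullet> x))"
  have k: "kernel 1 \<eta>"
    unfolding kernel_def
  proof (intro conjI allI impI)
    show "smooth \<eta>" unfolding \<eta>_def by (rule smooth_flat_ball)
    fix z :: "real^'n" assume "1 < norm z"
    then have "1 < z \<bullet> z" by (metis norm_eq_sqrt_inner real_sqrt_gt_1_iff)
    then show "\<eta> z = 0" by (simp add: \<eta>_def flat_def)
  qed
  have int: "integrable lborel \<eta>" using kernel_integrable[OF k continuous_on_const[of _ 1]] by simp
  \<comment> \<open>On this ball the bump is at least \<open>exp (- 4 / 3)\<close>, so its integral is positive.\<close>
  let ?B = "ball 0 (1/2) :: (real^'n) set"
  have "0 < exp (- 4 / 3) * measure lborel ?B"
    using content_ball_pos[of "1/2" "0 :: real^'n"] by simp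
  also have "\<dots> = (LINT z|lborel. exp (- 4 / 3) * indicator ?B z)" by simp
  also have "\<dots> \<le> (LINT z|lborel. \<eta> z)"
  proof (rule integral_mono[OF _ int])
    show "integrable lborel (\<lambda>z. exp (- 4 / 3) * indicator ?B z :: real)"
      using emeasure_lborel_ball_finite by (intro integrable_mult_right integrable_real_indicator) auto
    fix z :: "real^'n"
    show "exp (- 4 / 3) * indicator ?B z \<le> \<eta> z"
    proof (cases "z \<in> ?B")
      case True
      then have "norm z * norm z \<le> (1/2) * (1/2)" by (intro mult_mono) auto
      then have zz: "z \<bullet> z \<le> 1 / 4" by (simp add: dot_square_norm power2_eq_square)
      then have "1 / (1 - z \<bullet> z) \<le> 1 / (3 / 4)" by (intro divide_left_mono) auto
      then show ?thesis using zz True by (simp add: \<eta>_def flat_def)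
    next
      case False
      then show ?thesis by (simp add: \<eta>_def flat_def)
    qed
  qed
  finally have pos: "0 < (LINT z|lborel. \<eta> z)" .
  show ?thesis
    using kernel_cmul[OF k, of "1 / (LINT z|lborel. \<eta> z)"] pos
    by (intro exI[of _ "\<lambda>z. 1 / (LINT z|lborel. \<eta> z) * \<eta> z"]) auto
qed

text \<open>
  The moments are stated for all continuous positively homogeneous functions, which covers the
  homogeneous parts of polynomials without naming monomials.
\<close>

definition moment_kernel :: "nat \<Rightarrow> (real^'n \<Rightarrow> real) \<Rightarrow> bool" where
  "moment_kernel k \<phi> \<longleftrightarrow> kernel 1 \<phi> \<and> (LINT z|lborel. \<phi> z) = 1 \<and>
    (\<forall>m Q. 1 \<le> m \<and> m \<le> k \<and> continuous_on UNIV Q \<and> (\<forall>t>0. \<forall>z. Q (t *\<^sub>R z) = t ^ m * Q z)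
       \<longrightarrow> (LINT z|lborel. Q z * \<phi> z) = 0)"

lemma moment_kernel_kernel: "moment_kernel k \<phi> \<Longrightarrow> kernel 1 \<phi>"
  and moment_kernel_integral: "moment_kernel k \<phi> \<Longrightarrow> (LINT z|lborel. \<phi> z) = 1"
  and moment_kernel_moment: "moment_kernel k \<phi> \<Longrightarrow> 1 \<le> m \<Longrightarrow> m \<le> k \<Longrightarrow> continuous_on UNIV Q \<Longrightarrow>
    (\<forall>t>0. \<forall>z. Q (t *\<^sub>R z) = t ^ m * Q z) \<Longrightarrow> (LINT z|lborel. Q z * \<phi> z) = 0"
  and moment_kernel_0: "moment_kernel k \<phi> \<Longrightarrow> moment_kernel 0 \<phi>"
  by (auto simp: moment_kernel_def)

lemma exists_moment_kernel: "\<exists>\<phi> :: real^'n \<Rightarrow> real. moment_kernel k \<phi>"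
proof (induction k)
  case 0
  then show ?case using exists_normalized_kernel by (simp add: moment_kernel_def)
next
  case (Suc k)
  then obtain \<phi> :: "real^'n \<Rightarrow> real" where mk: "moment_kernel k \<phi>"
    by blast
  note \<phi> = moment_kernel_kernel[OF mk] and one = moment_kernel_integral[OF mk]
    and mom = moment_kernel_moment[OF mk]
  define \<psi> where "\<psi> = (\<lambda>z :: real^'n. 2 ^ CARD('n) * \<phi> (2 *\<^sub>R z))"
  have \<psi>: "kernel 1 \<psi>"
  proof -
    have "smooth (\<lambda>z. \<phi> (2 *\<^sub>R z))"
      using smooth_affine[OF kernel_smooth[OF \<phi>], of 2 0] by simp
    then have "kernel 1 (\<lambda>z. \<phi> (2 *\<^sub>R z))" using \<phi> by (auto simp: kernel_def)
    then show ?thesis unfolding \<psi>_def by (rule kernel_cmul)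
  qed
  have scale: "(LINT z|lborel. Q z * \<psi> z) = (1/2) ^ m * (LINT z|lborel. Q z * \<phi> z)"
    if Q: "continuous_on UNIV Q" and hom: "\<forall>t>0. \<forall>z. Q (t *\<^sub>R z) = t ^ m * Q z" for Q m
  proof -
    have meas: "(\<lambda>z. Q z * \<psi> z) \<in> borel_measurable borel"
      using Q smooth_continuous[OF kernel_smooth[OF \<psi>]]
      by (intro borel_measurable_continuous_onI continuous_on_mult)
    have "(LINT z|lborel. Q z * \<psi> z)
        = \<bar>1/2\<bar> ^ CARD('n) * (LINT z|lborel. Q (0 + (1/2) *\<^sub>R z) * \<psi> (0 + (1/2) *\<^sub>R z))"
      by (rule lborel_integral_affine[OF meas]) simp
    also have "(\<lambda>z. Q (0 + (1/2) *\<^sub>R z) * \<psi> (0 + (1/2) *\<^sub>R z))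
        = (\<lambda>z. ((1/2) ^ m * 2 ^ CARD('n)) * (Q z * \<phi> z))"
      using hom by (simp add: \<psi>_def fun_eq_iff)
    also have "\<bar>1/2\<bar> ^ CARD('n) * (LINT z|lborel. ((1/2) ^ m * 2 ^ CARD('n)) * (Q z * \<phi> z))
        = (1/2) ^ m * (LINT z|lborel. Q z * \<phi> z)"
      by (simp add: power_one_over)
    finally show ?thesis .
  qed
  \<comment> \<open>Contracting \<open>\<phi>\<close> by the factor 2 multiplies its moments of degree \<open>m\<close> by \<open>(1/2)^m\<close>. The weights
    are chosen with \<open>a + b = 1\<close>, so mass one is kept, and \<open>a + b (1/2)^(k+1) = 0\<close>.\<close>
  define b where "b = 1 / (1 - (1/2) ^ Suc k :: real)"
  define a where "a = 1 - b"
  have "(1/2) ^ Suc k < (1 :: real)" by (rule power_Suc_less_one) auto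
  then have ab: "a + b * (1/2) ^ Suc k = 0" by (simp add: a_def b_def field_simps)
  let ?\<chi> = "\<lambda>z. a * \<phi> z + b * \<psi> z"
  have split: "(LINT z|lborel. Q z * ?\<chi> z) = (a + b * (1/2) ^ m) * (LINT z|lborel. Q z * \<phi> z)"
    if Q: "continuous_on UNIV Q" and hom: "\<forall>t>0. \<forall>z. Q (t *\<^sub>R z) = t ^ m * Q z" for Q m
  proof -
    have "(LINT z|lborel. Q z * ?\<chi> z) = (LINT z|lborel. a * (Q z * \<phi> z) + b * (Q z * \<psi> z))"
      by (simp add: algebra_simps)
    also have "\<dots> = a * (LINT z|lborel. Q z * \<phi> z) + b * (LINT z|lborel. Q z * \<psi> z)"
      using kernel_integrable[OF \<phi> Q] kernel_integrable[OF \<psi> Q]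
      by (subst Bochner_Integration.integral_add) auto
    finally show ?thesis using scale[OF Q hom] by (simp add: algebra_simps)
  qed
  show ?case
    unfolding moment_kernel_def
  proof (intro exI[of _ ?\<chi>] conjI allI impI)
    show "kernel 1 ?\<chi>" by (intro kernel_add kernel_cmul \<phi> \<psi>)
    show "(LINT z|lborel. ?\<chi> z) = 1"
      using split[of "\<lambda>z. 1" 0] one by (simp add: a_def)
    fix m and Q :: "real^'n \<Rightarrow> real"
    assume "1 \<le> m \<and> m \<le> Suc k \<and> continuous_on UNIV Q \<and> (\<forall>t>0. \<forall>z. Q (t *\<^sub>R z) = t ^ m * Q z)"
    then have m: "1 \<le> m" "m \<le> Suc k" and Q: "continuous_on UNIV Q" "\<forall>t>0. \<forall>z. Q (t *\<^sub>R z) = t ^ m * Q z"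
      by auto
    show "(LINT z|lborel. Q z * ?\<chi> z) = 0"
    proof (cases "m = Suc k")
      case True
      then show ?thesis using split[OF Q] ab by simp
    next
      case False
      then show ?thesis using split[OF Q] mom[OF _ _ Q] m by simp
    qed
  qed
qed

section \<open>Polynomial functions through their derivatives\<close>

text \<open>
  This description of polynomial functions is evidently invariant under translations; the
  description by homogeneous parts at the origin is not.
\<close>

definition degree_at_most :: "nat \<Rightarrow> (real^'n \<Rightarrow> 'c::real_normed_vector) \<Rightarrow> bool" where
  "degree_at_most k P \<longleftrightarrow> smooth P \<and> (\<forall>vs. k < length vs \<longrightarrow> iter_deriv P vs = (\<lambda>x. 0))"

lemma degree_at_most_smooth: "degree_at_most k P \<Longrightarrow> smooth P"
  by (simp add: degree_at_most_def)

lemma degree_at_most_mono: "degree_at_most m P \<Longrightarrow> m \<le> k \<Longrightarrow> degree_at_most k P"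
  by (simp add: degree_at_most_def)

lemma degree_at_most_const: "degree_at_most 0 (\<lambda>x :: real^'n. c)"
proof -
  have "iter_deriv (\<lambda>x. c) vs = (\<lambda>x. 0)" if "0 < length vs" for vs :: "(real^'n) list"
    using that by (cases vs) (auto simp: iter_deriv_zero)
  then show ?thesis by (simp add: degree_at_most_def smooth_const)
qed

lemma degree_at_most_bounded_linear:
  assumes L: "bounded_linear L" and P: "degree_at_most k P"
  shows "degree_at_most k (\<lambda>x. L (P x))"
  using P smooth_bounded_linear[OF L, of P] linear_0[OF bounded_linear.linear[OF L]]
    smooth_iter_deriv_bounded_linear[OF L degree_at_most_smooth[OF P]]
  by (simp add: degree_at_most_def)

lemma degree_at_most_sum:
  assumes "\<And>i. i \<in> I \<Longrightarrow> degree_at_most k (F i)"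
  shows "degree_at_most k (\<lambda>x. \<Sum>i\<in>I. F i x)"
  using assms smooth_iter_deriv_sum[of I F]
  by (auto simp: degree_at_most_def smooth_sum)

lemma degree_at_most_translate:
  "degree_at_most k P \<Longrightarrow> degree_at_most k (\<lambda>x. P (x - a))"
  using smooth_affine[of P 1 "- a"] iter_deriv_affine[of P 1 "- a"]
  by (simp add: degree_at_most_def)

lemma degree_at_most_ddir: "degree_at_most (Suc k) P \<Longrightarrow> degree_at_most k (ddir v P)"
  unfolding degree_at_most_def
  by (metis Suc_less_eq iter_deriv.simps(2) length_Cons smooth_ddir)

lemma degree_at_most_mult_linear:
  fixes l :: "real^'n \<Rightarrow> real" and g :: "real^'n \<Rightarrow> 'c::real_normed_vector"
  assumes l: "bounded_linear l"
  shows "degree_at_most m g \<Longrightarrow> degree_at_most (Suc m) (\<lambda>x. l x *\<^sub>R g x)"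
proof (induction m arbitrary: g rule: less_induct)
  case (less m)
  have IH: "degree_at_most m (\<lambda>x. l x *\<^sub>R h x)" if "m = Suc m'" "degree_at_most m' h"
    for m' and h :: "real^'n \<Rightarrow> 'c" using less.IH[of m' h] that by simp
  have g: "degree_at_most m g" by (rule less.prems)
  have sg: "smooth g" using g by (simp add: degree_at_most_def)
  have slg: "smooth (\<lambda>x. l x *\<^sub>R g x)" by (rule smooth_scaleR[OF smooth_linear[OF l] sg])
  have "iter_deriv (\<lambda>x. l x *\<^sub>R g x) vs = (\<lambda>x. 0)" if "Suc m < length vs" for vs
  proof -
    from that obtain v ws where vs: "vs = v # ws" "m < length ws" by (cases vs) auto
    have dd: "ddir v (\<lambda>x. l x *\<^sub>R g x) = (\<lambda>x. l x *\<^sub>R ddir v g x + l v *\<^sub>R g x)"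
      by (intro ext ddir_eqI has_derivative_scaleR bounded_linear_imp_has_derivative[OF l]
          smooth_has_derivative[OF sg])
    have s1: "smooth (\<lambda>x. l x *\<^sub>R ddir v g x)"
      by (rule smooth_scaleR[OF smooth_linear[OF l] smooth_ddir[OF sg]])
    have z1: "iter_deriv (\<lambda>x. l x *\<^sub>R ddir v g x) ws = (\<lambda>x. 0)"
    proof (cases m)
      case 0
      have "ddir v g = (\<lambda>x. 0)" using g[unfolded degree_at_most_def] 0
        by (metis iter_deriv.simps length_Cons list.size(3) lessI One_nat_def)
      then show ?thesis by (simp add: fun_eq_iff iter_deriv_zero)
    next
      case (Suc m')
      then show ?thesis
        using IH[OF Suc degree_at_most_ddir[of m' g v]] g vs by (simp add: degree_at_most_def)
    qed
    have z2: "iter_deriv (\<lambda>x. l v *\<^sub>R g x) ws = (\<lambda>x. 0)"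
      using smooth_iter_deriv_cmul[OF sg, where vs=ws and c="l v"] g vs(2)
      by (simp add: degree_at_most_def)
    show ?thesis
      using smooth_iter_deriv_add[OF s1 smooth_cmul[OF sg], where vs=ws]
      by (simp add: vs(1) dd z1 z2)
  qed
  then show "degree_at_most (Suc m) (\<lambda>x. l x *\<^sub>R g x)" using slg by (simp add: degree_at_most_def)
qed

lemma degree_at_most_multilinear_diagonal:
  fixes \<psi> :: "(real^'n) list \<Rightarrow> 'c::real_normed_vector"
  assumes "\<And>vs i. length vs = m \<Longrightarrow> i < m \<Longrightarrow> linear (\<lambda>v. \<psi> (vs[i := v]))"
  shows "degree_at_most m (\<lambda>x. \<psi> (replicate m x))"
proof -
  have monom: "degree_at_most m (\<lambda>x. \<Prod>i<m. x \<bullet> bs ! i)" for m and bs :: "(real^'n) list"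
  proof (induction m)
    case 0
    then show ?case using degree_at_most_const[of 1] by simp
  next
    case (Suc m)
    then show ?case
      using degree_at_most_mult_linear[OF bounded_linear_inner_left Suc] by (simp add: mult.commute)
  qed
  have "\<psi> (replicate m x) = (\<Sum>bs\<in>basis_lists m. (\<Prod>i<m. x \<bullet> bs ! i) *\<^sub>R \<psi> bs)" for x
    using multilinear_expansion[where vs="replicate m x" and \<psi>=\<psi> and m=m] assms by simp
  moreover have "degree_at_most m (\<lambda>x. \<Sum>bs\<in>basis_lists m. (\<Prod>i<m. x \<bullet> bs ! i) *\<^sub>R \<psi> bs)"
    by (rule degree_at_most_sum, rule degree_at_most_bounded_linear[OF bounded_linear_scaleR_left monom])
  ultimately show ?thesis by presburger
qed

lemma poly_fun_degree_at_most:
  fixes P :: "real^'n \<Rightarrow> 'c::real_normed_vector"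
  assumes "poly_fun k P" shows "degree_at_most k P"
proof -
  obtain \<psi> where \<psi>: "\<And>m. m \<le> k \<Longrightarrow> sym_multilinear m (\<psi> m)"
    and P: "P = (\<lambda>x. \<Sum>m\<le>k. \<psi> m (replicate m x))" using assms unfolding poly_fun_def by blast
  have "degree_at_most k (\<lambda>x. \<psi> m (replicate m x))" if m: "m \<le> k" for m
  proof (rule degree_at_most_mono[OF degree_at_most_multilinear_diagonal m])
    show "linear (\<lambda>v. \<psi> m (vs[i := v]))" if "length vs = m" "i < m" for vs i
      using \<psi>[OF m] that unfolding sym_multilinear_def by blast
  qed
  then show ?thesis unfolding P by (intro degree_at_most_sum) simp
qed

lemma iter_deriv_diagonal:
  fixes P :: "real^'n \<Rightarrow> 'c::real_normed_vector"
  assumes "C_diff m P"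
  shows "iter_deriv P (replicate m z) x = (\<Sum>bs\<in>basis_lists m. (\<Prod>i<m. z \<bullet> bs ! i) *\<^sub>R iter_deriv P bs x)"
  using multilinear_expansion[of m "\<lambda>vs. iter_deriv P vs x" "replicate m z"]
    iter_deriv_multilinear[OF assms] by simp

lemma iter_deriv_diagonal_scale:
  fixes P :: "real^'n \<Rightarrow> 'c::real_normed_vector"
  assumes "C_diff m P"
  shows "iter_deriv P (replicate m (t *\<^sub>R z)) x = t ^ m *\<^sub>R iter_deriv P (replicate m z) x"
  by (simp add: iter_deriv_diagonal[OF assms] scaleR_sum_right prod.distrib)

text \<open>
  By induction on the degree: along the segment from \<open>x\<close> to \<open>x + z\<close> the difference of the two
  sides has derivative zero, because the derivative of the right-hand side is the
  Taylor sum of \<open>ddir z P\<close>.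
\<close>

lemma taylor_degree_at_most:
  fixes P :: "real^'n \<Rightarrow> 'c::real_normed_vector"
  shows "degree_at_most k P \<Longrightarrow>
    P (x + z) = (\<Sum>m\<le>k. (1 / fact m) *\<^sub>R iter_deriv P (replicate m z) x)"
proof (induction k arbitrary: P z)
  case 0
  have "ddir v P = (\<lambda>x. 0)" for v
    using 0[unfolded degree_at_most_def] by (metis iter_deriv.simps length_Cons list.size(3) lessI One_nat_def)
  then have "frechet_derivative P (at y) = (\<lambda>h. 0)" for y by (auto simp: fun_eq_iff)
  then have "(P has_derivative (\<lambda>h. 0)) (at y within UNIV)" for y
    using smooth_has_derivative[OF degree_at_most_smooth[OF 0], of y] by simp
  then have "P (x + z) = P x" by (intro has_derivative_zero_unique[of UNIV]) auto
  then show ?case by simp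
next
  case (Suc k)
  have sm: "smooth P" by (rule degree_at_most_smooth[OF Suc.prems])
  define c where "c = (\<lambda>m. iter_deriv P (replicate m z) x)"
  define G where "G = (\<lambda>t. P (x + t *\<^sub>R z) - (c 0 + (\<Sum>m\<le>k. (t ^ Suc m / fact (Suc m)) *\<^sub>R c (Suc m))))"
  have "(G has_vector_derivative 0) (at t within UNIV)" for t
  proof -
    have tay: "ddir z P (x + t *\<^sub>R z) = (\<Sum>m\<le>k. (t ^ m / fact m) *\<^sub>R c (Suc m))"
      using Suc.IH[OF degree_at_most_ddir[OF Suc.prems, of z], of "t *\<^sub>R z"]
        iter_deriv_diagonal_scale[OF smooth_C_diff[OF smooth_ddir[OF sm]], where t=t and z=z and x=x]
      by (simp add: c_def)
    have deriv_term: "((\<lambda>t. (t ^ Suc m / fact (Suc m)) *\<^sub>R c (Suc m)) has_vector_derivative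
        (t ^ m / fact m) *\<^sub>R c (Suc m)) (at t)" for m
    proof -
      have "((\<lambda>t. t ^ Suc m / fact (Suc m)) has_real_derivative t ^ m / fact m) (at t)"
        using DERIV_cdivide[OF DERIV_pow[of "Suc m" t], of "fact (Suc m)"]
        by (simp add: nonzero_mult_divide_mult_cancel_left del: power_Suc)
      from has_vector_derivative_scaleR[OF this has_vector_derivative_const]
      show ?thesis by simp
    qed
    have "((\<lambda>t. c 0 + (\<Sum>m\<le>k. (t ^ Suc m / fact (Suc m)) *\<^sub>R c (Suc m))) has_vector_derivative
        (0 + (\<Sum>m\<le>k. (t ^ m / fact m) *\<^sub>R c (Suc m)))) (at t)"
      by (intro has_vector_derivative_add has_vector_derivative_const has_vector_derivative_sum deriv_term)
    from has_vector_derivative_diff[OF smooth_line_derivative[OF sm, of x z t] this]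
    show ?thesis unfolding G_def by (simp add: tay)
  qed
  then have "G 1 = G 0" using has_vector_derivative_zero_constant[of UNIV G] by (metis UNIV_I convex_UNIV)
  also have "G 0 = 0" by (simp add: G_def c_def)
  finally show ?case unfolding sum.atMost_Suc_shift by (simp add: G_def c_def)
qed

text \<open>
  The homogeneous parts are the Taylor coefficients at 0, which are symmetric because
  directional derivatives commute.
\<close>

lemma degree_at_most_poly_fun:
  fixes P :: "real^'n \<Rightarrow> ('b::real_normed_vector \<Rightarrow>\<^sub>L real)"
  assumes "degree_at_most k P" shows "poly_fun k P"
proof -
  have sm: "smooth P" by (rule degree_at_most_smooth[OF assms])
  have sym: "iter_deriv P vs x = iter_deriv P ws x" if "mset vs = mset ws" for vs ws x
  proof (rule blinfun_eqI)
    fix v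
    have bl: "bounded_linear (\<lambda>F :: 'b \<Rightarrow>\<^sub>L real. blinfun_apply F v)"
      using norm_blinfun
      by (intro bounded_linear_intro[where K="norm v"]) (auto simp: blinfun.bilinear_simps simp flip: real_norm_def)
    have "iter_deriv (\<lambda>x. P x v) us x = iter_deriv P us x v" for us
      using smooth_iter_deriv_bounded_linear[OF bl sm, of us] by simp
    then show "iter_deriv P vs x v = iter_deriv P ws x v"
      using iter_deriv_mset_eq[OF smooth_bounded_linear[OF bl sm] that] by metis
  qed
  define \<psi> where "\<psi> = (\<lambda>m vs. (1 / fact m) *\<^sub>R iter_deriv P vs 0)"
  have "sym_multilinear m (\<psi> m)" for m
    unfolding sym_multilinear_def
  proof (intro conjI allI impI; elim conjE)
    fix vs :: "(real^'n) list" and j assume "length vs = m" "j < m"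
    then have "linear (\<lambda>v. iter_deriv P (vs[j := v]) 0)"
      by (intro iter_deriv_multilinear[OF smooth_C_diff[OF sm] order_refl]) simp
    from linear_compose[OF this bounded_linear.linear[OF bounded_linear_scaleR_right[of "1 / fact m"]]]
    show "linear (\<lambda>v. \<psi> m (vs[j := v]))" by (simp only: \<psi>_def o_def)
  next
    fix vs ws :: "(real^'n) list" assume "mset vs = mset ws"
    from sym[OF this] show "\<psi> m vs = \<psi> m ws" by (simp only: \<psi>_def)
  qed
  moreover have "P = (\<lambda>x. \<Sum>m\<le>k. \<psi> m (replicate m x))"
  proof
    fix x
    show "P x = (\<Sum>m\<le>k. \<psi> m (replicate m x))"
      using taylor_degree_at_most[OF assms, of 0 x] by (simp only: \<psi>_def add_0_left)
  qed
  ultimately show ?thesis unfolding poly_fun_def by blast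
qed

section \<open>Dilated kernels\<close>

definition dil :: "real \<Rightarrow> (real^'n \<Rightarrow> real) \<Rightarrow> real^'n \<Rightarrow> real" where
  "dil \<rho> \<phi> = (\<lambda>z. inverse \<rho> ^ CARD('n) * \<phi> (inverse \<rho> *\<^sub>R z))"

lemma kernel_dil:
  fixes \<phi> :: "real^'n \<Rightarrow> real"
  assumes \<phi>: "kernel 1 \<phi>" and \<rho>: "\<rho> > 0" shows "kernel \<rho> (dil \<rho> \<phi>)"
  unfolding dil_def
proof (rule kernel_cmul)
  have "smooth (\<lambda>z. \<phi> (inverse \<rho> *\<^sub>R z))"
    using smooth_affine[OF kernel_smooth[OF \<phi>], of "inverse \<rho>" 0] by simp
  then show "kernel \<rho> (\<lambda>z. \<phi> (inverse \<rho> *\<^sub>R z))"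
    using \<phi> \<rho> by (auto simp: kernel_def field_simps)
qed

lemma iter_deriv_dil:
  fixes \<phi> :: "real^'n \<Rightarrow> real"
  assumes \<phi>: "smooth \<phi>"
  shows "iter_deriv (dil \<rho> \<phi>) vs = (\<lambda>z. inverse \<rho> ^ length vs * dil \<rho> (iter_deriv \<phi> vs) z)"
proof -
  have s: "smooth (\<lambda>z. \<phi> (inverse \<rho> *\<^sub>R z))" using smooth_affine[OF \<phi>, of "inverse \<rho>" 0] by simp
  have "iter_deriv (\<lambda>z. inverse \<rho> ^ CARD('n) *\<^sub>R \<phi> (inverse \<rho> *\<^sub>R z)) vs =
      (\<lambda>z. inverse \<rho> ^ CARD('n) *\<^sub>R iter_deriv (\<lambda>z. \<phi> (inverse \<rho> *\<^sub>R z)) vs z)"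
    by (rule smooth_iter_deriv_cmul[OF s])
  then show ?thesis
    using iter_deriv_affine[OF \<phi>, of "inverse \<rho>" 0 vs] by (simp add: dil_def mult_ac)
qed

lemma iter_deriv_conv_dil:
  assumes T: "locally_finite_order T" and \<phi>: "kernel 1 \<phi>" and \<rho>: "\<rho> > 0"
  shows "iter_deriv (conv T (dil \<rho> \<phi>)) vs x = inverse \<rho> ^ length vs *\<^sub>R conv T (dil \<rho> (iter_deriv \<phi> vs)) x"
  using iter_deriv_conv[OF T kernel_dil[OF \<phi> \<rho>], of vs]
    conv_cmul[OF T kernel_dil[OF kernel_iter_deriv[OF \<phi>] \<rho>]]
  by (simp add: iter_deriv_dil[OF kernel_smooth[OF \<phi>]])

text \<open>
  In \<open>\<integral> P(x - \<rho> z) \<phi>(z) dz\<close> the Taylor expansion of \<open>P\<close> at \<open>x\<close> leaves only its constant term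
  \<open>P(x)\<close>: the moments of \<open>\<phi>\<close> annihilate the others. Hence convolution reproduces \<open>P\<close> exactly,
  and an estimate for \<open>T - P\<close> becomes an estimate for \<open>T * \<phi>\<^sub>\<rho> - P\<close> and all its derivatives.
\<close>

lemma conv_polynomial:
  fixes P :: "real^'n \<Rightarrow> ('b::real_normed_vector \<Rightarrow>\<^sub>L real)" and \<phi> :: "real^'n \<Rightarrow> real"
  assumes P: "degree_at_most k P" and mk: "moment_kernel k \<phi>"
    and \<rho>: "\<rho> > 0"
  shows "conv (fun_distr P) (dil \<rho> \<phi>) = P"
proof (intro ext blinfun_eqI)
  fix x v
  note \<phi> = moment_kernel_kernel[OF mk] and one = moment_kernel_integral[OF mk]
    and mom = moment_kernel_moment[OF mk]
  have sm: "smooth P" by (rule degree_at_most_smooth[OF P])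
  have cP: "continuous_on UNIV P" by (rule smooth_continuous[OF sm])
  have lf: "locally_finite_order (fun_distr P)" by (rule locally_finite_order_continuous[OF cP])
  define Q where "Q m z = (1 / fact m) * (iter_deriv P (replicate m (- \<rho> *\<^sub>R z)) x) v" for m z
  have Q: "Q m z = (1 / fact m) * (\<Sum>bs\<in>basis_lists m. (\<Prod>i<m. - \<rho> * (z \<bullet> bs ! i)) * iter_deriv P bs x v)" for m z
    unfolding Q_def iter_deriv_diagonal[OF smooth_C_diff[OF sm]]
    by (simp add: blinfun.sum_left blinfun.scaleR_left)
  have Qc: "continuous_on UNIV (Q m)" for m
    unfolding Q[abs_def] by (intro continuous_intros)
  have Qh: "Q m (t *\<^sub>R z) = t ^ m * Q m z" for m t z
    using iter_deriv_diagonal_scale[OF smooth_C_diff[OF sm], of m t "- \<rho> *\<^sub>R z" x]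
    by (simp add: Q_def blinfun.scaleR_left mult.commute[of t])
  have PQ: "P (x - \<rho> *\<^sub>R z) v = (\<Sum>m\<le>k. Q m z)" for z
    using taylor_degree_at_most[OF P, of x "- \<rho> *\<^sub>R z"]
    by (simp add: Q_def blinfun.sum_left blinfun.scaleR_left)
  have c1: "continuous_on UNIV (\<lambda>y. P y v)"
    by (intro bounded_bilinear.continuous_on[OF bounded_bilinear_blinfun_apply cP] continuous_intros)
  have c2: "continuous_on UNIV (\<lambda>y. dil \<rho> \<phi> (x - y))"
    by (intro continuous_on_compose2[OF smooth_continuous[OF kernel_smooth[OF kernel_dil[OF \<phi> \<rho>]], of UNIV]]
        continuous_intros) auto
  have "conv (fun_distr P) (dil \<rho> \<phi>) x v = (LINT y|lborel. dil \<rho> \<phi> (x - y) * P y v)"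
    by (simp add: conv_apply[OF lf kernel_dil[OF \<phi> \<rho>]] fun_distr_def blinfun.scaleR_right)
  also have "\<dots> = \<bar>- \<rho>\<bar> ^ CARD('n) *
      (LINT z|lborel. dil \<rho> \<phi> (x - (x + - \<rho> *\<^sub>R z)) * P (x + - \<rho> *\<^sub>R z) v)"
    using c1 c2 \<rho>
    by (intro lborel_integral_affine borel_measurable_continuous_onI continuous_on_mult) auto
  also have "(\<lambda>z. dil \<rho> \<phi> (x - (x + - \<rho> *\<^sub>R z)) * P (x + - \<rho> *\<^sub>R z) v)
      = (\<lambda>z. inverse \<rho> ^ CARD('n) * (\<Sum>m\<le>k. Q m z * \<phi> z))"
    using \<rho> PQ by (simp add: dil_def fun_eq_iff sum_distrib_left sum_distrib_right mult_ac)
  also have "\<bar>- \<rho>\<bar> ^ CARD('n) * (LINT z|lborel. inverse \<rho> ^ CARD('n) * (\<Sum>m\<le>k. Q m z * \<phi> z))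
      = (LINT z|lborel. (\<Sum>m\<le>k. Q m z * \<phi> z))"
    using \<rho> by (simp add: power_inverse)
  also have "\<dots> = (\<Sum>m\<le>k. (LINT z|lborel. Q m z * \<phi> z))"
    by (rule Bochner_Integration.integral_sum) (rule kernel_integrable[OF \<phi> Qc])
  also have "\<dots> = (\<Sum>m\<in>{0}. (LINT z|lborel. Q m z * \<phi> z))"
  proof (rule sum.mono_neutral_right)
    show "\<forall>m\<in>{..k} - {0}. (LINT z|lborel. Q m z * \<phi> z) = 0"
    proof
      fix m assume "m \<in> {..k} - {0}"
      then show "(LINT z|lborel. Q m z * \<phi> z) = 0" using Qh Qc by (intro mom[of m "Q m"]) auto
    qed
  qed auto
  also have "\<dots> = P x v"
    using one by (simp add: Q_def)
  finally show "conv (fun_distr P) (dil \<rho> \<phi>) x v = P x v" .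
qed

text \<open>
  The value at \<open>x\<close> of a regularization at scale \<open>r/c\<close>, seen as the value on one test function of the
  functional rescaled to the ball with centre \<open>a\<close> and radius \<open>r\<close>.
\<close>

lemma rescale_zoom:
  fixes S :: "(real^'n \<Rightarrow> 'b::real_normed_vector) \<Rightarrow> real" and \<phi> :: "real^'n \<Rightarrow> real"
  assumes S: "linear_on_tests S" and \<phi>: "kernel 1 \<phi>" and r: "r > 0" and c: "c > 0"
  shows "rescale S a r (\<lambda>z. \<phi> ((c / r) *\<^sub>R (x - a) - c *\<^sub>R z) *\<^sub>R v)
    = inverse c ^ CARD('n) * S (\<lambda>y. dil (r / c) \<phi> (x - y) *\<^sub>R v)"
proof -
  have rc: "r / c > 0" using r c by simp
  have "(\<lambda>y. \<phi> ((c / r) *\<^sub>R (x - y)) *\<^sub>R v) \<in> test_functions"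
  proof -
    have "kernel (r / c) (\<lambda>z. (r / c) ^ CARD('n) * dil (r / c) \<phi> z)"
      by (rule kernel_cmul[OF kernel_dil[OF \<phi> rc]])
    from conv_integrand_in_test_functions[OF this, of x v]
    show ?thesis using r c by (simp add: dil_def power_divide)
  qed
  from linear_on_tests_cmul[OF S this, of "(c / r) ^ CARD('n)"]
  have "S (\<lambda>y. dil (r / c) \<phi> (x - y) *\<^sub>R v) = (c / r) ^ CARD('n) * S (\<lambda>y. \<phi> ((c / r) *\<^sub>R (x - y)) *\<^sub>R v)"
    by (simp add: dil_def)
  moreover have "(c / r) *\<^sub>R (x - a) - c *\<^sub>R (inverse r *\<^sub>R (y - a)) = (c / r) *\<^sub>R (x - y)" for y
    by (simp add: algebra_simps divide_inverse)
  ultimately show ?thesis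
    using r c by (simp add: rescale_def power_divide power_inverse field_simps)
qed

lemma zoomed_kernel_test:
  fixes \<phi> :: "real^'n \<Rightarrow> real" and v :: "'b::real_normed_vector"
  assumes \<phi>: "kernel 1 \<phi>" and r: "r > 0" and c: "c > 0" and x: "norm (x - a) + r / c \<le> r"
  shows "(\<lambda>z. \<phi> ((c / r) *\<^sub>R (x - a) - c *\<^sub>R z) *\<^sub>R v) \<in> unit_tests" (is ?A)
    and "iter_deriv (\<lambda>z. \<phi> ((c / r) *\<^sub>R (x - a) - c *\<^sub>R z) *\<^sub>R v) bs z
      = ((- c) ^ length bs * iter_deriv \<phi> bs ((c / r) *\<^sub>R (x - a) - c *\<^sub>R z)) *\<^sub>R v" (is ?B)
proof -
  let ?b = "(c / r) *\<^sub>R (x - a)"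
  have s: "smooth (\<lambda>z. \<phi> (?b - c *\<^sub>R z))"
    using smooth_affine[OF kernel_smooth[OF \<phi>], of "- c" ?b] by simp
  show ?B
    using smooth_iter_deriv_bounded_linear[OF bounded_linear_scaleR_left s, of v bs]
      iter_deriv_affine[OF kernel_smooth[OF \<phi>], of "- c" ?b bs] by simp
  show ?A
    unfolding test_functions_on_iff[OF compact_cball]
  proof (intro conjI allI impI)
    show "smooth (\<lambda>z. \<phi> (?b - c *\<^sub>R z) *\<^sub>R v)"
      by (rule smooth_bounded_linear[OF bounded_linear_scaleR_left s])
    fix z :: "real^'n" assume "z \<notin> cball 0 1"
    then have "1 < norm z" by simp
    then have "c * 1 < c * norm z" using c by (intro mult_strict_left_mono)
    moreover have "norm ?b = (c / r) * norm (x - a)" "norm (c *\<^sub>R z) = c * norm z" using r c by simp_all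
    moreover have "(c / r) * (norm (x - a) + r / c) \<le> (c / r) * r"
      using x r c by (intro mult_left_mono) auto
    then have "(c / r) * norm (x - a) + 1 \<le> c" using r c by (simp add: distrib_left)
    moreover have "norm (c *\<^sub>R z) - norm ?b \<le> norm (?b - c *\<^sub>R z)"
      by (metis norm_minus_commute norm_triangle_ineq2)
    ultimately have "1 < norm (?b - c *\<^sub>R z)" by linarith
    then show "\<phi> (?b - c *\<^sub>R z) *\<^sub>R v = 0" using \<phi> by (simp add: kernel_def)
  qed
qed

text \<open>
  On functions supported in the unit ball the \<open>L^p\<close> norm of the \<open>i\<close>-th derivative is controlled by its
  supremum. Small functions in the \<open>C^i\<close> sense are therefore admissible in the definition of \<open>\<nu>\<close> pointwise
  differentiability, for every \<open>i\<close> and \<open>p\<close>.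
\<close>

lemma nu_le_one:
  fixes i :: nat and p :: real
  assumes p: "1 \<le> p"
  obtains \<delta> where "\<delta> > 0" and
    "\<And>\<theta> :: real^'n \<Rightarrow> 'b::real_normed_vector. \<theta> \<in> unit_tests \<Longrightarrow>
      (\<And>bs x. bs \<in> basis_lists i \<Longrightarrow> norm (iter_deriv \<theta> bs x) \<le> \<delta>) \<Longrightarrow> \<nu> i p \<theta> \<le> 1"
proof -
  let ?B = "cball 0 1 :: (real^'n) set"
  define N where "N = real (card (basis_lists i :: (real^'n) list set))"
  define V where "V = measure lborel ?B"
  have NV: "N \<ge> 0" "V \<ge> 0" by (auto simp: N_def V_def)
  \<comment> \<open>Chosen so that both the bound \<open>N * \<delta>\<close> for the norm and \<open>N * \<delta> * V\<close> are at most 1. Then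
    the \<open>p\<close>-th power is at most the first power and its integral is at most 1.\<close>
  define \<delta> where "\<delta> = 1 / (N * (V + 1) + 1)"
  have "N * (V + 1) \<ge> 0" using NV by simp
  then have pos: "N * (V + 1) + 1 > 0" by linarith
  have \<delta>: "\<delta> > 0" using pos by (simp add: \<delta>_def)
  have D: "N * \<delta> * (V + 1) \<le> 1" using pos by (simp add: \<delta>_def field_simps)
  show thesis
  proof (rule that[OF \<delta>])
    fix \<theta> :: "real^'n \<Rightarrow> 'b"
    assume th: "\<theta> \<in> test_functions_on ?B"
      and bd: "\<And>bs x. bs \<in> basis_lists i \<Longrightarrow> norm (iter_deriv \<theta> bs x) \<le> \<delta>"
    have sm: "smooth \<theta>" and out: "\<And>x. x \<notin> ?B \<Longrightarrow> \<theta> x = 0"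
      using th by (auto simp: test_functions_on_iff)
    let ?m = "\<lambda>x. mnorm i (higher_deriv i \<theta> x)"
    have m0: "0 \<le> ?m x" for x
      by (intro mnorm_nonneg higher_deriv_multilinear smooth_C_diff[OF sm])
    have le: "?m x \<le> (\<Sum>bs\<in>basis_lists i. norm (iter_deriv \<theta> bs x))" for x
    proof -
      have "?m x \<le> (\<Sum>bs\<in>basis_lists i. norm (higher_deriv i \<theta> x bs))"
        by (intro mnorm_le_sum higher_deriv_multilinear smooth_C_diff[OF sm])
      also have "\<dots> = (\<Sum>bs\<in>basis_lists i. norm (iter_deriv \<theta> bs x))"
        by (intro sum.cong) (auto simp: higher_deriv_def basis_lists_def)
      finally show ?thesis .
    qed
    have m1: "?m x \<le> N * \<delta>" for x
      using le[of x] sum_bounded_above[of "basis_lists i" "\<lambda>bs. norm (iter_deriv \<theta> bs x)" \<delta>] bd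
      by (simp add: N_def)
    have mz: "?m x = 0" if "x \<notin> ?B" for x
    proof -
      have "iter_deriv \<theta> bs x = 0" for bs
        by (rule iter_deriv_outside[OF _ sm out that]) auto
      then show ?thesis using le[of x] m0[of x] by simp
    qed
    have ND: "N * \<delta> \<ge> 0" "N * \<delta> \<le> 1" "N * \<delta> * V \<le> 1"
    proof -
      show "N * \<delta> \<ge> 0" using NV \<delta> by simp
      then have "N * \<delta> * V \<ge> 0" using NV by simp
      then show "N * \<delta> \<le> 1" "N * \<delta> * V \<le> 1" using D \<open>N * \<delta> \<ge> 0\<close> by (auto simp: distrib_left)
    qed
    have pw: "?m x powr p \<le> N * \<delta> * indicator ?B x" for x
    proof (cases "x \<in> ?B")
      case True
      have "?m x powr p \<le> (N * \<delta>) powr p" using m0 m1 p by (intro powr_mono2) auto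
      also have "\<dots> \<le> (N * \<delta>) powr 1" using ND p by (intro powr_mono') auto
      finally show ?thesis using True ND by simp
    next
      case False
      then show ?thesis using mz p by simp
    qed
    have "(LINT x|lborel. ?m x powr p) \<le> (LINT x|lborel. N * \<delta> * indicator ?B x)"
      by (rule integral_mono') (use pw ND emeasure_lborel_cball_finite in \<open>auto intro!: integrable_mult_right integrable_real_indicator\<close>)
    also have "\<dots> \<le> 1" using ND by (simp add: V_def)
    finally have "(LINT x|lborel. ?m x powr p) powr (1 / p) \<le> 1 powr (1 / p)"
      using p by (intro powr_mono2) (auto intro!: integral_nonneg)
    then show "\<nu> i p \<theta> \<le> 1" by (simp add: \<nu>_def)
  qed
qed

text \<open>
  The test functions that arise from a fixed kernel at a fixed ratio \<open>c\<close> of scales are, up to a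
  translation by a bounded vector, all the same one. A single constant times \<open>norm v\<close>
  therefore makes all of them admissible.
\<close>

lemma zoomed_kernel_estimate:
  fixes \<phi> :: "real^'n \<Rightarrow> real"
  assumes p: "1 \<le> p" and \<phi>: "kernel 1 \<phi>" and c: "c > 0"
  obtains C where "C \<ge> 0" and
    "\<And>(S :: (real^'n \<Rightarrow> 'b::real_normed_vector) \<Rightarrow> real) a r H x v. linear_on_tests S \<Longrightarrow> r > 0 \<Longrightarrow>
      (\<And>\<theta>. \<theta> \<in> unit_tests \<Longrightarrow> \<nu> i p \<theta> \<le> 1 \<Longrightarrow> rescale S a r \<theta> \<le> H) \<Longrightarrow>
      norm (x - a) + r / c \<le> r \<Longrightarrow> \<bar>S (\<lambda>y. dil (r / c) \<phi> (x - y) *\<^sub>R v)\<bar> \<le> C * H * norm v"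
proof -
  obtain \<delta> where \<delta>: "\<delta> > 0" and nu: "\<And>\<theta> :: real^'n \<Rightarrow> 'b. \<theta> \<in> unit_tests \<Longrightarrow>
      (\<And>bs x. bs \<in> basis_lists i \<Longrightarrow> norm (iter_deriv \<theta> bs x) \<le> \<delta>) \<Longrightarrow> \<nu> i p \<theta> \<le> 1"
    using nu_le_one[OF p] by metis
  obtain M0 where M0: "derivs_bounded i M0 \<phi>"
    using kernel_bounded[OF \<phi>] by metis
  define M where "M = c ^ i * (\<bar>M0\<bar> + 1)"
  have M: "M > 0" using c by (simp add: M_def)
  have M': "c ^ i * \<bar>iter_deriv \<phi> bs z\<bar> \<le> M" if "bs \<in> basis_lists i" for bs z
    using derivs_boundedD[OF M0, of bs z] that c unfolding M_def by (intro mult_left_mono) (auto simp: basis_lists_def)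
  show thesis
  proof (rule that[of "c ^ CARD('n) * M / \<delta>"])
    show "c ^ CARD('n) * M / \<delta> \<ge> 0" using c M \<delta> by simp
    fix S :: "(real^'n \<Rightarrow> 'b) \<Rightarrow> real" and a x :: "real^'n" and r H and v :: 'b
    assume S: "linear_on_tests S" and r: "r > 0"
      and H: "\<And>\<theta>. \<theta> \<in> unit_tests \<Longrightarrow> \<nu> i p \<theta> \<le> 1 \<Longrightarrow> rescale S a r \<theta> \<le> H"
      and x: "norm (x - a) + r / c \<le> r"
    have rc: "r / c > 0" using r c by simp
    have tf: "(\<lambda>y. dil (r / c) \<phi> (x - y) *\<^sub>R v) \<in> test_functions" for v :: 'b
      by (rule conv_integrand_in_test_functions[OF kernel_dil[OF \<phi> rc]])
    have scal: "S (\<lambda>y. dil (r / c) \<phi> (x - y) *\<^sub>R (t *\<^sub>R v)) = t * S (\<lambda>y. dil (r / c) \<phi> (x - y) *\<^sub>R v)" for t v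
      using linear_on_tests_cmul[OF S tf, of t v] by (simp add: mult.commute)
    have one_sided: "S (\<lambda>y. dil (r / c) \<phi> (x - y) *\<^sub>R v) \<le> c ^ CARD('n) * H" if "M * norm v \<le> \<delta>" for v
    proof -
      let ?\<theta> = "\<lambda>z. \<phi> ((c / r) *\<^sub>R (x - a) - c *\<^sub>R z) *\<^sub>R v"
      have "\<nu> i p ?\<theta> \<le> 1"
      proof (rule nu[OF zoomed_kernel_test(1)[OF \<phi> r c x]])
        fix bs z assume bs: "bs \<in> (basis_lists i :: (real^'n) list set)"
        then have "length bs = i" by (simp add: basis_lists_def)
        then have "norm (iter_deriv ?\<theta> bs z)
            = c ^ i * \<bar>iter_deriv \<phi> bs ((c / r) *\<^sub>R (x - a) - c *\<^sub>R z)\<bar> * norm v"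
          using c by (simp add: zoomed_kernel_test(2)[OF \<phi> r c x] abs_mult power_abs)
        also have "\<dots> \<le> M * norm v" using M'[OF bs] by (intro mult_right_mono) auto
        finally show "norm (iter_deriv ?\<theta> bs z) \<le> \<delta>" using that by linarith
      qed
      then have "rescale S a r ?\<theta> \<le> H" by (rule H[OF zoomed_kernel_test(1)[OF \<phi> r c x]])
      then have "inverse c ^ CARD('n) * S (\<lambda>y. dil (r / c) \<phi> (x - y) *\<^sub>R v) \<le> H"
        by (simp only: rescale_zoom[OF S \<phi> r c])
      then show ?thesis
        using c by (simp add: power_inverse field_simps)
    qed
    show "\<bar>S (\<lambda>y. dil (r / c) \<phi> (x - y) *\<^sub>R v)\<bar> \<le> c ^ CARD('n) * M / \<delta> * H * norm v"
    proof (cases "v = 0")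
      case True
      then show ?thesis using scal[of 0 0] by simp
    next
      case False
      define t where "t = \<delta> / (M * norm v)"
      have t: "t > 0" using \<delta> M False by (simp add: t_def)
      have le: "M * norm (t *\<^sub>R v) \<le> \<delta>" "M * norm ((- t) *\<^sub>R v) \<le> \<delta>"
        using t M False \<delta> by (auto simp: t_def)
      have "t * \<bar>S (\<lambda>y. dil (r / c) \<phi> (x - y) *\<^sub>R v)\<bar> \<le> c ^ CARD('n) * H"
        using one_sided[OF le(1)] one_sided[OF le(2)] scal[of t v] scal[of "- t" v] t
        by (auto simp: abs_if simp del: scaleR_minus_left)
      then have "\<bar>S (\<lambda>y. dil (r / c) \<phi> (x - y) *\<^sub>R v)\<bar> \<le> c ^ CARD('n) * H / t"
        using t by (simp add: pos_le_divide_eq mult.commute)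
      then show ?thesis by (simp add: t_def mult_ac)
    qed
  qed
qed

section \<open>Smooth cutoffs\<close>

lemma cutoff_apply:
  fixes \<phi> :: "real^'n \<Rightarrow> real"
  assumes D: "D \<in> sets borel" and \<phi>: "kernel 1 \<phi>" and \<rho>: "\<rho> > 0"
  shows "conv (set_distr D) (dil \<rho> \<phi>) x 1
    = (LINT y|lborel. indicator D y * dil \<rho> \<phi> (x - y))"
  unfolding conv_apply[OF locally_finite_order_set_distr[OF D] kernel_dil[OF \<phi> \<rho>]]
  by (simp add: set_distr_def fun_distr_def scaleR_blinfun.rep_eq)

text \<open>
  Substituting \<open>y = x - \<rho> z\<close> removes \<open>\<rho>\<close> from the bound.
\<close>

lemma cutoff_bound:
  fixes \<phi> :: "real^'n \<Rightarrow> real"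
  assumes D: "D \<in> sets borel" and \<phi>: "kernel 1 \<phi>" and M: "\<And>z. \<bar>\<phi> z\<bar> \<le> M" and \<rho>: "\<rho> > 0"
  shows "\<bar>conv (set_distr D) (dil \<rho> \<phi>) x 1\<bar>
    \<le> M * measure lborel (cball 0 1 :: (real^'n) set)"
proof -
  let ?f = "\<lambda>y. indicator D y * dil \<rho> \<phi> (x - y)"
  let ?h = "\<lambda>z. indicator D (x + - \<rho> *\<^sub>R z) * \<phi> z"
  have [measurable]: "\<phi> \<in> borel_measurable borel" "dil \<rho> \<phi> \<in> borel_measurable borel" "D \<in> sets borel"
    using D smooth_continuous[OF kernel_smooth[OF \<phi>]] smooth_continuous[OF kernel_smooth[OF kernel_dil[OF \<phi> \<rho>]]]
    by (auto intro: borel_measurable_continuous_onI)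
  have "(LINT y|lborel. ?f y) = \<bar>- \<rho>\<bar> ^ CARD('n) * (LINT z|lborel. ?f (x + - \<rho> *\<^sub>R z))"
    by (rule lborel_integral_affine) (use \<rho> in auto)
  also have "(\<lambda>z. ?f (x + - \<rho> *\<^sub>R z)) = (\<lambda>z. inverse \<rho> ^ CARD('n) * ?h z)"
    using \<rho> by (simp add: dil_def fun_eq_iff mult_ac)
  also have "\<bar>- \<rho>\<bar> ^ CARD('n) * (LINT z|lborel. inverse \<rho> ^ CARD('n) * ?h z) = (LINT z|lborel. ?h z)"
    using \<rho> by (simp add: power_inverse)
  finally have eq: "(LINT y|lborel. ?f y) = (LINT z|lborel. ?h z)" .
  have M0: "M \<ge> 0" using M[of 0] by simp
  have "\<bar>LINT z|lborel. ?h z\<bar> \<le> M * measure lborel (cball 0 1 :: (real^'n) set)"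
  proof (rule integrable_compact_support(2))
    show "?h \<in> borel_measurable borel" by measurable
    show "\<bar>?h z\<bar> \<le> M" for z using M M0 by (auto simp: indicator_def)
    show "?h z = 0" if "z \<notin> cball 0 1" for z using \<phi> that by (simp add: kernel_def)
  qed auto
  then show ?thesis using eq by (simp add: cutoff_apply[OF D \<phi> \<rho>])
qed

lemma cutoff_zero:
  fixes \<phi> :: "real^'n \<Rightarrow> real"
  assumes D: "D \<in> sets borel" and \<phi>: "kernel 1 \<phi>" and \<rho>: "\<rho> > 0" and "cball x \<rho> \<inter> D = {}"
  shows "conv (set_distr D) (dil \<rho> \<phi>) x 1 = 0"
proof -
  have "(\<lambda>y. indicator D y * dil \<rho> \<phi> (x - y)) = (\<lambda>y. 0)"
  proof
    fix y show "indicator D y * dil \<rho> \<phi> (x - y) = 0"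
      using assms(4) kernel_dil[OF \<phi> \<rho>]
      by (cases "y \<in> cball x \<rho>") (auto simp: indicator_def kernel_def dist_norm)
  qed
  then show ?thesis unfolding cutoff_apply[OF D \<phi> \<rho>] by simp
qed

lemma cutoff_one:
  fixes \<phi> :: "real^'n \<Rightarrow> real"
  assumes D: "D \<in> sets borel" and mk: "moment_kernel k \<phi>" and \<rho>: "\<rho> > 0"
    and "cball x \<rho> \<subseteq> D"
  shows "conv (set_distr D) (dil \<rho> \<phi>) x 1 = 1"
proof -
  note \<phi> = moment_kernel_kernel[OF mk]
  have U: "UNIV \<in> sets (borel :: (real^'n) measure)" by simp
  have "indicator D y * dil \<rho> \<phi> (x - y) = indicator UNIV y * dil \<rho> \<phi> (x - y)" for y
    using assms(4) kernel_dil[OF \<phi> \<rho>]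
    by (cases "y \<in> cball x \<rho>") (auto simp: indicator_def kernel_def dist_norm)
  then have "conv (set_distr D) (dil \<rho> \<phi>) x 1
      = conv (set_distr UNIV) (dil \<rho> \<phi>) x 1"
    by (simp only: cutoff_apply[OF D \<phi> \<rho>] cutoff_apply[OF U \<phi> \<rho>])
  also have "\<dots> = 1"
    using conv_polynomial[OF degree_at_most_const[of "id_blinfun :: real \<Rightarrow>\<^sub>L real"]
        moment_kernel_0[OF mk] \<rho>]
    by (simp add: set_distr_def)
  finally show ?thesis .
qed

section \<open>Differentiation of series and Lipschitz estimates\<close>

lemma norm_derivative_le_sum_Basis:
  fixes f :: "real^'n \<Rightarrow> 'c::real_normed_vector"
  assumes "linear f'" and "\<And>b. b \<in> Basis \<Longrightarrow> norm (f' b) \<le> B b"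
  shows "norm (f' u) \<le> (\<Sum>b\<in>(Basis :: (real^'n) set). B b) * norm u"
proof -
  have "f' u = f' (\<Sum>b\<in>Basis. (u \<bullet> b) *\<^sub>R b)" by (simp only: euclidean_representation)
  also have "\<dots> = (\<Sum>b\<in>Basis. (u \<bullet> b) *\<^sub>R f' b)"
    by (simp only: linear_sum[OF assms(1)] linear_cmul[OF assms(1)])
  finally have "norm (f' u) \<le> (\<Sum>b\<in>(Basis :: (real^'n) set). norm ((u \<bullet> b) *\<^sub>R f' b))" by (simp only: norm_sum)
  also have "\<dots> \<le> (\<Sum>b\<in>(Basis :: (real^'n) set). norm u * B b)"
    unfolding norm_scaleR by (intro sum_mono mult_mono assms(2)) (auto intro: Basis_le_norm)
  also have "\<dots> = (\<Sum>b\<in>(Basis :: (real^'n) set). B b) * norm u"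
    unfolding sum_distrib_left[symmetric] by (rule mult.commute)
  finally show ?thesis .
qed

lemma smooth_lipschitz:
  fixes f :: "real^'n \<Rightarrow> 'c::real_normed_vector"
  assumes f: "smooth f" and S: "convex S" and B: "\<And>x b. x \<in> S \<Longrightarrow> b \<in> Basis \<Longrightarrow> norm (ddir b f x) \<le> B b"
    and "x \<in> S" "y \<in> S"
  shows "norm (f x - f y) \<le> (\<Sum>b\<in>Basis. B b) * norm (x - y)"
proof (rule differentiable_bound[OF S _ _ assms(4,5)])
  show "(f has_derivative frechet_derivative f (at z)) (at z within S)" for z
    using smooth_has_derivative[OF f] has_derivative_at_withinI by blast
  show "onorm (frechet_derivative f (at z)) \<le> (\<Sum>b\<in>Basis. B b)" if "z \<in> S" for z
  proof (rule onorm_le)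
    show "norm (frechet_derivative f (at z) u) \<le> (\<Sum>b\<in>Basis. B b) * norm u" for u
      by (rule norm_derivative_le_sum_Basis[OF has_derivative_linear[OF smooth_has_derivative[OF f]]])
        (rule B[OF that])
  qed
qed

text \<open>
  By induction on the order. Summable bounds in the basis directions bound the derivatives of the
  terms as linear maps, which is what termwise differentiation requires.
\<close>

lemma smooth_series:
  fixes h :: "nat \<Rightarrow> real^'n \<Rightarrow> 'c::banach"
  assumes "\<And>q. smooth (h q)"
    and "\<And>vs. length vs \<le> k \<Longrightarrow> \<exists>M. summable M \<and> (\<forall>q x. norm (iter_deriv (h q) vs x) \<le> M q)"
  shows "C_diff k (\<lambda>x. \<Sum>q. h q x) \<and>
    (\<forall>vs. length vs \<le> k \<longrightarrow> iter_deriv (\<lambda>x. \<Sum>q. h q x) vs = (\<lambda>x. \<Sum>q. iter_deriv (h q) vs x))"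
  using assms
proof (induction k arbitrary: h)
  case 0
  obtain M where M: "summable M" "\<And>q x. norm (h q x) \<le> M q" using 0(2)[of "[]"] by auto
  have "uniform_limit UNIV (\<lambda>n x. \<Sum>q<n. h q x) (\<lambda>x. \<Sum>q. h q x) sequentially"
    by (rule Weierstrass_m_test) (use M in auto)
  then have "continuous_on UNIV (\<lambda>x. \<Sum>q. h q x)"
    by (rule uniform_limit_theorem[rotated])
      (auto intro!: always_eventually continuous_on_sum smooth_continuous[OF 0(1)])
  then show ?case by simp
next
  case (Suc k)
  have summ: "summable (\<lambda>q. iter_deriv (h q) vs x)" if "length vs \<le> Suc k" for vs x
    using Suc.prems(2)[OF that] by (metis summable_comparison_test')
  have lin: "linear (frechet_derivative (h q) (at x))" for q x
    by (rule has_derivative_linear[OF smooth_has_derivative[OF Suc.prems(1)]])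
  have der: "((\<lambda>x. \<Sum>q. h q x) has_derivative (\<lambda>u. \<Sum>q. ddir u (h q) x)) (at x)" for x
  proof -
    have "\<forall>b. \<exists>M. summable M \<and> (\<forall>q x. norm (ddir b (h q) x) \<le> M q)"
      using Suc.prems(2)[of "[_]"] by simp
    then obtain M where M: "\<And>b. summable (M b)" "\<And>b q x. norm (ddir b (h q) x) \<le> M b q" by metis
    define N where "N = (\<lambda>q. \<Sum>b\<in>(Basis :: (real^'n) set). M b q)"
    have N: "summable N" unfolding N_def by (intro summable_sum M)
    have Nb: "norm (ddir u (h q) y) \<le> N q * norm u" for q y u
      unfolding N_def by (rule norm_derivative_le_sum_Basis[OF lin M(2)])
    have su: "summable (\<lambda>q. ddir u (h q) y)" for u y using summ[of "[u]" y] by simp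
    have "\<exists>g. \<forall>y\<in>UNIV. (\<lambda>q. h q y) sums g y \<and> (g has_derivative (\<lambda>u. \<Sum>q. ddir u (h q) y)) (at y within UNIV)"
    proof (rule has_derivative_series)
      show "(h q has_derivative frechet_derivative (h q) (at y)) (at y within UNIV)" for q y
        using smooth_has_derivative[OF Suc.prems(1)] by simp
      show "(\<lambda>q. h q x) sums (\<Sum>q. h q x)" using summ[of "[]" x] by (simp add: summable_sums)
      fix e :: real assume e: "e > 0"
      have "(\<lambda>n. \<Sum>q. N (q + n)) \<longlonglongrightarrow> 0" using suminf_exist_split2[OF N] by simp
      then have "\<forall>\<^sub>F n in sequentially. (\<Sum>q. N (q + n)) < e" using e by (rule order_tendstoD)
      then show "\<forall>\<^sub>F n in sequentially. \<forall>y\<in>UNIV. \<forall>u.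
          norm ((\<Sum>q<n. frechet_derivative (h q) (at y) u) - (\<Sum>q. ddir u (h q) y)) \<le> e * norm u"
      proof eventually_elim
        case (elim n)
        show ?case
        proof (intro ballI allI)
          fix y u :: "real^'n"
          have "norm ((\<Sum>q<n. ddir u (h q) y) - (\<Sum>q. ddir u (h q) y)) = norm (\<Sum>q. ddir u (h (q + n)) y)"
            using suminf_split_initial_segment[OF su[of y u], of n] by simp
          also have "\<dots> \<le> (\<Sum>q. N (q + n) * norm u)"
            using N Nb by (intro norm_suminf_le summable_mult2 summable_ignore_initial_segment) auto
          also have "\<dots> = (\<Sum>q. N (q + n)) * norm u"
            using N by (intro suminf_mult2[symmetric] summable_ignore_initial_segment)
          also have "\<dots> \<le> e * norm u" using elim by (intro mult_right_mono) auto
          finally show "norm ((\<Sum>q<n. ddir u (h q) y) - (\<Sum>q. ddir u (h q) y)) \<le> e * norm u" .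
        qed
      qed
    qed auto
    then obtain g where g: "\<And>y. (\<lambda>q. h q y) sums g y" "\<And>y. (g has_derivative (\<lambda>u. \<Sum>q. ddir u (h q) y)) (at y)"
      by auto
    have "g = (\<lambda>y. \<Sum>q. h q y)" using sums_unique[OF g(1)] by auto
    then show ?thesis using g(2) by simp
  qed
  have dd: "ddir v (\<lambda>x. \<Sum>q. h q x) = (\<lambda>x. \<Sum>q. ddir v (h q) x)" for v
    by (intro ext ddir_eqI der)
  have IH: "C_diff k (\<lambda>x. \<Sum>q. ddir v (h q) x) \<and> (\<forall>vs. length vs \<le> k \<longrightarrow>
      iter_deriv (\<lambda>x. \<Sum>q. ddir v (h q) x) vs = (\<lambda>x. \<Sum>q. iter_deriv (ddir v (h q)) vs x))" for v
  proof (rule Suc.IH[OF smooth_ddir[OF Suc.prems(1)]])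
    show "\<exists>M. summable M \<and> (\<forall>q x. norm (iter_deriv (ddir v (h q)) vs x) \<le> M q)" if "length vs \<le> k" for vs
      using Suc.prems(2)[of "v # vs"] that by simp
  qed
  show ?case
  proof (intro conjI allI impI)
    show "C_diff (Suc k) (\<lambda>x. \<Sum>q. h q x)" using IH by (intro C_diff_SucI[OF der]) blast
    fix vs :: "(real^'n) list" assume vs: "length vs \<le> Suc k"
    show "iter_deriv (\<lambda>x. \<Sum>q. h q x) vs = (\<lambda>x. \<Sum>q. iter_deriv (h q) vs x)"
      using vs IH by (cases vs) (simp_all add: dd)
  qed
qed

section \<open>Families of functions with scaling bounds\<close>

text \<open>
  A function that varies by \<open>\<rho>^s\<close> on the length scale \<open>\<rho>\<close> loses a factor \<open>\<rho>\<close> with every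
  derivative. The constant may depend on the list of directions but not on \<open>q\<close>; in this form the
  bounds multiply, and no Leibniz formula for higher derivatives has to be written down.
\<close>

definition scaled :: "(nat \<Rightarrow> real) \<Rightarrow> real \<Rightarrow> (nat \<Rightarrow> (real^'n) set)
    \<Rightarrow> (nat \<Rightarrow> real^'n \<Rightarrow> 'c::real_normed_vector) \<Rightarrow> bool" where
  "scaled \<rho> s U f \<longleftrightarrow> (\<forall>q. smooth (f q)) \<and>
    (\<forall>vs. \<exists>C. \<forall>q. \<forall>x\<in>U q. norm (iter_deriv (f q) vs x) \<le> C * \<rho> q powr (s - real (length vs)))"

lemma scaled_ddir:
  assumes "scaled \<rho> s U f" shows "scaled \<rho> (s - 1) U (\<lambda>q. ddir v (f q))"
  unfolding scaled_def
proof (intro conjI allI)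
  show "smooth (ddir v (f q))" for q using assms smooth_ddir by (auto simp: scaled_def)
  fix vs
  have "\<exists>C. \<forall>q. \<forall>x\<in>U q. norm (iter_deriv (f q) (v # vs) x) \<le> C * \<rho> q powr (s - real (length (v # vs)))"
    using assms unfolding scaled_def by blast
  then show "\<exists>C. \<forall>q. \<forall>x\<in>U q. norm (iter_deriv (ddir v (f q)) vs x) \<le> C * \<rho> q powr (s - 1 - real (length vs))"
    by (simp add: algebra_simps)
qed

lemma scaled_scaleR:
  fixes f :: "nat \<Rightarrow> real^'n \<Rightarrow> real" and g :: "nat \<Rightarrow> real^'n \<Rightarrow> 'c::real_normed_vector"
  assumes \<rho>: "\<And>q. \<rho> q > 0" and "scaled \<rho> s U f" "scaled \<rho> t U g"
  shows "scaled \<rho> (s + t) U (\<lambda>q x. f q x *\<^sub>R g q x)"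
proof -
  have "\<exists>C. \<forall>q. \<forall>x\<in>U q. norm (iter_deriv (\<lambda>x. f q x *\<^sub>R g q x) vs x) \<le> C * \<rho> q powr (s + t - real (length vs))"
    if "scaled \<rho> s U f" "scaled \<rho> t U g"
    for vs s t and f :: "nat \<Rightarrow> real^'n \<Rightarrow> real" and g :: "nat \<Rightarrow> real^'n \<Rightarrow> 'c"
    using that
  proof (induction vs arbitrary: f g s t)
    case Nil
    obtain Cf where Cf: "\<And>q x. x \<in> U q \<Longrightarrow> \<bar>f q x\<bar> \<le> Cf * \<rho> q powr s"
      using Nil(1) unfolding scaled_def by (metis diff_0_right iter_deriv.simps(1) list.size(3) of_nat_0 real_norm_def)
    obtain Cg where Cg: "\<And>q x. x \<in> U q \<Longrightarrow> norm (g q x) \<le> Cg * \<rho> q powr t"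
      using Nil(2) unfolding scaled_def by (metis diff_0_right iter_deriv.simps(1) list.size(3) of_nat_0)
    have "\<bar>f q x\<bar> * norm (g q x) \<le> (Cf * \<rho> q powr s) * (Cg * \<rho> q powr t)" if "x \<in> U q" for q x
      using Cf[OF that] Cg[OF that] by (intro mult_mono) (auto intro: order_trans[OF abs_ge_zero])
    then show ?case by (intro exI[of _ "Cf * Cg"]) (simp add: powr_add mult_ac)
  next
    case (Cons v vs)
    have sf: "smooth (f q)" "smooth (g q)" for q using Cons.prems by (auto simp: scaled_def)
    have dd: "ddir v (\<lambda>x. f q x *\<^sub>R g q x) = (\<lambda>x. f q x *\<^sub>R ddir v (g q) x + ddir v (f q) x *\<^sub>R g q x)" for q
      by (intro ext ddir_eqI has_derivative_scaleR smooth_has_derivative sf)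
    obtain C1 where C1: "\<And>q x. x \<in> U q \<Longrightarrow> norm (iter_deriv (\<lambda>x. f q x *\<^sub>R ddir v (g q) x) vs x)
        \<le> C1 * \<rho> q powr (s + (t - 1) - real (length vs))"
      using Cons.IH[OF Cons.prems(1) scaled_ddir[OF Cons.prems(2)]] by blast
    obtain C2 where C2: "\<And>q x. x \<in> U q \<Longrightarrow> norm (iter_deriv (\<lambda>x. ddir v (f q) x *\<^sub>R g q x) vs x)
        \<le> C2 * \<rho> q powr ((s - 1) + t - real (length vs))"
      using Cons.IH[OF scaled_ddir[OF Cons.prems(1)] Cons.prems(2)] by blast
    have ex: "s + (t - 1) - real (length vs) = s + t - real (length (v # vs))"
      "(s - 1) + t - real (length vs) = s + t - real (length (v # vs))" by auto
    have "norm (iter_deriv (\<lambda>x. f q x *\<^sub>R g q x) (v # vs) x)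
        \<le> (C1 + C2) * \<rho> q powr (s + t - real (length (v # vs)))" if x: "x \<in> U q" for q x
    proof -
      have "iter_deriv (\<lambda>x. f q x *\<^sub>R g q x) (v # vs) x
          = iter_deriv (\<lambda>x. f q x *\<^sub>R ddir v (g q) x) vs x + iter_deriv (\<lambda>x. ddir v (f q) x *\<^sub>R g q x) vs x"
        using smooth_iter_deriv_add[OF smooth_scaleR[OF sf(1) smooth_ddir[OF sf(2)]]
            smooth_scaleR[OF smooth_ddir[OF sf(1)] sf(2)], where vs=vs]
        by (simp add: dd)
      then show ?thesis
        using C1[OF x] C2[OF x] norm_triangle_ineq unfolding ex distrib_right by (smt (verit))
    qed
    then show ?case by blast
  qed
  from this[OF assms(2,3)] show ?thesis
    using assms(2,3) unfolding scaled_def[of _ "s + t"] by (simp add: scaled_def smooth_scaleR)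
qed

section \<open>Extension from a set of uniform approximability\<close>

text \<open>
  The points of \<open>E\<close> satisfy the differentiability estimate with common constants \<open>J\<close> and \<open>r0\<close>. For a maximal
  such set, closedness will be a consequence of the extension constructed here.
\<close>

locale uniform_approximation =
  fixes T :: "(real^'n \<Rightarrow> 'b::banach) \<Rightarrow> real"
    and i k :: nat and \<alpha> p J r0 :: real
    and E :: "(real^'n) set" and P :: "real^'n \<Rightarrow> real^'n \<Rightarrow> ('b \<Rightarrow>\<^sub>L real)"
    and \<phi> :: "real^'n \<Rightarrow> real"
  assumes alpha: "0 < \<alpha>" "\<alpha> \<le> 1" and p: "1 \<le> p" and T: "locally_finite_order T"
    and r0: "0 < r0" and E: "E \<noteq> {}"
    and P: "\<And>a. a \<in> E \<Longrightarrow> degree_at_most k (P a)"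
    and est: "\<And>a r \<theta>. a \<in> E \<Longrightarrow> 0 < r \<Longrightarrow> r < r0 \<Longrightarrow> \<theta> \<in> unit_tests \<Longrightarrow> \<nu> i p \<theta> \<le> 1 \<Longrightarrow>
      rescale (\<lambda>\<eta>. T \<eta> - fun_distr (P a) \<eta>) a r \<theta> \<le> J * r powr (real k + \<alpha>)"
    and mk: "moment_kernel k \<phi>"
begin

lemmas ker = moment_kernel_kernel[OF mk]

definition \<rho> :: "nat \<Rightarrow> real" where "\<rho> q = r0 / 16 * (1 / 2) ^ q"

text \<open>
  The scale starts at \<open>r0 / 16\<close> because the estimates at scale \<open>\<rho> q\<close> use the ball of radius
  \<open>8 \<rho> q\<close>, which has to be smaller than \<open>r0\<close>.
\<close>

definition g :: "nat \<Rightarrow> real^'n \<Rightarrow> ('b \<Rightarrow>\<^sub>L real)" where "g q = conv T (dil (\<rho> q) \<phi>)"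

text \<open>
  The characteristic function of the \<open>4 \<rho> q\<close>-neighbourhood smoothed at scale \<open>\<rho> q\<close>: it is 1
  within distance \<open>3 \<rho> q\<close> of \<open>E\<close> and 0 beyond distance \<open>5 \<rho> q\<close>.
\<close>

definition cut :: "nat \<Rightarrow> real^'n \<Rightarrow> real" where
  "cut q x = conv (set_distr {y. infdist y E \<le> 4 * \<rho> q})
      (dil (\<rho> q) \<phi>) x 1"

text \<open>
  Near \<open>E\<close> the sums \<open>F Q\<close> telescope to \<open>g Q\<close>. Away from \<open>E\<close>, where the regularizations of \<open>T\<close> need not
  converge, the cutoffs stop the summation.
\<close>

definition h :: "nat \<Rightarrow> real^'n \<Rightarrow> ('b \<Rightarrow>\<^sub>L real)" where
  "h q x = cut (Suc q) x *\<^sub>R (g (Suc q) x - g q x)"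

definition F :: "nat \<Rightarrow> real^'n \<Rightarrow> ('b \<Rightarrow>\<^sub>L real)" where
  "F Q x = g 0 x + (\<Sum>q<Q. h q x)"

definition extension :: "real^'n \<Rightarrow> ('b \<Rightarrow>\<^sub>L real)" where
  "extension x = g 0 x + (\<Sum>q. h q x)"

lemma rho_pos: "\<rho> q > 0"
  using r0 by (simp add: \<rho>_def)

lemma rho_Suc: "\<rho> (Suc q) = \<rho> q / 2"
  by (simp add: \<rho>_def)

lemma rho_antimono: "q \<le> q' \<Longrightarrow> \<rho> q' \<le> \<rho> q"
  using r0 by (auto simp: \<rho>_def intro!: mult_left_mono power_decreasing)

lemma rho_powr: "\<rho> q powr s = \<rho> 0 powr s * ((1 / 2) powr s) ^ q"
proof (induction q)
  case (Suc q)
  have "\<rho> (Suc q) powr s = (1 / 2 * \<rho> q) powr s" by (simp add: rho_Suc)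
  also have "\<dots> = (1 / 2) powr s * \<rho> q powr s" by (rule powr_mult)
  finally show ?case by (simp add: Suc.IH mult_ac)
qed simp

lemma rho_tendsto_0: "s > 0 \<Longrightarrow> (\<lambda>q. C * \<rho> q powr s) \<longlonglongrightarrow> 0"
proof -
  assume s: "s > 0"
  have "(1 / 2 :: real) powr s < 1" using s powr_less_mono2[of s "1/2" 1] by simp
  then have "(\<lambda>q. ((1 / 2 :: real) powr s) ^ q) \<longlonglongrightarrow> 0" by (intro LIMSEQ_power_zero) simp
  from tendsto_mult_left[OF this, of "C * \<rho> 0 powr s"] show ?thesis
    by (subst rho_powr) (simp add: mult.assoc)
qed

lemma smooth_g: "smooth (g q)"
  unfolding g_def by (rule smooth_conv[OF T kernel_dil[OF ker rho_pos]])

text \<open>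
  A kernel of radius \<open>\<rho> q\<close> placed at distance at most \<open>7 \<rho> q\<close> from \<open>a\<close> lies in the ball about \<open>a\<close> of
  radius \<open>8 \<rho> q\<close>. There \<open>T - P a\<close> is small by hypothesis, and \<open>P a\<close> is reproduced by the kernel.
\<close>

lemma approx:
  "\<exists>C\<ge>0. \<forall>q. \<forall>a\<in>E. \<forall>x. norm (x - a) \<le> 7 * \<rho> q \<longrightarrow>
    norm (iter_deriv (\<lambda>x. g q x - P a x) vs x) \<le> C * \<rho> q powr (real k + \<alpha> - real (length vs))"
proof -
  let ?\<psi> = "iter_deriv \<phi> vs" and ?e = "real k + \<alpha>"
  have k\<psi>: "kernel 1 ?\<psi>" by (rule kernel_iter_deriv[OF ker])
  obtain C where C: "C \<ge> 0" and bound: "\<And>(S :: (real^'n \<Rightarrow> 'b) \<Rightarrow> real) a r H x v. linear_on_tests S \<Longrightarrow> r > 0 \<Longrightarrow>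
      (\<And>\<theta>. \<theta> \<in> unit_tests \<Longrightarrow> \<nu> i p \<theta> \<le> 1 \<Longrightarrow> rescale S a r \<theta> \<le> H) \<Longrightarrow>
      norm (x - a) + r / 8 \<le> r \<Longrightarrow> \<bar>S (\<lambda>y. dil (r / 8) ?\<psi> (x - y) *\<^sub>R v)\<bar> \<le> C * H * norm v"
    using zoomed_kernel_estimate[OF p k\<psi>, of 8 i] by (metis zero_less_numeral)
  show ?thesis
  proof (intro exI[of _ "C * \<bar>J\<bar> * 8 powr ?e"] conjI allI ballI impI)
    show "C * \<bar>J\<bar> * 8 powr ?e \<ge> 0" using C by simp
    fix q a x assume a: "a \<in> E" and x: "norm (x - a) \<le> 7 * \<rho> q"
    let ?S = "\<lambda>\<eta>. T \<eta> - fun_distr (P a) \<eta>"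
    have LP: "locally_finite_order (fun_distr (P a))"
      by (rule locally_finite_order_continuous[OF smooth_continuous[OF degree_at_most_smooth[OF P[OF a]]]])
    have S: "linear_on_tests ?S"
      by (rule linear_on_tests_diff[OF locally_finite_order_linear[OF T] locally_finite_order_linear[OF LP]])
    have r: "0 < 8 * \<rho> q" "8 * \<rho> q < r0"
    proof -
      show "0 < 8 * \<rho> q" using rho_pos by simp
      show "8 * \<rho> q < r0" using rho_antimono[of 0 q] r0 by (simp add: \<rho>_def)
    qed
    have b: "\<bar>?S (\<lambda>y. dil (\<rho> q) ?\<psi> (x - y) *\<^sub>R v)\<bar> \<le> C * (J * (8 * \<rho> q) powr ?e) * norm v" for v
      using bound[OF S r(1) est[OF a r], where x=x and v=v] x by simp
    have k\<rho>: "kernel (\<rho> q) (dil (\<rho> q) ?\<psi>)" by (rule kernel_dil[OF k\<psi> rho_pos])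
    have rep: "P a = conv (fun_distr (P a)) (dil (\<rho> q) \<phi>)"
      using conv_polynomial[OF P[OF a] mk rho_pos] by simp
    have "iter_deriv (\<lambda>x. g q x - P a x) vs x = iter_deriv (g q) vs x - iter_deriv (P a) vs x"
      using smooth_iter_deriv_diff[OF smooth_g degree_at_most_smooth[OF P[OF a]]]
      by simp
    also have "iter_deriv (P a) vs x = iter_deriv (conv (fun_distr (P a)) (dil (\<rho> q) \<phi>)) vs x"
      using rep by simp
    also have "iter_deriv (g q) vs x - \<dots> = inverse (\<rho> q) ^ length vs *\<^sub>R
        (conv T (dil (\<rho> q) ?\<psi>) x - conv (fun_distr (P a)) (dil (\<rho> q) ?\<psi>) x)"
      unfolding g_def iter_deriv_conv_dil[OF T ker rho_pos] iter_deriv_conv_dil[OF LP ker rho_pos]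
      by (simp add: scaleR_diff_right)
    finally have eq: "iter_deriv (\<lambda>x. g q x - P a x) vs x = inverse (\<rho> q) ^ length vs *\<^sub>R
        (conv T (dil (\<rho> q) ?\<psi>) x - conv (fun_distr (P a)) (dil (\<rho> q) ?\<psi>) x)" .
    have "norm (conv T (dil (\<rho> q) ?\<psi>) x - conv (fun_distr (P a)) (dil (\<rho> q) ?\<psi>) x)
        \<le> C * (\<bar>J\<bar> * (8 * \<rho> q) powr ?e)"
    proof (rule norm_blinfun_bound)
      show "0 \<le> C * (\<bar>J\<bar> * (8 * \<rho> q) powr ?e)" using C by simp
      fix v
      have "norm ((conv T (dil (\<rho> q) ?\<psi>) x - conv (fun_distr (P a)) (dil (\<rho> q) ?\<psi>) x) v)
          = \<bar>?S (\<lambda>y. dil (\<rho> q) ?\<psi> (x - y) *\<^sub>R v)\<bar>"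
        by (simp add: minus_blinfun.rep_eq conv_apply[OF T k\<rho>] conv_apply[OF LP k\<rho>])
      also have "\<dots> \<le> C * (J * (8 * \<rho> q) powr ?e) * norm v" by (rule b)
      also have "\<dots> \<le> C * (\<bar>J\<bar> * (8 * \<rho> q) powr ?e) * norm v"
        using C by (intro mult_right_mono mult_left_mono) auto
      finally show "norm ((conv T (dil (\<rho> q) ?\<psi>) x - conv (fun_distr (P a)) (dil (\<rho> q) ?\<psi>) x) v)
          \<le> C * (\<bar>J\<bar> * (8 * \<rho> q) powr ?e) * norm v" .
    qed
    then have "norm (iter_deriv (\<lambda>x. g q x - P a x) vs x)
        \<le> inverse (\<rho> q) ^ length vs * (C * (\<bar>J\<bar> * (8 * \<rho> q) powr ?e))"
      unfolding eq using rho_pos[of q] by (simp add: mult_left_mono)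
    also have "\<dots> = C * \<bar>J\<bar> * 8 powr ?e * (\<rho> q powr ?e / \<rho> q ^ length vs)"
      using rho_pos[of q] by (simp add: powr_mult power_inverse divide_inverse mult_ac)
    also have "\<rho> q powr ?e / \<rho> q ^ length vs = \<rho> q powr (?e - real (length vs))"
      using rho_pos[of q] by (simp add: powr_diff powr_realpow)
    finally show "norm (iter_deriv (\<lambda>x. g q x - P a x) vs x)
        \<le> C * \<bar>J\<bar> * 8 powr ?e * \<rho> q powr (?e - real (length vs))" .
  qed
qed

lemma cut_set: "{y. infdist y E \<le> 4 * \<rho> q} \<in> sets borel"
  by (intro borel_closed closed_Collect_le continuous_intros)

lemma smooth_cut_conv:
  "smooth (conv (set_distr {y. infdist y E \<le> 4 * \<rho> q})
      (dil (\<rho> q) \<phi>))"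
  by (rule smooth_conv[OF locally_finite_order_set_distr[OF cut_set] kernel_dil[OF ker rho_pos]])

lemma bounded_linear_apply_one: "bounded_linear (\<lambda>L :: real \<Rightarrow>\<^sub>L real. blinfun_apply L 1)"
  by (rule bounded_bilinear.bounded_linear_left[OF bounded_bilinear_blinfun_apply])

lemma smooth_cut: "smooth (cut q)"
  unfolding cut_def[abs_def] by (rule smooth_bounded_linear[OF bounded_linear_apply_one smooth_cut_conv])

lemma cut_one: "infdist x E < 3 * \<rho> q \<Longrightarrow> cut q x = 1"
  unfolding cut_def
proof (rule cutoff_one[OF cut_set mk rho_pos])
  assume x: "infdist x E < 3 * \<rho> q"
  show "cball x (\<rho> q) \<subseteq> {y. infdist y E \<le> 4 * \<rho> q}"
  proof safe
    fix y assume "y \<in> cball x (\<rho> q)"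
    then show "infdist y E \<le> 4 * \<rho> q" using infdist_triangle[of y E x] x by (simp add: dist_commute)
  qed
qed

lemma cut_zero: "5 * \<rho> q < infdist x E \<Longrightarrow> cut q x = 0"
  unfolding cut_def
proof (rule cutoff_zero[OF cut_set ker rho_pos])
  assume x: "5 * \<rho> q < infdist x E"
  have False if "y \<in> cball x (\<rho> q)" "infdist y E \<le> 4 * \<rho> q" for y
    using infdist_triangle[of x E y] x that by (simp add: dist_commute)
  then show "cball x (\<rho> q) \<inter> {y. infdist y E \<le> 4 * \<rho> q} = {}" by blast
qed

lemma cut_bound: "\<exists>C\<ge>0. \<forall>q x. \<bar>iter_deriv (cut q) vs x\<bar> \<le> C * \<rho> q powr (- real (length vs))"
proof -
  have k\<psi>: "kernel 1 (iter_deriv \<phi> vs)" by (rule kernel_iter_deriv[OF ker])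
  obtain M where "derivs_bounded 0 M (iter_deriv \<phi> vs)" using kernel_bounded[OF k\<psi>] by blast
  from derivs_bounded_norm[OF this] derivs_bounded_nonneg[OF this]
  have M: "\<And>z. \<bar>iter_deriv \<phi> vs z\<bar> \<le> M" and M0: "M \<ge> 0" by auto
  let ?V = "measure lborel (cball 0 1 :: (real^'n) set)"
  show ?thesis
  proof (intro exI[of _ "M * ?V"] conjI allI)
    show "M * ?V \<ge> 0" using M0 by simp
    fix q x
    let ?L = "set_distr {y. infdist y E \<le> 4 * \<rho> q}"
    have "iter_deriv (cut q) vs x = (iter_deriv (conv ?L (dil (\<rho> q) \<phi>)) vs x) 1"
      unfolding cut_def[abs_def]
      using smooth_iter_deriv_bounded_linear[OF bounded_linear_apply_one smooth_cut_conv]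
      by simp
    also have "\<dots> = inverse (\<rho> q) ^ length vs * (conv ?L (dil (\<rho> q) (iter_deriv \<phi> vs)) x) 1"
      by (simp add: iter_deriv_conv_dil[OF locally_finite_order_set_distr[OF cut_set] ker rho_pos] scaleR_blinfun.rep_eq)
    finally have "\<bar>iter_deriv (cut q) vs x\<bar> \<le> inverse (\<rho> q) ^ length vs * (M * ?V)"
      using cutoff_bound[OF cut_set[of q] k\<psi> M rho_pos[of q], of x] rho_pos[of q]
      by (simp add: abs_mult mult_left_mono)
    also have "\<dots> = M * ?V * \<rho> q powr (- real (length vs))"
      using rho_pos[of q] by (simp add: powr_minus powr_realpow power_inverse)
    finally show "\<bar>iter_deriv (cut q) vs x\<bar> \<le> M * ?V * \<rho> q powr (- real (length vs))" .
  qed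
qed

lemma near_point:
  assumes "infdist x E < 6 * \<rho> q"
  obtains a where "a \<in> E" "norm (x - a) < 6 * \<rho> q"
proof -
  have "\<not> (\<forall>a\<in>E. 6 * \<rho> q \<le> dist x a)"
  proof
    assume "\<forall>a\<in>E. 6 * \<rho> q \<le> dist x a"
    then have "6 * \<rho> q \<le> infdist x E" unfolding infdist_def using E by (simp add: cINF_greatest)
    then show False using assms by simp
  qed
  then show thesis using that by (auto simp: not_le dist_norm)
qed

lemma rho_Suc_powr: "\<rho> (Suc q) powr s = (1 / 2) powr s * \<rho> q powr s"
  by (simp add: rho_powr[of "Suc q"] rho_powr[of q] mult_ac)

lemma smooth_h: "smooth (h q)"
  unfolding h_def[abs_def] by (intro smooth_scaleR smooth_diff smooth_g smooth_cut)

lemma smooth_F: "smooth (F Q)"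
  unfolding F_def[abs_def] by (intro smooth_add smooth_sum smooth_g smooth_h)

lemma h_outside:
  assumes "5 * \<rho> (Suc q) < infdist x E"
  shows "iter_deriv (h q) vs x = 0"
proof -
  have op: "open {x. 5 * \<rho> (Suc q) < infdist x E}"
    by (intro open_Collect_less continuous_intros)
  have "iter_deriv (h q) vs x = iter_deriv (\<lambda>x. 0) vs x"
    by (rule iter_deriv_local[OF op smooth_h smooth_const]) (use assms cut_zero in \<open>auto simp: h_def\<close>)
  then show ?thesis by (simp add: iter_deriv_zero)
qed

text \<open>
  On the support of the cutoff both regularizations are close to the same polynomial \<open>P a\<close>
  with \<open>a\<close> a nearby point of \<open>E\<close>, so their difference is small although \<open>P a\<close> depends on the place.
\<close>

lemma h_bound:
  "\<exists>C\<ge>0. \<forall>q x. norm (iter_deriv (h q) vs x) \<le> C * \<rho> q powr (real k + \<alpha> - real (length vs))"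
proof -
  \<comment> \<open>\<open>6 * \<rho> (Suc q)\<close> exceeds the radius \<open>5 * \<rho> (Suc q)\<close> of the cutoff and is below the radius
    \<open>7 * \<rho> (Suc q)\<close> in which \<open>approx\<close> applies, at the scale \<open>\<rho> q\<close> too.\<close>
  let ?U = "\<lambda>q. {x. infdist x E < 6 * \<rho> (Suc q)}" and ?e = "real k + \<alpha>"
  have s1: "scaled \<rho> 0 ?U (\<lambda>q. cut (Suc q))"
    unfolding scaled_def
  proof (intro conjI allI)
    fix vs :: "(real^'n) list"
    obtain C where "\<And>q x. \<bar>iter_deriv (cut q) vs x\<bar> \<le> C * \<rho> q powr (- real (length vs))" using cut_bound by blast
    from this[of "Suc _"] show "\<exists>C. \<forall>q. \<forall>x\<in>?U q. norm (iter_deriv (cut (Suc q)) vs x) \<le> C * \<rho> q powr (0 - real (length vs))"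
      by (intro exI[of _ "C * (1 / 2) powr (- real (length vs))"]) (simp add: rho_Suc_powr mult.assoc)
  qed (rule smooth_cut)
  have s2: "scaled \<rho> ?e ?U (\<lambda>q x. g (Suc q) x - g q x)"
    unfolding scaled_def
  proof (intro conjI allI)
    show "smooth (\<lambda>x. g (Suc q) x - g q x)" for q by (intro smooth_diff smooth_g)
    fix vs :: "(real^'n) list"
    let ?s = "?e - real (length vs)"
    obtain C where C: "\<And>q a x. a \<in> E \<Longrightarrow> norm (x - a) \<le> 7 * \<rho> q \<Longrightarrow>
        norm (iter_deriv (\<lambda>x. g q x - P a x) vs x) \<le> C * \<rho> q powr ?s" using approx by blast
    show "\<exists>C. \<forall>q. \<forall>x\<in>?U q. norm (iter_deriv (\<lambda>x. g (Suc q) x - g q x) vs x) \<le> C * \<rho> q powr ?s"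
    proof (intro exI[of _ "C * (1 / 2) powr ?s + C"] allI ballI)
      fix q x assume "x \<in> ?U q"
      then obtain a where a: "a \<in> E" "norm (x - a) < 6 * \<rho> (Suc q)" using near_point by blast
      have sP: "smooth (P a)" by (rule degree_at_most_smooth[OF P[OF a(1)]])
      have l: "norm (x - a) \<le> 7 * \<rho> (Suc q)" "norm (x - a) \<le> 7 * \<rho> q"
        using a(2) rho_pos[of q] by (simp_all add: rho_Suc)
      have "iter_deriv (\<lambda>x. g (Suc q) x - g q x) vs x
          = iter_deriv (\<lambda>x. g (Suc q) x - P a x) vs x - iter_deriv (\<lambda>x. g q x - P a x) vs x"
        by (simp add: smooth_iter_deriv_diff[OF smooth_g sP]
            smooth_iter_deriv_diff[OF smooth_g smooth_g])
      then have "norm (iter_deriv (\<lambda>x. g (Suc q) x - g q x) vs x) \<le> C * \<rho> (Suc q) powr ?s + C * \<rho> q powr ?s"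
        using norm_triangle_ineq4 C[OF a(1) l(1)] C[OF a(1) l(2)] by (smt (verit))
      then show "norm (iter_deriv (\<lambda>x. g (Suc q) x - g q x) vs x) \<le> (C * (1 / 2) powr ?s + C) * \<rho> q powr ?s"
        by (simp add: rho_Suc_powr algebra_simps)
    qed
  qed
  have "scaled \<rho> (0 + ?e) ?U h"
    using scaled_scaleR[OF rho_pos s1 s2] by (simp add: h_def[abs_def])
  then obtain C where C: "\<And>q x. infdist x E < 6 * \<rho> (Suc q) \<Longrightarrow>
      norm (iter_deriv (h q) vs x) \<le> C * \<rho> q powr (?e - real (length vs))"
    unfolding scaled_def by fastforce
  have "norm (iter_deriv (h q) vs x) \<le> \<bar>C\<bar> * \<rho> q powr (?e - real (length vs))" for q x
  proof (cases "infdist x E < 6 * \<rho> (Suc q)")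
    case True
    then show ?thesis using C[OF True] by (smt (verit) mult_right_mono powr_ge_zero)
  next
    case False
    then have "5 * \<rho> (Suc q) < infdist x E" using rho_pos[of "Suc q"] by simp
    then show ?thesis by (simp add: h_outside)
  qed
  then show ?thesis by (intro exI[of _ "\<bar>C\<bar>"]) simp
qed

lemma F_near:
  assumes "infdist x E < 3 * \<rho> Q"
  shows "iter_deriv (F Q) vs x = iter_deriv (g Q) vs x"
proof (rule iter_deriv_local[OF _ smooth_F smooth_g])
  show "open {x. infdist x E < 3 * \<rho> Q}" by (intro open_Collect_less continuous_intros)
  show "x \<in> {x. infdist x E < 3 * \<rho> Q}" using assms by simp
  fix y assume y: "y \<in> {x. infdist x E < 3 * \<rho> Q}"
  have "h q y = g (Suc q) y - g q y" if "q < Q" for q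
  proof -
    have "infdist y E < 3 * \<rho> (Suc q)" using y rho_antimono[of "Suc q" Q] that by simp
    then show ?thesis by (simp add: h_def cut_one)
  qed
  then have "F Q y = g 0 y + (\<Sum>q<Q. g (Suc q) y - g q y)" by (simp add: F_def)
  then show "F Q y = g Q y" using sum_lessThan_telescope[of "\<lambda>q. g q y" Q] by simp
qed

text \<open>
  Summing the bounds for the terms \<open>h q\<close> would lose a logarithm when \<open>\<alpha> = 1\<close>. Instead, wherever
  \<open>h Q\<close> does not vanish, \<open>F Q\<close> coincides with \<open>g Q\<close>, and a derivative of order \<open>k + 1\<close> of \<open>g Q\<close> is
  one of \<open>g Q - P a\<close>. So the bound never accumulates and holds with one constant by induction on \<open>Q\<close>.
\<close>

lemma top_derivative_bound:
  assumes vs: "length vs = Suc k"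
  shows "\<exists>D\<ge>0. \<forall>Q x. norm x \<le> X \<longrightarrow> norm (iter_deriv (F Q) vs x) \<le> D * \<rho> Q powr (\<alpha> - 1)"
proof -
  have ex: "real k + \<alpha> - real (length vs) = \<alpha> - 1" using vs by simp
  obtain C1 where C1: "\<And>q a x. a \<in> E \<Longrightarrow> norm (x - a) \<le> 7 * \<rho> q \<Longrightarrow>
      norm (iter_deriv (\<lambda>x. g q x - P a x) vs x) \<le> C1 * \<rho> q powr (\<alpha> - 1)"
    using approx[of vs] unfolding ex by blast
  obtain C2 where C2: "\<And>q x. norm (iter_deriv (h q) vs x) \<le> C2 * \<rho> q powr (\<alpha> - 1)"
    using h_bound[of vs] unfolding ex by blast
  obtain B where B: "B \<ge> 0" "\<And>x. norm x \<le> X \<Longrightarrow> norm (iter_deriv (g 0) vs x) \<le> B"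
    using iter_deriv_bounded_on_compact[OF compact_cball smooth_g, of 0 X 0 vs] by auto
  \<comment> \<open>The last summand takes care of \<open>F 0 = g 0\<close>, which is only locally bounded away from \<open>E\<close>.\<close>
  define D where "D = \<bar>C1\<bar> + \<bar>C2\<bar> + B / \<rho> 0 powr (\<alpha> - 1)"
  have D0: "D \<ge> 0" using B(1) by (simp add: D_def)
  have near: "norm (iter_deriv (F Q) vs x) \<le> \<bar>C1\<bar> * \<rho> Q powr (\<alpha> - 1)" if x: "infdist x E < 3 * \<rho> Q" for Q x
  proof -
    have "infdist x E < 6 * \<rho> (Suc Q)" using x by (simp add: rho_Suc)
    then obtain a where a: "a \<in> E" "norm (x - a) < 6 * \<rho> (Suc Q)" using near_point by blast
    have "norm (x - a) \<le> 7 * \<rho> Q" using a(2) rho_pos[of Q] by (simp add: rho_Suc)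
    from C1[OF a(1) this] have "norm (iter_deriv (g Q) vs x - iter_deriv (P a) vs x) \<le> C1 * \<rho> Q powr (\<alpha> - 1)"
      by (simp add: smooth_iter_deriv_diff[OF smooth_g degree_at_most_smooth[OF P[OF a(1)]]])
    moreover have "iter_deriv (P a) vs x = 0" using P[OF a(1)] vs by (simp add: degree_at_most_def)
    moreover have "C1 * \<rho> Q powr (\<alpha> - 1) \<le> \<bar>C1\<bar> * \<rho> Q powr (\<alpha> - 1)" by (intro mult_right_mono) auto
    ultimately show ?thesis using F_near[OF x] by simp
  qed
  have "norm (iter_deriv (F Q) vs x) \<le> D * \<rho> Q powr (\<alpha> - 1)" if x: "norm x \<le> X" for Q x
  proof (induction Q)
    case 0
    have "norm (iter_deriv (F 0) vs x) \<le> B / \<rho> 0 powr (\<alpha> - 1) * \<rho> 0 powr (\<alpha> - 1)"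
      using B(2)[OF x] rho_pos[of 0] by (simp add: F_def[abs_def])
    also have "\<dots> \<le> D * \<rho> 0 powr (\<alpha> - 1)" by (intro mult_right_mono) (auto simp: D_def)
    finally show ?case .
  next
    case (Suc Q)
    have mono: "D * \<rho> Q powr (\<alpha> - 1) \<le> D * \<rho> (Suc Q) powr (\<alpha> - 1)"
      using alpha rho_pos[of "Suc Q"] rho_antimono[of Q "Suc Q"] D0
      by (intro mult_left_mono powr_mono2') auto
    have split: "iter_deriv (F (Suc Q)) vs x = iter_deriv (F Q) vs x + iter_deriv (h Q) vs x"
      using smooth_iter_deriv_add[OF smooth_F smooth_h, of Q Q vs]
      by (simp add: F_def[abs_def] add.assoc)
    show ?case
    proof (cases "infdist x E < 3 * \<rho> Q")
      case True
      have "norm (iter_deriv (F (Suc Q)) vs x) \<le> \<bar>C1\<bar> * \<rho> Q powr (\<alpha> - 1) + C2 * \<rho> Q powr (\<alpha> - 1)"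
        unfolding split using near[OF True] C2[of Q x] norm_triangle_ineq by (smt (verit))
      also have "\<dots> = (\<bar>C1\<bar> + C2) * \<rho> Q powr (\<alpha> - 1)" by (simp add: distrib_right)
      also have "\<dots> \<le> D * \<rho> Q powr (\<alpha> - 1)"
      proof (rule mult_right_mono)
        have "B / \<rho> 0 powr (\<alpha> - 1) \<ge> 0" using B(1) by simp
        then show "\<bar>C1\<bar> + C2 \<le> D" unfolding D_def by linarith
      qed simp
      finally show ?thesis using mono by linarith
    next
      case False
      \<comment> \<open>Here \<open>5 * \<rho> (Suc Q) = (5/2) * \<rho> Q\<close> is below \<open>3 * \<rho> Q\<close>.\<close>
      then have "5 * \<rho> (Suc Q) < infdist x E" using rho_pos[of Q] by (simp add: rho_Suc)
      then show ?thesis using Suc.IH mono split by (simp add: h_outside)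
    qed
  qed
  then show ?thesis using D0 by blast
qed

lemma summable_rho: "s > 0 \<Longrightarrow> summable (\<lambda>q. C * \<rho> q powr s)"
proof -
  assume s: "s > 0"
  have "(1 / 2 :: real) powr s < 1" using s powr_less_mono2[of s "1/2" 1] by simp
  then have "summable (\<lambda>q. (C * \<rho> 0 powr s) * ((1 / 2 :: real) powr s) ^ q)"
    by (intro summable_mult summable_geometric) simp
  then show ?thesis by (subst rho_powr) (simp add: mult.assoc)
qed

lemma extension_derivatives:
  "C_diff k extension"
  "length vs \<le> k \<Longrightarrow> iter_deriv extension vs x = iter_deriv (g 0) vs x + (\<Sum>q. iter_deriv (h q) vs x)"
proof -
  have "\<exists>M. summable M \<and> (\<forall>q x. norm (iter_deriv (h q) vs x) \<le> M q)" if "length vs \<le> k" for vs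
  proof -
    obtain C where C: "\<And>q x. norm (iter_deriv (h q) vs x) \<le> C * \<rho> q powr (real k + \<alpha> - real (length vs))"
      using h_bound by blast
    have "real k + \<alpha> - real (length vs) > 0" using that alpha by simp
    from summable_rho[OF this, of C] C show ?thesis by blast
  qed
  from smooth_series[OF smooth_h this]
  have s: "C_diff k (\<lambda>x. \<Sum>q. h q x)"
    "\<And>vs. length vs \<le> k \<Longrightarrow> iter_deriv (\<lambda>x. \<Sum>q. h q x) vs = (\<lambda>x. \<Sum>q. iter_deriv (h q) vs x)" by auto
  show "C_diff k extension"
    unfolding extension_def[abs_def] by (rule C_diff_add[OF smooth_C_diff[OF smooth_g] s(1)])
  assume vs: "length vs \<le> k"
  show "iter_deriv extension vs x = iter_deriv (g 0) vs x + (\<Sum>q. iter_deriv (h q) vs x)"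
    unfolding extension_def[abs_def]
    by (simp add: iter_deriv_add[OF smooth_C_diff[OF smooth_g] s(1) vs] s(2)[OF vs])
qed

text \<open>
  The exponent is at least \<open>\<alpha> > 0\<close>, so the bounds for \<open>h q\<close> form a geometric series.
\<close>

lemma extension_tail:
  assumes vs: "length vs \<le> k"
  shows "\<exists>C\<ge>0. \<forall>Q x. norm (iter_deriv extension vs x - iter_deriv (F Q) vs x)
    \<le> C * \<rho> Q powr (real k + \<alpha> - real (length vs))"
proof -
  let ?s = "real k + \<alpha> - real (length vs)"
  obtain C where C: "C \<ge> 0" "\<And>q x. norm (iter_deriv (h q) vs x) \<le> C * \<rho> q powr ?s" using h_bound by blast
  have s: "?s > 0" using vs alpha by simp
  define \<sigma> where "\<sigma> = (1 / 2 :: real) powr ?s"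
  have \<sigma>: "0 < \<sigma>" "\<sigma> < 1" using s powr_less_mono2[of ?s "1/2" 1] by (auto simp: \<sigma>_def)
  have su: "summable (\<lambda>q. iter_deriv (h q) vs x)" for x
    by (rule summable_comparison_test'[OF summable_rho[OF s, of C], of 0]) (rule C(2))
  show ?thesis
  proof (intro exI[of _ "C / (1 - \<sigma>)"] conjI allI)
    show "C / (1 - \<sigma>) \<ge> 0" using C(1) \<sigma> by simp
    fix Q x
    have sS: "smooth (\<lambda>x. \<Sum>q<Q. h q x)" by (intro smooth_sum smooth_h)
    have sum: "iter_deriv (\<lambda>x. \<Sum>q<Q. h q x) vs = (\<lambda>x. \<Sum>q<Q. iter_deriv (h q) vs x)"
      by (rule smooth_iter_deriv_sum[OF smooth_h])
    have "iter_deriv (F Q) vs x = iter_deriv (g 0) vs x + (\<Sum>q<Q. iter_deriv (h q) vs x)"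
      unfolding F_def[abs_def]
      by (simp add: smooth_iter_deriv_add[OF smooth_g sS] sum)
    then have "iter_deriv extension vs x - iter_deriv (F Q) vs x = (\<Sum>q. iter_deriv (h (q + Q)) vs x)"
      using suminf_split_initial_segment[OF su[of x], of Q] by (simp add: extension_derivatives(2)[OF vs])
    also have "norm \<dots> \<le> (\<Sum>q. (C * \<rho> Q powr ?s) * \<sigma> ^ q)"
    proof (rule norm_suminf_le)
      show "summable (\<lambda>q. (C * \<rho> Q powr ?s) * \<sigma> ^ q)" using \<sigma> by (intro summable_mult summable_geometric) simp
      fix q
      have "norm (iter_deriv (h (q + Q)) vs x) \<le> C * \<rho> (q + Q) powr ?s" by (rule C(2))
      also have "\<dots> = (C * \<rho> Q powr ?s) * \<sigma> ^ q"
        by (simp add: rho_powr[of "q + Q"] rho_powr[of Q] power_add \<sigma>_def mult_ac)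
      finally show "norm (iter_deriv (h (q + Q)) vs x) \<le> (C * \<rho> Q powr ?s) * \<sigma> ^ q" .
    qed
    also have "\<dots> = (C * \<rho> Q powr ?s) * (1 / (1 - \<sigma>))"
      using \<sigma> by (subst suminf_mult) (auto simp: suminf_geometric intro: summable_geometric)
    finally show "norm (iter_deriv extension vs x - iter_deriv (F Q) vs x) \<le> C / (1 - \<sigma>) * \<rho> Q powr ?s"
      by (simp add: mult_ac)
  qed
qed

lemma extension_agrees:
  assumes a: "a \<in> E" and vs: "length vs \<le> k"
  shows "iter_deriv extension vs a = iter_deriv (P a) vs a"
proof -
  let ?s = "real k + \<alpha> - real (length vs)"
  have s: "?s > 0" using vs alpha by simp
  obtain C1 where C1: "\<And>Q. norm (iter_deriv extension vs a - iter_deriv (F Q) vs a) \<le> C1 * \<rho> Q powr ?s"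
    using extension_tail[OF vs] by blast
  obtain C2 where C2: "\<And>q b x. b \<in> E \<Longrightarrow> norm (x - b) \<le> 7 * \<rho> q \<Longrightarrow>
      norm (iter_deriv (\<lambda>x. g q x - P b x) vs x) \<le> C2 * \<rho> q powr ?s" using approx by blast
  have "norm (iter_deriv extension vs a - iter_deriv (P a) vs a) \<le> (C1 + C2) * \<rho> Q powr ?s" for Q
  proof -
    have "norm (iter_deriv (g Q) vs a - iter_deriv (P a) vs a) \<le> C2 * \<rho> Q powr ?s"
      using C2[OF a, of a Q] rho_pos[of Q]
      by (simp add: smooth_iter_deriv_diff[OF smooth_g degree_at_most_smooth[OF P[OF a]]])
    moreover have "iter_deriv (F Q) vs a = iter_deriv (g Q) vs a"
      using a rho_pos[of Q] by (intro F_near) simp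
    ultimately show ?thesis
      using C1[of Q] norm_triangle_ineq[of "iter_deriv extension vs a - iter_deriv (F Q) vs a"
          "iter_deriv (F Q) vs a - iter_deriv (P a) vs a"]
      by (simp add: distrib_right)
  qed
  then have "norm (iter_deriv extension vs a - iter_deriv (P a) vs a) \<le> 0"
    using rho_tendsto_0[OF s, of "C1 + C2"] by (intro LIMSEQ_le_const) auto
  then show ?thesis by simp
qed

text \<open>
  With \<open>Q\<close> chosen so that \<open>\<rho> Q\<close> is comparable with the distance of \<open>x\<close> and \<open>y\<close>, the tail beyond \<open>Q\<close>
  is bounded by \<open>\<rho> Q powr \<alpha>\<close>, and so is the increment of the derivative of \<open>F Q\<close>, whose Lipschitz
  constant is of order \<open>\<rho> Q powr (\<alpha> - 1)\<close>.
\<close>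

lemma extension_holder:
  assumes vs: "length vs = k"
  shows "\<exists>C\<ge>0. \<forall>x y. norm x \<le> X \<longrightarrow> norm y \<le> X \<longrightarrow> norm (x - y) \<le> \<rho> 0 \<longrightarrow>
    norm (iter_deriv extension vs x - iter_deriv extension vs y) \<le> C * norm (x - y) powr \<alpha>"
proof -
  obtain C1 where C1: "C1 \<ge> 0" "\<And>Q x. norm (iter_deriv extension vs x - iter_deriv (F Q) vs x) \<le> C1 * \<rho> Q powr \<alpha>"
    using extension_tail[of vs] vs by auto
  have "\<forall>b. \<exists>D\<ge>0. \<forall>Q x. norm x \<le> X \<longrightarrow> norm (iter_deriv (F Q) (vs @ [b]) x) \<le> D * \<rho> Q powr (\<alpha> - 1)"
    using top_derivative_bound vs by simp
  then obtain D where D: "\<And>b. D b \<ge> 0"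
    "\<And>b Q x. norm x \<le> X \<Longrightarrow> norm (iter_deriv (F Q) (vs @ [b]) x) \<le> D b * \<rho> Q powr (\<alpha> - 1)" by metis
  define C2 where "C2 = (\<Sum>b\<in>(Basis :: (real^'n) set). D b)"
  have C2: "C2 \<ge> 0" unfolding C2_def by (intro sum_nonneg D)
  show ?thesis
  proof (intro exI[of _ "(2 * C1 + C2) * 2 powr \<alpha>"] conjI allI impI)
    show "(2 * C1 + C2) * 2 powr \<alpha> \<ge> 0" using C1 C2 by simp
    fix x y :: "real^'n" assume x: "norm x \<le> X" and y: "norm y \<le> X" and d: "norm (x - y) \<le> \<rho> 0"
    show "norm (iter_deriv extension vs x - iter_deriv extension vs y) \<le> (2 * C1 + C2) * 2 powr \<alpha> * norm (x - y) powr \<alpha>"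
    proof (cases "x = y")
      case False
      then have pos: "norm (x - y) > 0" by simp
      have "\<exists>n. \<rho> n < norm (x - y)"
        using order_tendstoD(2)[OF rho_tendsto_0[of 1 1] pos] rho_pos
        by (auto simp: eventually_sequentially abs_of_pos)
      then obtain n where n: "\<rho> n < norm (x - y)" "\<And>m. m < n \<Longrightarrow> norm (x - y) \<le> \<rho> m"
        using exists_least_iff[of "\<lambda>n. \<rho> n < norm (x - y)"] by (auto simp: not_less)
      then obtain Q where Q: "n = Suc Q" using d by (cases n) auto
      have le: "norm (x - y) \<le> \<rho> Q" "\<rho> Q \<le> 2 * norm (x - y)" using n Q by (auto simp: rho_Suc)
      have "norm (iter_deriv (F Q) vs x - iter_deriv (F Q) vs y)
          \<le> (\<Sum>b\<in>(Basis :: (real^'n) set). D b * \<rho> Q powr (\<alpha> - 1)) * norm (x - y)"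
      proof (rule smooth_lipschitz[OF smooth_iter_deriv[OF smooth_F] convex_cball[of 0 X]])
        show "norm (ddir b (iter_deriv (F Q) vs) z) \<le> D b * \<rho> Q powr (\<alpha> - 1)" if "z \<in> cball 0 X" for z b
          using D(2)[of z Q b] that by (simp add: iter_deriv_snoc)
      qed (use x y in auto)
      also have "\<dots> = C2 * \<rho> Q powr (\<alpha> - 1) * norm (x - y)" by (simp add: C2_def sum_distrib_right)
      also have "\<dots> \<le> C2 * \<rho> Q powr (\<alpha> - 1) * \<rho> Q" using C2 le by (intro mult_left_mono) auto
      also have "\<dots> = C2 * \<rho> Q powr \<alpha>" using rho_pos[of Q] by (simp add: powr_diff)
      finally have FQ: "norm (iter_deriv (F Q) vs x - iter_deriv (F Q) vs y) \<le> C2 * \<rho> Q powr \<alpha>" .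
      have "norm (iter_deriv extension vs x - iter_deriv extension vs y) \<le> (2 * C1 + C2) * \<rho> Q powr \<alpha>"
        using FQ C1(2)[of x Q] C1(2)[of y Q]
          norm_triangle_ineq[of "iter_deriv extension vs x - iter_deriv (F Q) vs x" "iter_deriv (F Q) vs x - iter_deriv (F Q) vs y"]
          norm_triangle_ineq4[of "iter_deriv extension vs x - iter_deriv (F Q) vs y" "iter_deriv extension vs y - iter_deriv (F Q) vs y"]
        by (simp add: algebra_simps)
      also have "\<dots> \<le> (2 * C1 + C2) * (2 * norm (x - y)) powr \<alpha>"
        using le C1 C2 alpha rho_pos[of Q] by (intro mult_left_mono powr_mono2) auto
      finally show ?thesis by (simp add: powr_mult mult.assoc)
    qed simp
  qed
qed

lemma extension_of_class: "of_class k \<alpha> extension"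
  unfolding of_class_def
proof (intro conjI allI)
  show C: "C_diff k extension" by (rule extension_derivatives(1))
  fix a :: "real^'n"
  have "\<forall>vs. \<exists>C. length vs = k \<longrightarrow> (\<forall>x y. norm x \<le> norm a + \<rho> 0 \<longrightarrow> norm y \<le> norm a + \<rho> 0 \<longrightarrow> norm (x - y) \<le> \<rho> 0 \<longrightarrow>
    norm (iter_deriv extension vs x - iter_deriv extension vs y) \<le> C * norm (x - y) powr \<alpha>)"
    using extension_holder[of _ "norm a + \<rho> 0"] by blast
  then obtain M where M: "\<And>vs x y. length vs = k \<Longrightarrow> norm x \<le> norm a + \<rho> 0 \<Longrightarrow> norm y \<le> norm a + \<rho> 0 \<Longrightarrow>
    norm (x - y) \<le> \<rho> 0 \<Longrightarrow> norm (iter_deriv extension vs x - iter_deriv extension vs y) \<le> M vs * norm (x - y) powr \<alpha>"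
    by metis
  show "\<exists>U M. open U \<and> a \<in> U \<and> (\<forall>x\<in>U. \<forall>y\<in>U.
      mnorm k (\<lambda>vs. higher_deriv k extension x vs - higher_deriv k extension y vs) \<le> M * dist x y powr \<alpha>)"
  proof (intro exI[of _ "ball a (\<rho> 0 / 2)"] exI[of _ "\<Sum>bs\<in>basis_lists k. M bs"] conjI ballI)
    show "a \<in> ball a (\<rho> 0 / 2)" using rho_pos by simp
    fix x y assume xy: "x \<in> ball a (\<rho> 0 / 2)" "y \<in> ball a (\<rho> 0 / 2)"
    have nx: "norm x \<le> norm a + \<rho> 0" "norm y \<le> norm a + \<rho> 0"
      using xy norm_triangle_sub[of x a] norm_triangle_sub[of y a] rho_pos[of 0]
      by (auto simp: dist_norm norm_minus_commute)
    have nd: "norm (x - y) \<le> \<rho> 0"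
      using xy dist_triangle2[of x y a] by (simp add: dist_norm norm_minus_commute)
    have "mnorm k (\<lambda>vs. higher_deriv k extension x vs - higher_deriv k extension y vs)
        \<le> (\<Sum>bs\<in>basis_lists k. norm (higher_deriv k extension x bs - higher_deriv k extension y bs))"
      using higher_deriv_multilinear[OF C] by (intro mnorm_le_sum linear_compose_sub) auto
    also have "\<dots> \<le> (\<Sum>bs\<in>basis_lists k. M bs * norm (x - y) powr \<alpha>)"
      using M[OF _ nx nd] by (intro sum_mono) (simp add: higher_deriv_def basis_lists_def)
    finally show "mnorm k (\<lambda>vs. higher_deriv k extension x vs - higher_deriv k extension y vs)
        \<le> (\<Sum>bs\<in>basis_lists k. M bs) * dist x y powr \<alpha>"
      by (simp add: sum_distrib_right dist_norm)
  qed simp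
qed

end

section \<open>Passage to limits of base points\<close>

lemma test_function_derivs_bounded:
  fixes \<theta> :: "real^'n \<Rightarrow> 'b::real_normed_vector"
  assumes K: "compact K" and \<theta>: "\<theta> \<in> test_functions_on K"
  shows "\<exists>B\<ge>0. \<forall>x. norm (iter_deriv \<theta> vs x) \<le> B"
proof -
  have sm: "smooth \<theta>" and out: "\<And>x. x \<notin> K \<Longrightarrow> \<theta> x = 0" using \<theta> K by (auto simp: test_functions_on_iff)
  obtain B where B: "B \<ge> 0" "\<forall>x\<in>K. norm (iter_deriv \<theta> vs x) \<le> B"
    using iter_deriv_bounded_on_compact[OF K sm] by blast
  have "norm (iter_deriv \<theta> vs x) \<le> B" for x
    using B iter_deriv_outside[OF compact_imp_closed[OF K] sm out] by (cases "x \<in> K") auto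
  then show ?thesis using B(1) by blast
qed

lemma moved_test_function:
  fixes \<theta> :: "real^'n \<Rightarrow> 'b::real_normed_vector"
  assumes \<theta>: "\<theta> \<in> unit_tests" and r: "r > 0" and b: "norm b \<le> X"
  shows "(\<lambda>x. \<theta> (inverse r *\<^sub>R (x - b))) \<in> test_functions_on (cball 0 (X + r))"
    and "iter_deriv (\<lambda>x. \<theta> (inverse r *\<^sub>R (x - b))) vs x
      = inverse r ^ length vs *\<^sub>R iter_deriv \<theta> vs (inverse r *\<^sub>R (x - b))"
proof -
  have sm: "smooth \<theta>" and out: "\<And>x. x \<notin> cball 0 1 \<Longrightarrow> \<theta> x = 0"
    using \<theta> by (auto simp: test_functions_on_iff)
  have eq: "(\<lambda>x. \<theta> (inverse r *\<^sub>R (x - b))) = (\<lambda>x. \<theta> (inverse r *\<^sub>R x + - (inverse r *\<^sub>R b)))"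
    by (simp add: scaleR_diff_right)
  show "iter_deriv (\<lambda>x. \<theta> (inverse r *\<^sub>R (x - b))) vs x
      = inverse r ^ length vs *\<^sub>R iter_deriv \<theta> vs (inverse r *\<^sub>R (x - b))"
    unfolding eq iter_deriv_affine[OF sm] by (simp add: scaleR_diff_right)
  show "(\<lambda>x. \<theta> (inverse r *\<^sub>R (x - b))) \<in> test_functions_on (cball 0 (X + r))"
    unfolding test_functions_on_iff[OF compact_cball]
  proof (intro conjI allI impI)
    show "smooth (\<lambda>x. \<theta> (inverse r *\<^sub>R (x - b)))" unfolding eq by (rule smooth_affine[OF sm])
    fix x :: "real^'n" assume "x \<notin> cball 0 (X + r)"
    then have "r < norm (x - b)" using b norm_triangle_ineq2[of x b] by simp
    then have "1 < inverse r * norm (x - b)" using r by (simp add: field_simps)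
    then have "1 < norm (inverse r *\<^sub>R (x - b))" using r by simp
    then show "\<theta> (inverse r *\<^sub>R (x - b)) = 0" by (intro out) simp
  qed
qed

text \<open>
  The derivatives of a test function are Lipschitz, hence its translates depend
  continuously on the base point in every \<open>C^N\<close> seminorm.
\<close>

lemma rescale_tendsto:
  fixes T :: "(real^'n \<Rightarrow> 'b::real_normed_vector) \<Rightarrow> real"
  assumes T: "locally_finite_order T" and \<theta>: "\<theta> \<in> unit_tests" and r: "r > 0"
    and b: "b \<longlonglongrightarrow> a"
  shows "(\<lambda>l. rescale T (b l) r \<theta>) \<longlonglongrightarrow> rescale T a r \<theta>"
proof -
  let ?m = "\<lambda>c x. \<theta> (inverse r *\<^sub>R (x - c))"
  obtain X0 where "\<And>l. norm (b l) \<le> X0" using b by (meson Bseq_def convergentI convergent_imp_Bseq)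
  then obtain X where X: "\<And>l. norm (b l) \<le> X" "norm a \<le> X"
    by (metis max.coboundedI1 max.cobounded2)
  let ?K = "cball 0 (X + r) :: (real^'n) set"
  have "compact ?K" by (rule compact_cball)
  with T obtain N C where NC: "\<And>\<eta> M. \<eta> \<in> test_functions_on ?K \<Longrightarrow>
      derivs_bounded N M \<eta> \<Longrightarrow> \<bar>T \<eta>\<bar> \<le> C * M"
    unfolding locally_finite_order_def by metis
  obtain B where B0: "\<And>vs. B vs \<ge> 0" and B: "\<And>vs x. norm (iter_deriv \<theta> vs x) \<le> B vs"
    using test_function_derivs_bounded[OF compact_cball \<theta>] by metis
  have sm: "smooth \<theta>" using \<theta> by (simp add: test_functions_on_iff)
  define L where "L = (\<lambda>bs. inverse r ^ length bs * ((\<Sum>c\<in>(Basis :: (real^'n) set). B (bs @ [c])) * inverse r))"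
  have L0: "L bs \<ge> 0" for bs
    unfolding L_def using r B0 by (intro mult_nonneg_nonneg sum_nonneg) auto
  let ?A = "\<Union>m\<le>N. basis_lists m :: (real^'n) list set"
  have "finite ?A" using finite_basis_lists by blast
  then have LA: "L bs \<le> sum L ?A" if "set bs \<subseteq> Basis" "length bs \<le> N" for bs
    using that L0 by (intro member_le_sum) (auto simp: basis_lists_def)
  have diff: "\<bar>T (?m (b l)) - T (?m a)\<bar> \<le> C * (sum L ?A * norm (b l - a))" for l
  proof -
    have t1: "?m (b l) \<in> test_functions_on ?K" "?m a \<in> test_functions_on ?K"
      using moved_test_function(1)[OF \<theta> r] X by auto
    then have t2: "?m (b l) \<in> test_functions" "(\<lambda>x. - 1 *\<^sub>R ?m a x) \<in> test_functions" "?m a \<in> test_functions"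
      using cmul_test_function[OF compact_cball t1(2), of "- 1"] test_functions_on_subset by blast+
    note lin = locally_finite_order_linear[OF T]
    have eq: "T (\<lambda>x. ?m (b l) x - ?m a x) = T (?m (b l)) - T (?m a)"
      using linear_on_tests_add[OF lin t2(1,2)] linear_on_tests_cmul[OF lin t2(3), of "- 1"] by simp
    have s1: "smooth (?m (b l))" "smooth (?m a)" using t1 by (auto simp: test_functions_on_iff)
    have "\<bar>T (\<lambda>x. ?m (b l) x - ?m a x)\<bar> \<le> C * (sum L ?A * norm (b l - a))"
    proof (rule NC)
      show "(\<lambda>x. ?m (b l) x - ?m a x) \<in> test_functions_on ?K"
        using t1 smooth_diff[OF s1] by (auto simp: test_functions_on_iff[OF compact_cball])
      show "derivs_bounded N (sum L ?A * norm (b l - a)) (\<lambda>x. ?m (b l) x - ?m a x)"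
        unfolding derivs_bounded_def
      proof (intro allI impI)
        fix bs :: "(real^'n) list" and x assume bs: "set bs \<subseteq> Basis" "length bs \<le> N"
        have "norm (iter_deriv (\<lambda>x. ?m (b l) x - ?m a x) bs x) = inverse r ^ length bs *
            norm (iter_deriv \<theta> bs (inverse r *\<^sub>R (x - b l)) - iter_deriv \<theta> bs (inverse r *\<^sub>R (x - a)))"
          using r moved_test_function(2)[OF \<theta> r X(1)] moved_test_function(2)[OF \<theta> r X(2)]
          by (simp add: smooth_iter_deriv_diff[OF s1(1) s1(2)]
              flip: scaleR_diff_right)
        also have "norm (iter_deriv \<theta> bs (inverse r *\<^sub>R (x - b l)) - iter_deriv \<theta> bs (inverse r *\<^sub>R (x - a)))
            \<le> (\<Sum>c\<in>(Basis :: (real^'n) set). B (bs @ [c])) * norm (inverse r *\<^sub>R (x - b l) - inverse r *\<^sub>R (x - a))"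
          using B[of "bs @ [_]"]
          by (intro smooth_lipschitz[OF smooth_iter_deriv[OF sm] convex_UNIV]) (auto simp: iter_deriv_snoc)
        also have "norm (inverse r *\<^sub>R (x - b l) - inverse r *\<^sub>R (x - a)) = inverse r * norm (b l - a)"
          using r by (simp add: norm_minus_commute flip: scaleR_diff_right)
        finally have "norm (iter_deriv (\<lambda>x. ?m (b l) x - ?m a x) bs x) \<le> L bs * norm (b l - a)"
          using r by (simp add: L_def mult_ac)
        also have "\<dots> \<le> sum L ?A * norm (b l - a)" by (intro mult_right_mono LA bs) auto
        finally show "norm (iter_deriv (\<lambda>x. ?m (b l) x - ?m a x) bs x) \<le> sum L ?A * norm (b l - a)" .
      qed
    qed
    then show ?thesis by (simp only: eq)
  qed
  have "(\<lambda>l. C * (sum L ?A * norm (b l - a))) \<longlonglongrightarrow> 0"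
    by (intro tendsto_mult_right_zero tendsto_norm_zero LIM_zero b)
  then have "(\<lambda>l. T (?m (b l)) - T (?m a)) \<longlonglongrightarrow> 0"
    by (rule Lim_null_comparison[rotated]) (use diff in auto)
  then have "(\<lambda>l. T (?m (b l))) \<longlonglongrightarrow> T (?m a)" by (rule LIM_zero_cancel)
  then show ?thesis unfolding rescale_def by (intro tendsto_mult_left)
qed

text \<open>
  Moving the base point into the polynomial leaves one fixed test function, so that in a limit of base
  points only the density varies.
\<close>

lemma rescale_fun_distr_shift:
  fixes P :: "real^'n \<Rightarrow> ('b::real_normed_vector \<Rightarrow>\<^sub>L real)"
  assumes P: "continuous_on UNIV P" and \<theta>: "smooth \<theta>"
  shows "rescale (fun_distr P) a r \<theta> = rescale (fun_distr (\<lambda>y. P (a + y))) 0 r \<theta>"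
proof -
  have "continuous_on UNIV (\<lambda>x. P x (\<theta> (inverse r *\<^sub>R (x - a))))"
    by (intro bounded_bilinear.continuous_on[OF bounded_bilinear_blinfun_apply P]
        continuous_on_compose2[OF smooth_continuous[OF \<theta>, of UNIV]] continuous_intros) auto
  from lborel_integral_affine[OF borel_measurable_continuous_onI[OF this], of 1 a]
  show ?thesis by (simp add: rescale_def fun_distr_def)
qed

lemma fun_distr_tendsto:
  fixes P :: "nat \<Rightarrow> real^'n \<Rightarrow> ('b::real_normed_vector \<Rightarrow>\<^sub>L real)"
  assumes P: "\<And>l. continuous_on UNIV (P l)" and Q: "continuous_on UNIV Q" and lim: "\<And>x. (\<lambda>l. P l x) \<longlonglongrightarrow> Q x"
    and K: "compact K" and B: "\<And>l x. x \<in> K \<Longrightarrow> norm (P l x) \<le> B" and \<eta>: "\<eta> \<in> test_functions_on K"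
  shows "(\<lambda>l. fun_distr (P l) \<eta>) \<longlonglongrightarrow> fun_distr Q \<eta>"
proof -
  have sm: "smooth \<eta>" and out: "\<And>x. x \<notin> K \<Longrightarrow> \<eta> x = 0" using \<eta> K by (auto simp: test_functions_on_iff)
  obtain M where M: "\<And>x. norm (\<eta> x) \<le> M"
    using test_function_derivs_bounded[OF K \<eta>, of "[]"] by auto
  have meas: "(\<lambda>x. R x (\<eta> x)) \<in> borel_measurable borel" if "continuous_on UNIV R" for R :: "real^'n \<Rightarrow> ('b \<Rightarrow>\<^sub>L real)"
    using that smooth_continuous[OF sm]
    by (intro borel_measurable_continuous_onI bounded_bilinear.continuous_on[OF bounded_bilinear_blinfun_apply])
  show ?thesis
    unfolding fun_distr_def
  proof (rule integral_dominated_convergence[where w="\<lambda>x. B * M * indicator K x"])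
    show "(\<lambda>x. Q x (\<eta> x)) \<in> borel_measurable lborel" using meas[OF Q] by simp
    show "(\<lambda>x. P l x (\<eta> x)) \<in> borel_measurable lborel" for l using meas[OF P] by simp
    show "integrable lborel (\<lambda>x. B * M * indicator K x)"
      using emeasure_bounded_finite[OF compact_imp_bounded[OF K]] K
      by (intro integrable_mult_right integrable_real_indicator) (auto simp: borel_compact)
    show "AE x in lborel. (\<lambda>l. P l x (\<eta> x)) \<longlonglongrightarrow> Q x (\<eta> x)"
      using bounded_bilinear.tendsto[OF bounded_bilinear_blinfun_apply lim tendsto_const] by simp
    show "AE x in lborel. norm (P l x (\<eta> x)) \<le> B * M * indicator K x" for l
    proof (rule AE_I2)
      fix x
      show "norm (P l x (\<eta> x)) \<le> B * M * indicator K x"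
      proof (cases "x \<in> K")
        case True
        have "norm (P l x (\<eta> x)) \<le> norm (P l x) * norm (\<eta> x)" by (rule norm_blinfun)
        also have "\<dots> \<le> B * M"
          using B[OF True] M by (intro mult_mono) (auto intro: order_trans[OF norm_ge_zero])
        finally show ?thesis using True by simp
      qed (simp add: out)
    qed
  qed
qed

lemma rescale_diff: "rescale (\<lambda>\<eta>. T \<eta> - S \<eta>) a r \<theta> = rescale T a r \<theta> - rescale S a r \<theta>"
  by (simp add: rescale_def right_diff_distrib)

text \<open>
  The Taylor polynomial of \<open>f\<close> at \<open>a\<close> as a function of the displacement \<open>y\<close> from \<open>a\<close>.
\<close>

definition taylor_part :: "nat \<Rightarrow> (real^'n \<Rightarrow> 'c::real_normed_vector) \<Rightarrow> real^'n \<Rightarrow> real^'n \<Rightarrow> 'c" where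
  "taylor_part k f a y = (\<Sum>m\<le>k. (1 / fact m) *\<^sub>R iter_deriv f (replicate m y) a)"

lemma degree_at_most_taylor_part:
  assumes "C_diff k f"
  shows "degree_at_most k (taylor_part k f a)"
proof -
  have "degree_at_most k (\<lambda>y. (1 / fact m) *\<^sub>R iter_deriv f (replicate m y) a)" if m: "m \<le> k" for m
  proof (rule degree_at_most_bounded_linear[OF bounded_linear_scaleR_right])
    have "degree_at_most m (\<lambda>y. iter_deriv f (replicate m y) a)"
      by (rule degree_at_most_multilinear_diagonal)
        (auto intro!: iter_deriv_multilinear[OF C_diff_mono[OF assms m]])
    then show "degree_at_most k (\<lambda>y. iter_deriv f (replicate m y) a)" by (rule degree_at_most_mono[OF _ m])
  qed
  then show ?thesis unfolding taylor_part_def[abs_def] by (intro degree_at_most_sum) simp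
qed

lemma continuous_taylor_part:
  assumes "C_diff k f"
  shows "continuous_on UNIV (\<lambda>z. taylor_part k f (fst z) (snd z))"
proof -
  have "continuous_on UNIV (\<lambda>z. iter_deriv f (replicate m (snd z)) (fst z))" if m: "m \<le> k" for m
  proof -
    have c: "continuous_on UNIV (iter_deriv f bs)" if "bs \<in> basis_lists m" for bs
      using C_diff_imp_continuous[OF C_diff_iter_deriv[of 0 bs f]] C_diff_mono[OF assms m] that
      by (simp add: basis_lists_def)
    then have "continuous_on UNIV (\<lambda>z. \<Sum>bs\<in>basis_lists m. (\<Prod>i<m. snd z \<bullet> bs ! i) *\<^sub>R iter_deriv f bs (fst z))"
      by (intro continuous_intros) (auto intro!: continuous_on_compose2[OF c continuous_on_fst[OF continuous_on_id]])
    then show ?thesis by (simp add: iter_deriv_diagonal[OF C_diff_mono[OF assms m]])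
  qed
  then show ?thesis unfolding taylor_part_def by (intro continuous_intros) auto
qed

section \<open>Sets of uniform approximability\<close>

definition approximates :: "nat \<Rightarrow> real \<Rightarrow> nat \<Rightarrow> real \<Rightarrow> ((real^'n \<Rightarrow> 'b::real_normed_vector) \<Rightarrow> real)
    \<Rightarrow> real \<Rightarrow> real \<Rightarrow> real^'n \<Rightarrow> (real^'n \<Rightarrow> ('b \<Rightarrow>\<^sub>L real)) \<Rightarrow> bool" where
  "approximates i p k \<alpha> T J r0 a P \<longleftrightarrow> poly_fun k P \<and>
    (\<forall>r \<theta>. 0 < r \<longrightarrow> r < r0 \<longrightarrow> \<theta> \<in> unit_tests \<longrightarrow> \<nu> i p \<theta> \<le> 1 \<longrightarrow>
      rescale (\<lambda>\<eta>. T \<eta> - fun_distr P \<eta>) a r \<theta> \<le> J * r powr (real k + \<alpha>))"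

text \<open>
  Every test function becomes admissible after multiplication by a small constant of either sign. The
  factor \<open>r powr \<alpha>\<close> left over then forces the limit 0.
\<close>

lemma approximates_pt_approx:
  fixes T :: "(real^'n \<Rightarrow> 'b::real_normed_vector) \<Rightarrow> real"
  assumes ap: "approximates i p k \<alpha> T J r0 a P" and p: "1 \<le> p" and \<alpha>: "0 < \<alpha>" and r0: "0 < r0"
    and T: "locally_finite_order T"
  shows "pt_approx k T a P"
  unfolding pt_approx_def
proof (intro conjI ballI)
  show pf: "poly_fun k P" using ap by (simp add: approximates_def)
  fix \<theta> :: "real^'n \<Rightarrow> 'b" assume \<theta>: "\<theta> \<in> unit_tests"
  let ?S = "\<lambda>\<eta>. T \<eta> - fun_distr P \<eta>"
  have S: "linear_on_tests ?S"
    by (intro linear_on_tests_diff locally_finite_order_linear T locally_finite_order_continuous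
        smooth_continuous degree_at_most_smooth[OF poly_fun_degree_at_most[OF pf]])
  obtain \<delta> where \<delta>: "\<delta> > 0" and nu: "\<And>\<theta> :: real^'n \<Rightarrow> 'b. \<theta> \<in> unit_tests \<Longrightarrow>
      (\<And>bs x. bs \<in> basis_lists i \<Longrightarrow> norm (iter_deriv \<theta> bs x) \<le> \<delta>) \<Longrightarrow> \<nu> i p \<theta> \<le> 1"
    using nu_le_one[OF p] by metis
  have sm: "smooth \<theta>" using \<theta> by (simp add: test_functions_on_iff)
  obtain B where B0: "\<And>vs. B vs \<ge> 0" and B: "\<And>vs x. norm (iter_deriv \<theta> vs x) \<le> B vs"
    using test_function_derivs_bounded[OF compact_cball \<theta>] by metis
  define M where "M = sum B (basis_lists i) + 1"
  have M: "M > 0" using sum_nonneg[of "basis_lists i" B] B0 by (simp add: M_def add_nonneg_pos)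
  have BM: "norm (iter_deriv \<theta> bs x) \<le> M" if "bs \<in> basis_lists i" for bs x
    using B[of bs x] member_le_sum[where f=B, OF that _ finite_basis_lists] B0 by (simp add: M_def)
  define t where "t = \<delta> / M"
  have t: "t > 0" using \<delta> M by (simp add: t_def)
  have nu1: "\<nu> i p (\<lambda>x. s *\<^sub>R \<theta> x) \<le> 1" if s: "\<bar>s\<bar> = t" for s
  proof (rule nu[OF cmul_test_function[OF compact_cball \<theta>]])
    fix bs x assume bs: "bs \<in> (basis_lists i :: (real^'n) list set)"
    have "norm (iter_deriv (\<lambda>x. s *\<^sub>R \<theta> x) bs x) = t * norm (iter_deriv \<theta> bs x)"
      using s by (simp add: smooth_iter_deriv_cmul[OF sm])
    also have "\<dots> \<le> t * M" using BM[OF bs] t by (intro mult_left_mono) auto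
    also have "\<dots> = \<delta>" using M by (simp add: t_def)
    finally show "norm (iter_deriv (\<lambda>x. s *\<^sub>R \<theta> x) bs x) \<le> \<delta>" .
  qed
  have bound: "\<bar>r powr (- real k) * rescale ?S a r \<theta>\<bar> \<le> J / t * r powr \<alpha>" if r: "0 < r" "r < r0" for r
  proof -
    have "(\<lambda>x. \<theta> (inverse r *\<^sub>R (x - a))) \<in> test_functions"
      using moved_test_function(1)[OF \<theta> r(1) order_refl] test_functions_on_subset by blast
    then have sc: "rescale ?S a r (\<lambda>x. s *\<^sub>R \<theta> x) = s * rescale ?S a r \<theta>" for s
      using linear_on_tests_cmul[OF S, of "\<lambda>x. \<theta> (inverse r *\<^sub>R (x - a))" s] by (simp add: rescale_def)
    have le: "rescale ?S a r (\<lambda>x. s *\<^sub>R \<theta> x) \<le> J * r powr (real k + \<alpha>)" if "\<bar>s\<bar> = t" for s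
      using ap r nu1[OF that] cmul_test_function[OF compact_cball \<theta>, of s] by (simp add: approximates_def)
    have "t * \<bar>rescale ?S a r \<theta>\<bar> \<le> J * r powr (real k + \<alpha>)"
      using le[of t] le[of "- t"] t unfolding sc by (auto simp: abs_if)
    then have "\<bar>rescale ?S a r \<theta>\<bar> \<le> J / t * r powr (real k + \<alpha>)" using t by (simp add: field_simps)
    then have "r powr (- real k) * \<bar>rescale ?S a r \<theta>\<bar> \<le> r powr (- real k) * (J / t * r powr (real k + \<alpha>))"
      by (rule mult_left_mono) simp
    also have "\<dots> = J / t * (r powr (- real k) * r powr (real k + \<alpha>))" by simp
    also have "r powr (- real k) * r powr (real k + \<alpha>) = r powr \<alpha>" by (simp flip: powr_add)
    finally show ?thesis by (simp add: abs_mult)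
  qed
  have "((\<lambda>r. r powr \<alpha>) \<longlongrightarrow> 0) (at_right 0)"
    by (rule tendsto_zero_powrI[OF tendsto_ident_at tendsto_const _ \<alpha>])
      (simp add: eventually_at_filter)
  from tendsto_mult_left[OF this, of "J / t"]
  have lim: "((\<lambda>r. J / t * r powr \<alpha>) \<longlongrightarrow> 0) (at_right 0)" by simp
  show "((\<lambda>r. r powr (- real k) * rescale ?S a r \<theta>) \<longlongrightarrow> 0) (at_right 0)"
  proof (rule Lim_null_comparison[OF _ lim])
    show "\<forall>\<^sub>F r in at_right 0. norm (r powr (- real k) * rescale ?S a r \<theta>) \<le> J / t * r powr \<alpha>"
      unfolding eventually_at_right_field using bound r0 by auto
  qed
qed

text \<open>
  Both polynomials are reproduced by the moment kernel. Hence a derivative of \<open>P - Q\<close> of order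
  \<open>m \<le> k\<close> at \<open>a\<close> is \<open>r^(-m)\<close> times the value of the rescaled difference on one fixed test function. That value is
  \<open>o(r^k)\<close> by hypothesis, so all these derivatives agree, and Taylor's formula gives \<open>P = Q\<close>.
\<close>

lemma pt_approx_unique:
  fixes P Q :: "real^'n \<Rightarrow> ('b::real_normed_vector \<Rightarrow>\<^sub>L real)"
  assumes "pt_approx k T a P" and "pt_approx k T a Q"
  shows "P = Q"
proof -
  have dP: "degree_at_most k P" and dQ: "degree_at_most k Q"
    using assms poly_fun_degree_at_most by (auto simp: pt_approx_def)
  note sP = degree_at_most_smooth[OF dP] and sQ = degree_at_most_smooth[OF dQ]
  have LP: "locally_finite_order (fun_distr P)" and LQ: "locally_finite_order (fun_distr Q)"
    by (auto intro!: locally_finite_order_continuous smooth_continuous sP sQ)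
  obtain \<phi> :: "real^'n \<Rightarrow> real" where mk: "moment_kernel k \<phi>"
    using exists_moment_kernel by blast
  note ker = moment_kernel_kernel[OF mk]
  let ?S = "\<lambda>\<eta>. fun_distr P \<eta> - fun_distr Q \<eta>"
  have S: "linear_on_tests ?S"
    by (rule linear_on_tests_diff[OF locally_finite_order_linear[OF LP] locally_finite_order_linear[OF LQ]])
  have eq: "iter_deriv P vs a v = iter_deriv Q vs a v" if vs: "length vs \<le> k" for vs v
  proof -
    let ?\<psi> = "iter_deriv \<phi> vs"
    let ?\<theta> = "\<lambda>z. ?\<psi> ((1 / 1) *\<^sub>R (0 :: real^'n) - 1 *\<^sub>R z) *\<^sub>R v"
    have k\<psi>: "kernel 1 ?\<psi>" by (rule kernel_iter_deriv[OF ker])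
    have \<theta>: "?\<theta> \<in> unit_tests"
      using zoomed_kernel_test(1)[OF k\<psi>, of 1 1 0 0 v] by simp
    have formula: "(iter_deriv P vs a - iter_deriv Q vs a) v = inverse r ^ length vs * rescale ?S a r ?\<theta>"
      if r: "r > 0" for r
    proof -
      have "P = conv (fun_distr P) (dil r \<phi>)" "Q = conv (fun_distr Q) (dil r \<phi>)"
        using conv_polynomial[OF dP mk r] conv_polynomial[OF dQ mk r] by simp_all
      then have "iter_deriv P vs a = inverse r ^ length vs *\<^sub>R conv (fun_distr P) (dil r ?\<psi>) a"
        "iter_deriv Q vs a = inverse r ^ length vs *\<^sub>R conv (fun_distr Q) (dil r ?\<psi>) a"
        using iter_deriv_conv_dil[OF LP ker r, of vs a] iter_deriv_conv_dil[OF LQ ker r, of vs a] by simp_all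
      then have "(iter_deriv P vs a - iter_deriv Q vs a) v
          = inverse r ^ length vs * ?S (\<lambda>y. dil r ?\<psi> (a - y) *\<^sub>R v)"
        by (simp add: conv_apply[OF LP kernel_dil[OF k\<psi> r]] conv_apply[OF LQ kernel_dil[OF k\<psi> r]]
            minus_blinfun.rep_eq scaleR_blinfun.rep_eq right_diff_distrib)
      then show ?thesis using rescale_zoom[OF S k\<psi> r, of 1 a a v] by simp
    qed
    have "((\<lambda>r. r powr (- real k) * rescale (\<lambda>\<eta>. T \<eta> - fun_distr Q \<eta>) a r ?\<theta>
        - r powr (- real k) * rescale (\<lambda>\<eta>. T \<eta> - fun_distr P \<eta>) a r ?\<theta>) \<longlongrightarrow> 0 - 0) (at_right 0)"
      using assms \<theta> unfolding pt_approx_def by (intro tendsto_diff) blast+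
    then have l1: "((\<lambda>r. r powr (- real k) * rescale ?S a r ?\<theta>) \<longlongrightarrow> 0) (at_right 0)"
      by (simp add: rescale_diff right_diff_distrib)
    have l2: "((\<lambda>r :: real. r ^ (k - length vs)) \<longlongrightarrow> 0 ^ (k - length vs)) (at_right 0)"
      by (intro tendsto_intros)
    have "((\<lambda>r :: real. (iter_deriv P vs a - iter_deriv Q vs a) v) \<longlongrightarrow> 0) (at_right 0)"
    proof (rule Lim_transform_eventually)
      show "((\<lambda>r. r ^ (k - length vs) * (r powr (- real k) * rescale ?S a r ?\<theta>)) \<longlongrightarrow> 0) (at_right 0)"
        using tendsto_mult[OF l2 l1] by simp
      show "\<forall>\<^sub>F r in at_right 0. r ^ (k - length vs) * (r powr (- real k) * rescale ?S a r ?\<theta>)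
          = (iter_deriv P vs a - iter_deriv Q vs a) v"
        unfolding eventually_at_right_field
      proof (intro exI[of _ 1] conjI allI impI)
        fix r :: real assume r: "0 < r"
        have "r ^ (k - length vs) * r powr (- real k) = inverse r ^ length vs"
          using r vs by (simp add: powr_minus powr_realpow power_diff power_inverse field_simps)
        then show "r ^ (k - length vs) * (r powr (- real k) * rescale ?S a r ?\<theta>)
            = (iter_deriv P vs a - iter_deriv Q vs a) v"
          unfolding formula[OF r] mult.assoc[symmetric] by simp
      qed simp
    qed
    then have "(iter_deriv P vs a - iter_deriv Q vs a) v = 0"
      by (simp add: tendsto_const_iff)
    then show ?thesis by (simp add: minus_blinfun.rep_eq)
  qed
  have "P y = Q y" for y
  proof -
    have "(\<Sum>m\<le>k. (1 / fact m) *\<^sub>R iter_deriv P (replicate m (y - a)) a)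
        = (\<Sum>m\<le>k. (1 / fact m) *\<^sub>R iter_deriv Q (replicate m (y - a)) a)"
      by (intro sum.cong refl arg_cong[where f="scaleR _"] blinfun_eqI eq) simp
    then show ?thesis
      using taylor_degree_at_most[OF dP, of a "y - a"] taylor_degree_at_most[OF dQ, of a "y - a"] by simp
  qed
  then show ?thesis by (rule ext)
qed

text \<open>
  The function constructed above serves twice. It has the prescribed derivatives on \<open>E\<close>, so the
  polynomials attached to points of \<open>E\<close> are its Taylor polynomials and vary continuously with the point;
  at a limit point \<open>a\<close> of \<open>E\<close> its Taylor polynomial inherits the estimate, which puts \<open>a\<close> into \<open>E\<close>.
\<close>

lemma uniform_approximation_set:
  fixes T :: "(real^'n \<Rightarrow> 'b::banach) \<Rightarrow> real" and i k :: nat and \<alpha> p J r0 R :: real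
  assumes \<alpha>: "0 < \<alpha>" "\<alpha> \<le> 1" and p: "1 \<le> p" and T: "locally_finite_order T" and r0: "0 < r0"
  defines "E \<equiv> {a. norm a \<le> R \<and> (\<exists>P. approximates i p k \<alpha> T J r0 a P)}"
  shows "compact E \<and> (\<exists>f. of_class k \<alpha> f \<and> (\<forall>a\<in>E. \<forall>m\<le>k. pt_deriv k T m a = higher_deriv m f a))"
proof (cases "E = {}")
  case True
  have "of_class k \<alpha> (\<lambda>x :: real^'n. 0 :: 'b \<Rightarrow>\<^sub>L real)"
    unfolding of_class_def
  proof (intro conjI allI)
    show "C_diff k (\<lambda>x :: real^'n. 0 :: 'b \<Rightarrow>\<^sub>L real)" by (rule C_diff_const)
    have zero: "higher_deriv k (\<lambda>x :: real^'n. 0 :: 'b \<Rightarrow>\<^sub>L real) = (\<lambda>x vs. 0)"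
      by (intro ext) (simp add: higher_deriv_def iter_deriv_zero)
    have "mnorm k (\<lambda>vs :: (real^'n) list. 0 :: 'b \<Rightarrow>\<^sub>L real) \<le> 0"
      using mnorm_le_sum[of k "\<lambda>vs :: (real^'n) list. 0 :: 'b \<Rightarrow>\<^sub>L real"] by (simp add: linear_zero)
    then show "\<exists>U M. open U \<and> a \<in> U \<and> (\<forall>x\<in>U. \<forall>y\<in>U.
        mnorm k (\<lambda>vs. higher_deriv k (\<lambda>x. 0 :: 'b \<Rightarrow>\<^sub>L real) x vs - higher_deriv k (\<lambda>x. 0) y vs) \<le> M * dist x y powr \<alpha>)"
      for a :: "real^'n"
      by (intro exI[of _ UNIV] exI[of _ 0]) (simp add: zero)
  qed
  then show ?thesis using True by auto
next
  case False
  have "\<forall>a\<in>E. \<exists>P. approximates i p k \<alpha> T J r0 a P" by (simp add: E_def)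
  from bchoice[OF this] obtain P where ap: "\<And>a. a \<in> E \<Longrightarrow> approximates i p k \<alpha> T J r0 a (P a)" by blast
  have dP: "degree_at_most k (P a)" if "a \<in> E" for a
    using ap[OF that] poly_fun_degree_at_most by (auto simp: approximates_def)
  obtain \<phi> :: "real^'n \<Rightarrow> real" where mk: "moment_kernel k \<phi>"
    using exists_moment_kernel by blast
  interpret uniform_approximation T i k \<alpha> p J r0 E P \<phi>
    by unfold_locales (use \<alpha> p T r0 False dP ap mk in \<open>auto simp: approximates_def\<close>)
  note C = extension_derivatives(1)
  have Ptay: "P a (a + y) = taylor_part k extension a y" if "a \<in> E" for a y
    unfolding taylor_degree_at_most[OF dP[OF that]] taylor_part_def
    using extension_agrees[OF that] by simp
  have "closed E"
    unfolding closed_sequential_limits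
  proof (intro allI impI; elim conjE)
    fix b a assume b: "\<forall>l. b l \<in> E" and lim: "b \<longlonglongrightarrow> a"
    define Q where "Q = (\<lambda>y. taylor_part k extension a (y - a))"
    have dQ: "degree_at_most k Q"
      unfolding Q_def by (rule degree_at_most_translate[OF degree_at_most_taylor_part[OF C]])
    have "rescale (\<lambda>\<eta>. T \<eta> - fun_distr Q \<eta>) a r \<theta> \<le> J * r powr (real k + \<alpha>)"
      if r: "0 < r" "r < r0" and \<theta>: "\<theta> \<in> unit_tests" and nu: "\<nu> i p \<theta> \<le> 1" for r \<theta>
    proof -
      have sm: "smooth \<theta>" using \<theta> by (simp add: test_functions_on_iff)
      let ?P = "\<lambda>l. taylor_part k extension (b l)" and ?Q = "taylor_part k extension a"
      let ?\<eta> = "\<lambda>x. \<theta> (inverse r *\<^sub>R (x - 0))"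
      have "?\<eta> \<in> test_functions_on (cball 0 (0 + r))" by (rule moved_test_function(1)[OF \<theta> r(1)]) simp
      then have \<eta>: "?\<eta> \<in> test_functions_on (cball 0 r)" by simp
      have "compact ((\<lambda>z. taylor_part k extension (fst z) (snd z)) ` (insert a (range b) \<times> cball 0 r))"
        by (intro compact_continuous_image continuous_on_subset[OF continuous_taylor_part[OF C]]
            compact_Times compact_sequence_with_limit lim compact_cball) auto
      then obtain B where B: "\<And>z. z \<in> insert a (range b) \<times> cball 0 r \<Longrightarrow> norm (taylor_part k extension (fst z) (snd z)) \<le> B"
        using compact_imp_bounded bounded_iff by (metis (no_types, lifting) imageI)
      have "(\<lambda>l. fun_distr (?P l) ?\<eta>) \<longlonglongrightarrow> fun_distr ?Q ?\<eta>"
      proof (rule fun_distr_tendsto[OF _ _ _ compact_cball _ \<eta>])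
        show "continuous_on UNIV (?P l)" "continuous_on UNIV ?Q" for l
          by (auto intro!: smooth_continuous degree_at_most_smooth degree_at_most_taylor_part C)
        show "(\<lambda>l. ?P l x) \<longlonglongrightarrow> ?Q x" for x
        proof -
          have "(\<lambda>l. (b l, x)) \<longlonglongrightarrow> (a, x)" by (intro tendsto_intros lim)
          from continuous_on_tendsto_compose[OF continuous_taylor_part[OF C] this] show ?thesis by simp
        qed
        show "norm (?P l x) \<le> B" if "x \<in> cball 0 r" for l x using B[of "(b l, x)"] that by simp
      qed
      then have "(\<lambda>l. rescale (fun_distr (?P l)) 0 r \<theta>) \<longlonglongrightarrow> rescale (fun_distr ?Q) 0 r \<theta>"
        unfolding rescale_def by (intro tendsto_mult_left)
      moreover have "rescale (fun_distr (P (b l))) (b l) r \<theta> = rescale (fun_distr (?P l)) 0 r \<theta>" for l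
        using rescale_fun_distr_shift[OF smooth_continuous[OF degree_at_most_smooth[OF dP]] sm, of "b l" "b l" r] b Ptay
        by simp
      moreover have "rescale (fun_distr Q) a r \<theta> = rescale (fun_distr ?Q) 0 r \<theta>"
        using rescale_fun_distr_shift[OF smooth_continuous[OF degree_at_most_smooth[OF dQ]] sm, of a r]
        by (simp add: Q_def)
      ultimately have "(\<lambda>l. rescale (fun_distr (P (b l))) (b l) r \<theta>) \<longlonglongrightarrow> rescale (fun_distr Q) a r \<theta>" by simp
      from tendsto_diff[OF rescale_tendsto[OF T \<theta> r(1) lim] this]
      show ?thesis
        unfolding rescale_diff[symmetric]
        by (rule LIMSEQ_le_const2) (use est[OF _ r \<theta> nu] b in auto)
    qed
    then have "approximates i p k \<alpha> T J r0 a Q"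
      using degree_at_most_poly_fun[OF dQ] by (simp add: approximates_def)
    moreover have "norm a \<le> R"
      by (rule LIMSEQ_le_const2[OF tendsto_norm[OF lim]]) (use b in \<open>auto simp: E_def\<close>)
    ultimately show "a \<in> E" by (auto simp: E_def)
  qed
  moreover have "bounded E" unfolding bounded_iff E_def by auto
  ultimately have "compact E" by (simp add: compact_eq_bounded_closed)
  moreover have "pt_deriv k T m a = higher_deriv m extension a" if a: "a \<in> E" and m: "m \<le> k" for a m
  proof -
    have "pt_approx k T a (P a)" by (rule approximates_pt_approx[OF ap[OF a] p \<alpha>(1) r0 T])
    then have "(THE P. pt_approx k T a P) = P a" using pt_approx_unique by blast
    then show ?thesis
      unfolding pt_deriv_def higher_deriv_def using extension_agrees[OF a] m by auto
  qed
  ultimately show ?thesis using extension_of_class by blast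
qed

text \<open>
  A finite upper limit means a uniform bound for small radii; bound, radius and
  \<open>norm a\<close> are absorbed into one natural number.
\<close>

lemma nu_pt_differentiable_iff:
  "nu_pt_differentiable i p k \<alpha> T a \<longleftrightarrow>
    (\<exists>j. norm a \<le> real j \<and> (\<exists>P. approximates i p k \<alpha> T (real j) (1 / real (Suc j)) a P))"
proof
  let ?X = "\<lambda>P r. SUP \<theta>\<in>{\<theta> \<in> unit_tests. \<nu> i p \<theta> \<le> 1}.
             ereal (r powr (- real k - \<alpha>) * rescale (\<lambda>\<eta>. T \<eta> - fun_distr P \<eta>) a r \<theta>)"
  have pw: "r powr (- real k - \<alpha>) * y \<le> c \<longleftrightarrow> y \<le> c * r powr (real k + \<alpha>)" if "r > 0" for r y c :: real
  proof -
    have "r powr (- real k - \<alpha>) = inverse (r powr (real k + \<alpha>))"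
      using powr_minus[of r "real k + \<alpha>"] by simp
    then show ?thesis
      using pos_divide_le_eq[of "r powr (real k + \<alpha>)" y c] that by (simp add: divide_inverse mult.commute)
  qed
  {
    assume "nu_pt_differentiable i p k \<alpha> T a"
    then obtain P where P: "poly_fun k P" "Limsup (at_right 0) (?X P) < \<infinity>"
      unfolding nu_pt_differentiable_def by blast
    then obtain N :: nat where "Limsup (at_right 0) (?X P) < ereal (real N)"
      using less_PInf_Ex_of_nat less_imp_neq[OF P(2)] by blast
    then have "eventually (\<lambda>r. ?X P r < ereal (real N)) (at_right 0)" by (rule Limsup_lessD)
    then obtain r1 where r1: "r1 > 0" "\<And>r. 0 < r \<Longrightarrow> r < r1 \<Longrightarrow> ?X P r < ereal (real N)"
      unfolding eventually_at_right_field by auto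
    obtain n1 where n1: "norm a \<le> real n1" using real_arch_simple by blast
    obtain n2 where n2: "1 / r1 \<le> real n2" using real_arch_simple by blast
    define j where "j = N + n1 + n2"
    have j: "norm a \<le> real j" "real N \<le> real j" "1 / real (Suc j) \<le> r1"
    proof -
      show "norm a \<le> real j" "real N \<le> real j" using n1 by (auto simp: j_def)
      have "1 / r1 \<le> real (Suc j)" using n2 by (simp add: j_def)
      then show "1 / real (Suc j) \<le> r1" using r1(1) by (simp add: field_simps)
    qed
    have "rescale (\<lambda>\<eta>. T \<eta> - fun_distr P \<eta>) a r \<theta> \<le> real j * r powr (real k + \<alpha>)"
      if r: "0 < r" "r < 1 / real (Suc j)" and \<theta>: "\<theta> \<in> unit_tests" "\<nu> i p \<theta> \<le> 1" for r \<theta>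
    proof -
      have "ereal (r powr (- real k - \<alpha>) * rescale (\<lambda>\<eta>. T \<eta> - fun_distr P \<eta>) a r \<theta>) \<le> ?X P r"
        by (rule SUP_upper) (use \<theta> in simp)
      also have "\<dots> < ereal (real N)" by (rule r1(2)) (use r j in auto)
      finally have "r powr (- real k - \<alpha>) * rescale (\<lambda>\<eta>. T \<eta> - fun_distr P \<eta>) a r \<theta> \<le> real j"
        using j(2) by simp
      then show ?thesis by (simp only: pw[OF r(1)])
    qed
    then have "approximates i p k \<alpha> T (real j) (1 / real (Suc j)) a P"
      using P(1) by (simp add: approximates_def)
    then show "\<exists>j. norm a \<le> real j \<and> (\<exists>P. approximates i p k \<alpha> T (real j) (1 / real (Suc j)) a P)"
      using j(1) by blast
  next
    assume "\<exists>j. norm a \<le> real j \<and> (\<exists>P. approximates i p k \<alpha> T (real j) (1 / real (Suc j)) a P)"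
    then obtain j P where P: "poly_fun k P"
      and b: "\<And>r \<theta>. 0 < r \<Longrightarrow> r < 1 / real (Suc j) \<Longrightarrow> \<theta> \<in> unit_tests \<Longrightarrow> \<nu> i p \<theta> \<le> 1 \<Longrightarrow>
      rescale (\<lambda>\<eta>. T \<eta> - fun_distr P \<eta>) a r \<theta> \<le> real j * r powr (real k + \<alpha>)"
      unfolding approximates_def by blast
    have "eventually (\<lambda>r. ?X P r \<le> ereal (real j)) (at_right 0)"
      unfolding eventually_at_right_field
    proof (intro exI[of _ "1 / real (Suc j)"] conjI allI impI)
      fix r :: real assume r: "0 < r" "r < 1 / real (Suc j)"
      show "?X P r \<le> ereal (real j)"
        by (rule SUP_least) (use b[OF r] pw[OF r(1)] in auto)
    qed simp
    then have "Limsup (at_right 0) (?X P) \<le> ereal (real j)" by (rule Limsup_bounded)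
    then have "Limsup (at_right 0) (?X P) < \<infinity>" by (rule le_less_trans) simp
    then show "nu_pt_differentiable i p k \<alpha> T a"
      using P unfolding nu_pt_differentiable_def by blast
  }
qed

theorem theorem3:
  fixes T :: "(real^'n \<Rightarrow> 'b::banach) \<Rightarrow> real"
    and i k :: nat and \<alpha> p :: real
    and A :: "(real^'n) set"
  assumes "0 < \<alpha>" and "\<alpha> \<le> 1" and "1 \<le> p"
    and "distribution T"
    and "A = {a. nu_pt_differentiable i p k \<alpha> T a}"
  shows "\<exists>(f :: nat \<Rightarrow> real^'n \<Rightarrow> ('b \<Rightarrow>\<^sub>L real)) (C :: nat \<Rightarrow> (real^'n) set).
    (\<forall>j. of_class k \<alpha> (f j)) \<and>
    (\<forall>j. compact (C j)) \<and>
    A = (\<Union>j. C j) \<and>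
    (\<forall>j. \<forall>a\<in>C j. \<forall>m\<le>k. pt_deriv k T m a = higher_deriv m (f j) a)"
proof -
  define C where "C = (\<lambda>j. {a. norm a \<le> real j \<and>
    (\<exists>P. approximates i p k \<alpha> T (real j) (1 / real (Suc j)) a P)})"
  have "compact (C j) \<and> (\<exists>f. of_class k \<alpha> f \<and> (\<forall>a\<in>C j. \<forall>m\<le>k. pt_deriv k T m a = higher_deriv m f a))" for j
    unfolding C_def
    by (rule uniform_approximation_set[OF assms(1-3) distribution_locally_finite_order[OF assms(4)]]) simp
  then obtain f where "\<And>j. compact (C j)" "\<And>j. of_class k \<alpha> (f j)"
    "\<And>j a m. a \<in> C j \<Longrightarrow> m \<le> k \<Longrightarrow> pt_deriv k T m a = higher_deriv m (f j) a" by metis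
  moreover have "A = (\<Union>j. C j)"
    unfolding assms(5) nu_pt_differentiable_iff C_def by auto
  ultimately show ?thesis by (intro exI[of _ f] exI[of _ C]) simp
qed

end
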